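(* There exist two absolute constants $\gamma,\gamma'\in(0,1)$ such that for all $\epsilon\in\left[(\log n/\Delta)^{\gamma'},\gamma\right]$ one can maintain, with high probability, a proper $(1+\epsilon)\Delta$-edge-coloring in a dynamic graph $G$ on $n$ nodes of maximum degree $\Delta=\omega(\log n)$, with $O(\mathrm{poly}(1/\epsilon))$ expected recourse per update.
   Context: Dynamic edge coloring with recourse (oblivious adversary): the input graph $G$ on a fixed set of $n$ nodes changes through a sequence of $\mathrm{poly}(n)$ updates fixed in advance by an adversary (independently of the algorithm's random choices); each update inserts or deletes one edge, and the maximum degree of $G$ remains at most $\Delta$ at all times. The algorithm knows $n$ and $\Delta$. After each update the algorithm must hold a proper edge coloring of the current graph (no two edges sharing an endpoint have the same color). The recourse of an update is the number of edges whose color changes as a result of that update. "With high probability" means with probability at least $1-1/n^{c}$ for some constant $c>0$. *)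

theory Defs
  imports "HOL-Probability.Probability" "HOL-Library.Landau_Symbols"
begin

text \<open>Simple graphs on the node set \<open>{..<n}\<close>, represented by their sets of edges; an edge is a
  two-element set of nodes.\<close>

type_synonym edge = "nat set"
type_synonym graph = "edge set"

definition graph_on :: "nat \<Rightarrow> graph \<Rightarrow> bool" where
  "graph_on n G \<longleftrightarrow> (\<forall>e\<in>G. e \<subseteq> {..<n} \<and> card e = 2)"

definition node_degree :: "graph \<Rightarrow> nat \<Rightarrow> nat" where
  "node_degree G v = card {e \<in> G. v \<in> e}"

definition max_degree_le :: "nat \<Rightarrow> graph \<Rightarrow> nat \<Rightarrow> bool" where
  "max_degree_le n G D \<longleftrightarrow> (\<forall>v<n. node_degree G v \<le> D)"

datatype graph_update = Insert edge | Delete edge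

fun apply_update :: "graph_update \<Rightarrow> graph \<Rightarrow> graph" where
  "apply_update (Insert e) G = insert e G"
| "apply_update (Delete e) G = G - {e}"

fun proper_update :: "graph_update \<Rightarrow> graph \<Rightarrow> bool" where
  "proper_update (Insert e) G \<longleftrightarrow> e \<notin> G"
| "proper_update (Delete e) G \<longleftrightarrow> e \<in> G"

definition graph_after :: "graph \<Rightarrow> graph_update list \<Rightarrow> graph" where
  "graph_after G0 us = fold apply_update us G0"

definition dynamic_graph :: "nat \<Rightarrow> nat \<Rightarrow> graph \<Rightarrow> graph_update list \<Rightarrow> bool" where
  "dynamic_graph n D G0 us \<longleftrightarrow>
     (\<forall>i\<le>length us. graph_on n (graph_after G0 (take i us)) \<and>
                    max_degree_le n (graph_after G0 (take i us)) D) \<and>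
     (\<forall>i<length us. proper_update (us ! i) (graph_after G0 (take i us)))"

text \<open>A colouring is a function on all potential edges; its values outside the current graph are
  irrelevant.\<close>

definition proper_edge_coloring :: "graph \<Rightarrow> (edge \<Rightarrow> nat) \<Rightarrow> bool" where
  "proper_edge_coloring G \<phi> \<longleftrightarrow>
     (\<forall>e\<in>G. \<forall>f\<in>G. e \<noteq> f \<and> e \<inter> f \<noteq> {} \<longrightarrow> \<phi> e \<noteq> \<phi> f)"

definition proper_k_edge_coloring :: "nat \<Rightarrow> graph \<Rightarrow> (edge \<Rightarrow> nat) \<Rightarrow> bool" where
  "proper_k_edge_coloring k G \<phi> \<longleftrightarrow> proper_edge_coloring G \<phi> \<and> \<phi> ` G \<subseteq> {..<k}"

text \<open>The number of edges of the new graph \<open>G'\<close> that do not keep their previous colour. A newly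
  inserted edge is counted as changing from uncoloured to coloured.\<close>

definition recourse :: "graph \<Rightarrow> (edge \<Rightarrow> nat) \<Rightarrow> graph \<Rightarrow> (edge \<Rightarrow> nat) \<Rightarrow> nat" where
  "recourse G \<phi> G' \<phi>' = card {e \<in> G'. e \<notin> G \<or> \<phi>' e \<noteq> \<phi> e}"

text \<open>A randomized online algorithm: a random seed is drawn once, and \<open>coloring A r G0 us\<close> is the
  colouring held, under seed \<open>r\<close>, when the initial graph is \<open>G0\<close> and \<open>us\<close> are the updates seen so
  far. Since the colouring is a function of the past updates only, the algorithm is
  non-anticipating. The adversary is oblivious because the probabilities and expectations below
  are taken for fixed \<open>G0\<close> and \<open>us\<close>.\<close>

record 'r online_algorithm =
  seed :: "'r measure"
  coloring :: "'r \<Rightarrow> graph \<Rightarrow> graph_update list \<Rightarrow> edge \<Rightarrow> nat"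

definition randomized_algorithm :: "'r online_algorithm \<Rightarrow> bool" where
  "randomized_algorithm A \<longleftrightarrow>
     prob_space (seed A) \<and>
     (\<forall>G0 us e. (\<lambda>r. coloring A r G0 us e) \<in> measurable (seed A) (count_space UNIV))"

definition always_proper :: "'r online_algorithm \<Rightarrow> graph \<Rightarrow> graph_update list \<Rightarrow> bool" where
  "always_proper A G0 us \<longleftrightarrow>
     (\<forall>r \<in> space (seed A). \<forall>i\<le>length us.
        proper_edge_coloring (graph_after G0 (take i us)) (coloring A r G0 (take i us)))"

definition prob_maintains ::
    "'r online_algorithm \<Rightarrow> nat \<Rightarrow> graph \<Rightarrow> graph_update list \<Rightarrow> real" where
  "prob_maintains A k G0 us =
     measure (seed A) {r \<in> space (seed A). \<forall>i\<le>length us.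
        proper_k_edge_coloring k (graph_after G0 (take i us)) (coloring A r G0 (take i us))}"

text \<open>Expected recourse of the update \<open>us ! i\<close>.\<close>

definition expected_recourse ::
    "'r online_algorithm \<Rightarrow> graph \<Rightarrow> graph_update list \<Rightarrow> nat \<Rightarrow> real" where
  "expected_recourse A G0 us i =
     (\<integral>r. real (recourse
        (graph_after G0 (take i us)) (coloring A r G0 (take i us))
        (graph_after G0 (take (Suc i) us)) (coloring A r G0 (take (Suc i) us))) \<partial>(seed A))"

end

theory Submission
  imports Defs "HOL-Real_Asymp.Real_Asymp"
begin

text \<open>The colour of an edge is, for almost all edges, a function of the current graph and the random
  seed alone, so its recourse is a matter of how sensitive that function is to one edge update.

  Every edge draws a random group, which splits the graph into about \<open>\<Delta> \<theta>^12\<close> groups of degree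
  at most \<open>D \<approx> 1 / \<theta>^12\<close>, and each group is coloured by an independent nibble with \<open>D\<close> colours of
  its own. The nibble is a random process on the linear 3-uniform hypergraph whose hyperedges are the
  pairs (edge, colour). In every round each live hyperedge is selected with a small probability,
  and dummy events pad the death probability of every vertex to a fixed \<open>1 - exp (-\<theta>)\<close>.
  Hence \<open>exp (\<theta> b |X|)\<close> times the probability that a set \<open>X\<close> of vertices survives \<open>b\<close> rounds stays
  close to \<open>1\<close> for all small \<open>X\<close>, and this controls all moments of the number of live hyperedges at a
  vertex. It follows that an edge stays uncoloured with probability \<open>O(\<theta>)\<close> and, because a
  disagreement between the runs on two graphs spawns only \<open>O(\<theta>)\<close> new ones per round in
  expectation during the \<open>ln (1 / \<theta>) / \<theta>\<close> rounds, that one edge update changes only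
  \<open>poly (1 / \<theta>)\<close> colours in expectation.

  Since \<open>D\<close> does not depend on \<open>n\<close>, no concentration is needed inside a group. The independence of
  the groups, and of the labels, yields with high probability that at most \<open>O(\<theta> \<Delta>)\<close> edges are left
  over at every node, and these are coloured greedily with \<open>O(\<theta> \<Delta>)\<close> further colours.\<close>

subsection \<open>Expectations over finitely supported distributions\<close>

text \<open>The exponents come from two competing demands. A factorial moment of order
  \<open>k\<close> bounds the chance that a vertex exceeds its capacity by
  \<open>2 / (1 + \<theta>) ^ k\<close>. Overload and disagreement are correlated, so a union bound
  is taken over everything a disagreement can reach in \<open>T\<close> rounds, up to
  \<open>(2 * D + 1) ^ T\<close> vertices; with \<open>D\<close> polynomial in
  \<open>1 / \<theta>\<close>, a \<open>k\<close> of about \<open>1 / \<theta> ^ 4\<close> beats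
  this. Conversely \<open>k\<close> pairs of vertices must survive nearly independently, so the
  capacity, which sinks to about \<open>D * \<theta> ^ 2\<close>, has to dominate
  \<open>k ^ 2 * ln (1 / \<theta>)\<close>; this leads to \<open>D\<close> of about
  \<open>1 / \<theta> ^ 12\<close>.

  The price of a \<open>D\<close> independent of \<open>n\<close> is that nodes can exceed degree
  \<open>D\<close> in some of their groups. Edges with such an endpoint join the leftover. Overload
  at \<open>v\<close> itself is handled by a union bound over sets of groups. Overload at the other
  endpoints is harder, since neighbours of \<open>v\<close> share edges; a splitting of those edges
  into two families of disjoint sets restores independence.

  Only the leftover is coloured depending on the history, and an edge that stays in it keeps its
  colour, so the greedy part adds no recourse beyond the edges whose status changes.\<close>

abbreviation expect :: "'a pmf \<Rightarrow> ('a \<Rightarrow> real) \<Rightarrow> real" where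
  "expect \<equiv> measure_pmf.expectation"

lemma expect_bind:
  assumes "finite (set_pmf p)" "\<And>x. x \<in> set_pmf p \<Longrightarrow> finite (set_pmf (q x))"
  shows "expect (bind_pmf p q) f = expect p (\<lambda>x. expect (q x) f)"
proof -
  have "expect (bind_pmf p q) f = (\<Sum>a\<in>set_pmf p. pmf p a *\<^sub>R expect (q a) f)"
    using assms by (intro pmf_expectation_bind) auto
  also have "\<dots> = expect p (\<lambda>x. expect (q x) f)"
    using assms(1) by (subst integral_measure_pmf[of "set_pmf p"]) auto
  finally show ?thesis .
qed

lemma expect_pair:
  assumes "finite (set_pmf p)" "finite (set_pmf q)"
  shows "expect (pair_pmf p q) f = expect p (\<lambda>x. expect q (\<lambda>y. f (x, y)))"
  using assms by (simp add: pair_pmf_def expect_bind)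

lemma expect_mono:
  assumes "finite (set_pmf p)" "\<And>x. x \<in> set_pmf p \<Longrightarrow> f x \<le> g x"
  shows "expect p f \<le> expect p g"
  using assms by (intro integral_mono_AE integrable_measure_pmf_finite) (auto simp: AE_measure_pmf_iff)

lemma expect_nonneg: "(\<And>x. x \<in> set_pmf p \<Longrightarrow> 0 \<le> f x) \<Longrightarrow> 0 \<le> expect p f"
  by (intro integral_nonneg_AE) (auto simp: AE_measure_pmf_iff)

lemma expect_cong: "(\<And>x. x \<in> set_pmf p \<Longrightarrow> f x = g x) \<Longrightarrow> expect p f = expect p g"
  by (intro integral_cong_AE) (auto simp: AE_measure_pmf_iff)

lemma expect_le:
  assumes "finite (set_pmf p)" "\<And>x. x \<in> set_pmf p \<Longrightarrow> f x \<le> c"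
  shows "expect p f \<le> c"
  using expect_mono[OF assms(1), of f "\<lambda>_. c"] assms(2) by simp

lemma expect_add:
  "finite (set_pmf p) \<Longrightarrow> expect p (\<lambda>x. f x + g x) = expect p f + expect p g"
  by (intro Bochner_Integration.integral_add integrable_measure_pmf_finite)

lemma expect_sum:
  "finite (set_pmf p) \<Longrightarrow> expect p (\<lambda>x. \<Sum>i\<in>A. f i x) = (\<Sum>i\<in>A. expect p (f i))"
  by (intro Bochner_Integration.integral_sum integrable_measure_pmf_finite)

abbreviation pr :: "'a pmf \<Rightarrow> ('a \<Rightarrow> bool) \<Rightarrow> real" where
  "pr p Q \<equiv> measure_pmf.prob p {x. Q x}"

lemma pr_expect: "pr p Q = expect p (\<lambda>x. of_bool (Q x))"
proof -
  have "(\<lambda>x. of_bool (Q x) :: real) = indicat_real {x. Q x}" by (auto simp: indicator_def)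
  then show ?thesis by simp
qed

lemma pr_neg: "pr p (\<lambda>x. \<not> Q x) = 1 - pr p Q"
proof -
  have "pr p (\<lambda>x. \<not> Q x) = expect p (\<lambda>x. 1 - of_bool (Q x))"
    unfolding pr_expect by (intro expect_cong) auto
  also have "\<dots> = 1 - pr p Q"
    unfolding pr_expect by (subst Bochner_Integration.integral_diff)
      (auto intro: measure_pmf.integrable_const_bound[where B = 1])
  finally show ?thesis .
qed

lemma pr_mono: "(\<And>x. x \<in> set_pmf p \<Longrightarrow> Q x \<Longrightarrow> R x) \<Longrightarrow> pr p Q \<le> pr p R"
  by (intro measure_pmf.finite_measure_mono_AE) (auto simp: AE_measure_pmf_iff)

lemma pr_UN_le:
  assumes "finite A"
  shows "pr p (\<lambda>x. \<exists>i\<in>A. Q i x) \<le> (\<Sum>i\<in>A. pr p (Q i))"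
proof -
  have "{x. \<exists>i\<in>A. Q i x} = (\<Union>i\<in>A. {x. Q i x})" by auto
  then show ?thesis using measure_pmf.finite_measure_subadditive_finite[of A "\<lambda>i. {x. Q i x}" p] assms by auto
qed

lemma pr_markov:
  assumes "finite (set_pmf p)" "\<And>x. x \<in> set_pmf p \<Longrightarrow> 0 \<le> f x"
    and "\<And>x. x \<in> set_pmf p \<Longrightarrow> Q x \<Longrightarrow> c \<le> f x" "0 < c"
  shows "pr p Q \<le> expect p f / c"
proof -
  have "c * pr p Q = expect p (\<lambda>x. c * of_bool (Q x))"
    by (simp add: pr_expect)
  also have "\<dots> \<le> expect p f"
    using assms by (intro expect_mono) (auto simp: of_bool_def)
  finally show ?thesis using \<open>0 < c\<close> by (simp add: field_simps)
qed

lemma expect_card_le_sum_pr: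
  assumes "finite (set_pmf p)" "finite A" "\<And>x. x \<in> set_pmf p \<Longrightarrow> S x \<subseteq> A"
  shows "expect p (\<lambda>x. real (card (S x))) = (\<Sum>a\<in>A. pr p (\<lambda>x. a \<in> S x))"
proof -
  have "expect p (\<lambda>x. real (card (S x))) = expect p (\<lambda>x. \<Sum>a\<in>A. of_bool (a \<in> S x))"
  proof (rule expect_cong)
    fix x assume "x \<in> set_pmf p"
    then have "A \<inter> S x = S x" using assms(3) by auto
    then show "real (card (S x)) = (\<Sum>a\<in>A. of_bool (a \<in> S x))"
      using assms(2) by (simp add: of_bool_def sum.If_cases)
  qed
  also have "\<dots> = (\<Sum>a\<in>A. pr p (\<lambda>x. a \<in> S x))"
    using assms(1) by (simp add: expect_sum pr_expect)
  finally show ?thesis .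
qed

subsection \<open>Products and independence\<close>

definition depends_on :: "'i set \<Rightarrow> (('i \<Rightarrow> 'b) \<Rightarrow> 'c) \<Rightarrow> bool" where
  "depends_on S F \<longleftrightarrow> (\<forall>\<omega> \<omega>'. (\<forall>i\<in>S. \<omega> i = \<omega>' i) \<longrightarrow> F \<omega> = F \<omega>')"

lemma finite_set_Pi_pmf:
  assumes "finite I" "\<And>i. i \<in> I \<Longrightarrow> finite (set_pmf (p i))"
  shows "finite (set_pmf (Pi_pmf I d p))"
  using assms by (simp add: set_Pi_pmf finite_PiE_dflt)

lemma expect_Pi_split:
  assumes "finite A" "finite B" "A \<inter> B = {}"
    and fin: "\<And>i. i \<in> A \<union> B \<Longrightarrow> finite (set_pmf (p i))"
  shows "expect (Pi_pmf (A \<union> B) d p) F =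
    expect (Pi_pmf A d p) (\<lambda>f. expect (Pi_pmf B d p) (\<lambda>g. F (\<lambda>x. if x \<in> A then f x else g x)))"
proof -
  have "finite (set_pmf (Pi_pmf A d p))" "finite (set_pmf (Pi_pmf B d p))"
    using assms by (auto intro!: finite_set_Pi_pmf)
  then show ?thesis
    by (simp add: Pi_pmf_union[OF assms(1-3)] expect_pair case_prod_unfold cong: if_cong)
qed

lemma expect_Pi_indep:
  fixes F G :: "('i \<Rightarrow> 'b) \<Rightarrow> real"
  assumes I: "finite I" "A \<subseteq> I" "B \<subseteq> I" "A \<inter> B = {}"
    and fin: "\<And>i. i \<in> I \<Longrightarrow> finite (set_pmf (p i))"
    and F: "depends_on A F" and G: "depends_on B G"
  shows "expect (Pi_pmf I d p) (\<lambda>\<omega>. F \<omega> * G \<omega>) = expect (Pi_pmf I d p) F * expect (Pi_pmf I d p) G"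
proof -
  have IA: "I = A \<union> (I - A)" using I by auto
  have fA: "finite A" "finite (I - A)" using I finite_subset by auto
  have sp: "expect (Pi_pmf I d p) H =
    expect (Pi_pmf A d p) (\<lambda>f. expect (Pi_pmf (I-A) d p) (\<lambda>g. H (\<lambda>x. if x \<in> A then f x else g x)))" for H
    by (subst IA, rule expect_Pi_split) (use fA fin I in auto)
  have F': "F (\<lambda>x. if x \<in> A then f x else g x) = F f" for f g
    using F by (auto simp: depends_on_def)
  have G': "G (\<lambda>x. if x \<in> A then f x else g x) = G g" for f g
    using G I(4) unfolding depends_on_def by (elim allE impE) (auto simp: disjoint_iff)
  show ?thesis unfolding sp F' G' by simp
qed

lemma expect_Pi_prod_indep:
  fixes F :: "'k \<Rightarrow> ('i \<Rightarrow> 'b) \<Rightarrow> real"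
  assumes "finite K" "finite I" "\<And>k. k \<in> K \<Longrightarrow> S k \<subseteq> I" "disjoint_family_on S K"
    and fin: "\<And>i. i \<in> I \<Longrightarrow> finite (set_pmf (p i))"
    and "\<And>k. k \<in> K \<Longrightarrow> depends_on (S k) (F k)"
  shows "expect (Pi_pmf I d p) (\<lambda>\<omega>. \<Prod>k\<in>K. F k \<omega>) = (\<Prod>k\<in>K. expect (Pi_pmf I d p) (F k))"
  using assms(1,3,4,6)
proof (induction K rule: finite_induct)
  case (insert k K)
  have "expect (Pi_pmf I d p) (\<lambda>\<omega>. F k \<omega> * (\<Prod>k\<in>K. F k \<omega>)) =
     expect (Pi_pmf I d p) (F k) * expect (Pi_pmf I d p) (\<lambda>\<omega>. \<Prod>k\<in>K. F k \<omega>)"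
  proof (rule expect_Pi_indep[of I "S k" "\<Union>(S ` K)"])
    show "S k \<inter> \<Union> (S ` K) = {}"
      using insert by (auto simp: disjoint_family_on_def)
    show "depends_on (\<Union> (S ` K)) (\<lambda>\<omega>. \<Prod>k\<in>K. F k \<omega>)"
      unfolding depends_on_def
    proof (intro allI impI prod.cong refl)
      fix \<omega> \<omega>' :: "'i \<Rightarrow> 'b" and k assume "\<forall>i\<in>\<Union> (S ` K). \<omega> i = \<omega>' i" "k \<in> K"
      then show "F k \<omega> = F k \<omega>'" using insert.prems(3)[of k] by (auto simp: depends_on_def)
    qed
  qed (use insert assms in auto)
  then show ?case using insert by (simp add: disjoint_family_on_def)
qed auto

lemma exp_le_quadratic:
  assumes "0 \<le> x" "x \<le> (1::real)" shows "exp x \<le> 1 + x + x\<^sup>2"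
  using exp_bound assms by auto

text \<open>The chord of the convex function \<open>exp\<close> over \<open>[0, l]\<close> lies
  above its graph. The moment generating function of a variable in \<open>[0, 1]\<close> is thereby
  controlled by its mean alone.\<close>

lemma exp_convex_bound:
  assumes "0 \<le> x" "x \<le> (1::real)" "0 \<le> l"
  shows "exp (l * x) \<le> 1 + x * (exp l - 1)"
proof -
  have "convex_on UNIV (exp :: real \<Rightarrow> real)"
    by (rule f''_ge0_imp_convex[where f' = exp and f'' = exp]) (auto intro!: derivative_eq_intros)
  then have "exp ((1 - x) *\<^sub>R 0 + x *\<^sub>R l) \<le> (1 - x) * exp 0 + x * exp l"
    using assms by (intro convex_onD) auto
  then show ?thesis by (simp add: algebra_simps)
qed

text \<open>Exponential Markov inequality, with \<open>exp l - 1\<close> bounded by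
  \<open>l + l\<^sup>2\<close>. The parameter \<open>l\<close> stays free because two regimes occur:
  \<open>l = 1\<close> for thresholds above twice the mean, and \<open>l\<close> proportional to
  \<theta> for excesses by a relative \<theta>. The summands may read whole disjoint blocks of
  coordinates.\<close>

lemma chernoff_Pi_pmf:
  fixes F :: "'k \<Rightarrow> ('i \<Rightarrow> 'b) \<Rightarrow> real"
  assumes K: "finite K" and I: "finite I" "\<And>k. k \<in> K \<Longrightarrow> S k \<subseteq> I" "disjoint_family_on S K"
    and fin: "\<And>i. i \<in> I \<Longrightarrow> finite (set_pmf (p i))"
    and dep: "\<And>k. k \<in> K \<Longrightarrow> depends_on (S k) (F k)"
    and F01: "\<And>k \<omega>. k \<in> K \<Longrightarrow> \<omega> \<in> set_pmf (Pi_pmf I d p) \<Longrightarrow> F k \<omega> \<in> {0..1}"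
    and mean: "\<And>k. k \<in> K \<Longrightarrow> expect (Pi_pmf I d p) (F k) \<le> \<beta> k"
    and l: "0 \<le> l" "l \<le> 1"
  shows "pr (Pi_pmf I d p) (\<lambda>\<omega>. s \<le> (\<Sum>k\<in>K. F k \<omega>)) \<le> exp ((l + l\<^sup>2) * (\<Sum>k\<in>K. \<beta> k) - l * s)"
proof -
  let ?P = "Pi_pmf I d p"
  have fP: "finite (set_pmf ?P)" using I fin by (intro finite_set_Pi_pmf)
  have one: "expect ?P (\<lambda>\<omega>. exp (l * F k \<omega>)) \<le> exp ((l + l\<^sup>2) * \<beta> k)" if "k \<in> K" for k
  proof -
    have "expect ?P (\<lambda>\<omega>. exp (l * F k \<omega>)) \<le> expect ?P (\<lambda>\<omega>. 1 + F k \<omega> * (exp l - 1))"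
      using F01[OF that] l fP by (intro expect_mono exp_convex_bound) auto
    also have "\<dots> = 1 + expect ?P (F k) * (exp l - 1)"
      using fP by (simp add: expect_add)
    also have "\<dots> \<le> exp (expect ?P (F k) * (exp l - 1))"
      by (rule exp_ge_add_one_self)
    also have "\<dots> \<le> exp (\<beta> k * (l + l\<^sup>2))"
    proof -
      have "0 \<le> expect ?P (F k)" using F01[OF that] by (intro expect_nonneg) auto
      moreover have "0 \<le> exp l - 1" using l by simp
      moreover have "exp l - 1 \<le> l + l\<^sup>2" using exp_le_quadratic[OF l] by simp
      ultimately show ?thesis using mean[OF that]
        by (intro exp_mono mult_mono order_trans[OF _ mean[OF that]]) auto
    qed
    finally show ?thesis by (simp add: mult.commute)
  qed
  have "pr ?P (\<lambda>\<omega>. s \<le> (\<Sum>k\<in>K. F k \<omega>)) \<le> expect ?P (\<lambda>\<omega>. \<Prod>k\<in>K. exp (l * F k \<omega>)) / exp (l * s)"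
  proof (rule pr_markov[OF fP])
    fix \<omega> assume "s \<le> (\<Sum>k\<in>K. F k \<omega>)"
    then have "l * s \<le> (\<Sum>k\<in>K. l * F k \<omega>)" using l by (simp add: mult_left_mono flip: sum_distrib_left)
    then show "exp (l * s) \<le> (\<Prod>k\<in>K. exp (l * F k \<omega>))" using K by (simp flip: exp_sum)
  qed (auto intro: prod_nonneg)
  also have "expect ?P (\<lambda>\<omega>. \<Prod>k\<in>K. exp (l * F k \<omega>)) = (\<Prod>k\<in>K. expect ?P (\<lambda>\<omega>. exp (l * F k \<omega>)))"
    by (rule expect_Pi_prod_indep[OF K I fin]) (use dep in \<open>auto simp: depends_on_def\<close>)
  also have "\<dots> \<le> (\<Prod>k\<in>K. exp ((l + l\<^sup>2) * \<beta> k))"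
    using one by (intro prod_mono conjI expect_nonneg) auto
  also have "\<dots> = exp ((l + l\<^sup>2) * (\<Sum>k\<in>K. \<beta> k))"
    using K by (simp add: exp_sum sum_distrib_left)
  finally show ?thesis by (simp add: exp_diff divide_right_mono)
qed

subsection \<open>Independent coins\<close>

definition coins :: "'i set \<Rightarrow> real \<Rightarrow> ('i \<Rightarrow> bool) pmf" where
  "coins I q = Pi_pmf I False (\<lambda>_. bernoulli_pmf q)"

lemma finite_set_coins: "finite I \<Longrightarrow> finite (set_pmf (coins I q))"
  unfolding coins_def by (rule finite_set_Pi_pmf) auto

lemma pr_coins_pattern:
  assumes "finite I" "S \<subseteq> I" "R \<subseteq> I" "S \<inter> R = {}" "0 \<le> q" "q \<le> 1"
  shows "pr (coins I q) (\<lambda>\<omega>. (\<forall>i\<in>S. \<not> \<omega> i) \<and> (\<forall>i\<in>R. \<omega> i)) = (1 - q) ^ card S * q ^ card R"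
proof -
  define B where "B i = (if i \<in> S then {False} else if i \<in> R then {True} else UNIV)" for i
  have fS: "finite S" "finite R" using assms by (auto intro: finite_subset)
  have "pr (coins I q) (\<lambda>\<omega>. (\<forall>i\<in>S. \<not> \<omega> i) \<and> (\<forall>i\<in>R. \<omega> i)) = measure_pmf.prob (coins I q) (Pi I B)"
    using assms by (intro arg_cong[where f = "measure_pmf.prob _"]) (auto simp: B_def Pi_def)
  also have "\<dots> = (\<Prod>i\<in>I. measure_pmf.prob (bernoulli_pmf q) (B i))"
    unfolding coins_def using assms by (intro measure_Pi_pmf_Pi)
  also have "\<dots> = (\<Prod>i\<in>I. (if i \<in> S then 1 - q else 1) * (if i \<in> R then q else 1))"
    using assms by (intro prod.cong) (auto simp: B_def measure_pmf_single)
  also have "\<dots> = (1 - q) ^ card S * q ^ card R"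
    using assms by (simp add: prod.distrib prod.If_cases Int_absorb1)
  finally show ?thesis .
qed

lemma pr_coins_none:
  assumes "finite I" "S \<subseteq> I" "0 \<le> q" "q \<le> 1"
  shows "pr (coins I q) (\<lambda>\<omega>. \<forall>i\<in>S. \<not> \<omega> i) = (1 - q) ^ card S"
  using pr_coins_pattern[of I S "{}" q] assms by simp

lemma pr_coins_one:
  assumes "finite I" "S \<subseteq> I" "j \<in> I" "j \<notin> S" "0 \<le> q" "q \<le> 1"
  shows "pr (coins I q) (\<lambda>\<omega>. (\<forall>i\<in>S. \<not> \<omega> i) \<and> \<omega> j) = (1 - q) ^ card S * q"
  using pr_coins_pattern[of I S "{j}" q] assms by simp

lemma pr_coins_some_le:
  assumes "finite I" "S \<subseteq> I" "0 \<le> q" "q \<le> 1"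
  shows "pr (coins I q) (\<lambda>\<omega>. \<exists>i\<in>S. \<omega> i) \<le> q * card S"
proof -
  have "pr (coins I q) (\<lambda>\<omega>. \<exists>i\<in>S. \<omega> i) \<le> (\<Sum>i\<in>S. pr (coins I q) (\<lambda>\<omega>. \<omega> i))"
    using assms finite_subset by (intro pr_UN_le) auto
  also have "\<dots> = (\<Sum>i\<in>S. q)"
    using pr_coins_pattern[of I "{}" "{_}" q] assms by (intro sum.cong) auto
  finally show ?thesis by (simp add: mult.commute)
qed

subsection \<open>The nibble on a linear 3-uniform hypergraph\<close>

text \<open>Second-order inclusion-exclusion: adding the cardinalities overcounts by at most one per
  pair, and \<open>card X\<close> squared generously bounds the number of pairs.\<close>

lemma bonferroni_card:
  assumes "finite X" "\<And>x. x \<in> X \<Longrightarrow> finite (S x)"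
    and "\<And>x y. x \<in> X \<Longrightarrow> y \<in> X \<Longrightarrow> x \<noteq> y \<Longrightarrow> card (S x \<inter> S y) \<le> 1"
  shows "(\<Sum>x\<in>X. card (S x)) \<le> card (\<Union>x\<in>X. S x) + (card X)\<^sup>2"
  using assms
proof (induction X rule: finite_induct)
  case (insert x X)
  have fin: "finite (S y)" if "y \<in> insert x X" for y using insert.prems(1) that .
  have "card (S x \<inter> (\<Union>y\<in>X. S y)) \<le> (\<Sum>y\<in>X. card (S x \<inter> S y))"
    unfolding Int_UN_distrib by (rule card_UN_le[OF insert.hyps(1)])
  also have "\<dots> \<le> (\<Sum>y\<in>X. 1)"
    by (rule sum_mono, rule insert.prems(2)) (use insert.hyps(2) in auto)
  finally have "card (S x \<inter> (\<Union>y\<in>X. S y)) \<le> card X" by simp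
  moreover have "card (S x) + card (\<Union>y\<in>X. S y) = card (S x \<union> (\<Union>y\<in>X. S y)) + card (S x \<inter> (\<Union>y\<in>X. S y))"
    by (rule card_Un_Int) (use fin insert.hyps(1) in auto)
  moreover have "(\<Sum>y\<in>X. card (S y)) \<le> card (\<Union>y\<in>X. S y) + (card X)\<^sup>2"
    by (rule insert.IH) (use insert.prems in blast)+
  ultimately show ?case
    using insert.hyps by (simp add: power2_eq_square)
qed simp

section \<open>One round of the nibble\<close>

locale linear_hypergraph =
  fixes E :: "'x set set"
  assumes fin_E: "finite E"
    and card_edge: "h \<in> E \<Longrightarrow> card h = 3"
    and linear: "h \<in> E \<Longrightarrow> h' \<in> E \<Longrightarrow> h \<noteq> h' \<Longrightarrow> card (h \<inter> h') \<le> 1"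
begin

lemma finite_edge: "h \<in> E \<Longrightarrow> finite h"
  using card_edge by (metis card.infinite zero_neq_numeral)

lemma edge_unique:
  assumes "h \<in> E" "h' \<in> E" "x \<in> h" "x \<in> h'" "y \<in> h" "y \<in> h'" "x \<noteq> y"
  shows "h = h'"
proof (rule ccontr)
  assume "h \<noteq> h'"
  then have "card (h \<inter> h') \<le> 1" using linear assms by auto
  moreover have "card {x, y} \<le> card (h \<inter> h')"
    using assms finite_edge by (intro card_mono) auto
  ultimately show False using assms by simp
qed

text \<open>The condition does not ask for \<open>x\<close> itself to be in \<open>A\<close>, so
  that degrees also make sense at dead vertices. The comparison of two runs relies on this at
  vertices alive in only one of them.\<close>

definition nb :: "'x set \<Rightarrow> 'x \<Rightarrow> nat" where
  "nb A x = card {h \<in> E. x \<in> h \<and> h - {x} \<subseteq> A}"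

text \<open>The coins \<open>Inr (x, j)\<close> are dummies: together with the coins of the live hyperedges at \<open>x\<close>
  they make exactly \<open>max m (nb A x)\<close> coins that can kill \<open>x\<close>, so that the survival probability of
  \<open>x\<close> does not depend on \<open>nb A x\<close> unless \<open>nb A x > m\<close>.\<close>

definition killers :: "nat \<Rightarrow> 'x set \<Rightarrow> 'x \<Rightarrow> ('x set + 'x \<times> nat) set" where
  "killers m A x = Inl ` {h \<in> E. x \<in> h \<and> h \<subseteq> A} \<union> (\<lambda>j. Inr (x, j)) ` {nb A x..<m}"

definition step :: "nat \<Rightarrow> ('x set + 'x \<times> nat \<Rightarrow> bool) \<Rightarrow> 'x set \<Rightarrow> 'x set" where
  "step m \<omega> A = {x \<in> A. \<forall>i\<in>killers m A x. \<not> \<omega> i}"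

text \<open>A selection counts only if no intersecting live hyperedge is selected too, which makes
  the hits pairwise disjoint. The vertices of a selected live hyperedge die under
  \<open>step\<close> even if it is not a hit, so that death stays a plain test of coins.\<close>

definition hits :: "('x set + 'x \<times> nat \<Rightarrow> bool) \<Rightarrow> 'x set \<Rightarrow> 'x set set" where
  "hits \<omega> A = {h \<in> E. h \<subseteq> A \<and> \<omega> (Inl h) \<and>
     (\<forall>h'\<in>E. h' \<subseteq> A \<and> h' \<noteq> h \<and> h' \<inter> h \<noteq> {} \<longrightarrow> \<not> \<omega> (Inl h'))}"

lemma nb_alt: "x \<in> A \<Longrightarrow> nb A x = card {h \<in> E. x \<in> h \<and> h \<subseteq> A}"
  unfolding nb_def by (intro arg_cong[where f = card]) auto

lemma nb_mono: "A \<subseteq> B \<Longrightarrow> nb A x \<le> nb B x"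
  unfolding nb_def using fin_E by (intro card_mono) auto

lemma finite_killers: "finite (killers m A x)"
  unfolding killers_def using fin_E by auto

lemma card_killers:
  assumes "x \<in> A" shows "card (killers m A x) = max m (nb A x)"
proof -
  have "card (killers m A x) = card {h \<in> E. x \<in> h \<and> h \<subseteq> A} + card {nb A x..<m}"
    unfolding killers_def using fin_E
    by (subst card_Un_disjoint) (auto simp: card_image inj_on_def)
  then show ?thesis using nb_alt[OF assms] by auto
qed

text \<open>Dummy coins are private to their vertex, so a common killer is a live hyperedge through
  both vertices; linearity allows only one.\<close>

lemma card_killers_Int:
  assumes "x \<noteq> y" shows "card (killers m A x \<inter> killers m A y) \<le> 1"
proof -
  have "i = j" if ij: "i \<in> killers m A x \<inter> killers m A y" "j \<in> killers m A x \<inter> killers m A y" for i j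
  proof -
    obtain h h' where "i = Inl h" "j = Inl h'" "h \<in> E" "h' \<in> E" "x \<in> h" "y \<in> h" "x \<in> h'" "y \<in> h'"
      using ij assms by (auto simp: killers_def)
    then show ?thesis using edge_unique[of h h' x y] assms by simp
  qed
  then show ?thesis using finite_killers by (simp add: card_le_Suc0_iff_eq)
qed

text \<open>The padding gives every vertex at least \<open>m\<close> killers whatever
  \<open>A\<close> looks like, and overlaps cost at most the square of \<open>card X\<close>. Upper
  bounds on survival therefore hold for every alive set, whereas \<open>card_UN_killers_le\<close>,
  behind the lower bounds, needs degrees within the capacity.\<close>

lemma card_UN_killers_ge:
  assumes "finite X" "X \<subseteq> A"
  shows "card X * m \<le> card (\<Union>x\<in>X. killers m A x) + (card X)\<^sup>2"
proof -
  have "card X * m = (\<Sum>x\<in>X. m)" by simp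
  also have "\<dots> \<le> (\<Sum>x\<in>X. card (killers m A x))"
    using assms by (intro sum_mono) (auto simp: card_killers)
  also have "\<dots> \<le> card (\<Union>x\<in>X. killers m A x) + (card X)\<^sup>2"
    using assms by (intro bonferroni_card finite_killers card_killers_Int) auto
  finally show ?thesis .
qed

lemma card_UN_killers_le:
  assumes "finite X" "X \<subseteq> A" "\<And>x. x \<in> X \<Longrightarrow> nb A x \<le> m"
  shows "card (\<Union>x\<in>X. killers m A x) \<le> card X * m"
proof -
  have "card (\<Union>x\<in>X. killers m A x) \<le> (\<Sum>x\<in>X. card (killers m A x))"
    using assms by (intro card_UN_le)
  also have "\<dots> = (\<Sum>x\<in>X. m)"
    using assms by (intro sum.cong) (auto simp: card_killers)
  finally show ?thesis by simp
qed

lemma subset_step_iff: "X \<subseteq> step m \<omega> A \<longleftrightarrow> X \<subseteq> A \<and> (\<forall>i\<in>(\<Union>x\<in>X. killers m A x). \<not> \<omega> i)"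
  by (auto simp: step_def)

lemma step_subset: "step m \<omega> A \<subseteq> A" by (auto simp: step_def)

lemma hits_dead: "h \<in> hits \<omega> A \<Longrightarrow> h \<inter> step m \<omega> A = {}"
  by (auto simp: hits_def step_def killers_def)

lemma hits_disjoint: "h \<in> hits \<omega> A \<Longrightarrow> h' \<in> hits \<omega> A \<Longrightarrow> h \<noteq> h' \<Longrightarrow> h \<inter> h' = {}"
  by (auto simp: hits_def)

end

section \<open>Survival of small vertex sets over many rounds\<close>

text \<open>\<open>M b\<close> is the capacity in round \<open>b\<close>. A hyperedge at a vertex
  still counts after \<open>b\<close> rounds if its other two vertices survived, so a degree
  \<open>D\<close> should shrink to about \<open>D * exp (- 2 * \<delta> * b)\<close>;
  \<open>M_ge\<close> adds a relative headroom \<eta> and room for moments of order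
  \<open>k\<close>. \<open>error_le\<close> caps the total inclusion-exclusion error for sets of up
  to \<open>2 * k + 3\<close> vertices: \<open>k\<close> pairs plus the three vertices of one
  hyperedge.\<close>

locale nibble = linear_hypergraph E for E :: "'x set set" +
  fixes V :: "'x set" and M :: "nat \<Rightarrow> nat" and \<delta> \<eta> :: real and D k T :: nat
  assumes fin_V: "finite V"
    and \<delta>_nonneg: "0 \<le> \<delta>" and \<eta>_nonneg: "0 \<le> \<eta>"
    and M_ge: "b \<le> T \<Longrightarrow> (1 + \<eta>) * D * exp (- 2 * \<delta> * b) + k + 3 \<le> M b"
    and M_pos': "0 < M b"
    and error_le: "(2 * k + 3)\<^sup>2 * (\<Sum>b<T. \<delta> / M b) \<le> ln 2"
begin

definition coin_set :: "nat \<Rightarrow> ('x set + 'x \<times> nat) set" where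
  "coin_set b = Inl ` E \<union> Inr ` (V \<times> {..<M b})"

text \<open>Tuned so that \<open>M b\<close> coins all fail with probability exactly
  \<open>exp (- \<delta>)\<close>, which turns survival probabilities into exponentials of coin
  counts.\<close>

definition rate :: "nat \<Rightarrow> real" where "rate b = 1 - exp (- \<delta> / M b)"

definition round_pmf :: "nat \<Rightarrow> ('x set + 'x \<times> nat \<Rightarrow> bool) pmf" where
  "round_pmf b = coins (coin_set b) (rate b)"

text \<open>The most recent round is the head of the list.\<close>

fun seeds :: "nat \<Rightarrow> ('x set + 'x \<times> nat \<Rightarrow> bool) list pmf" where
  "seeds 0 = return_pmf []"
| "seeds (Suc b) = bind_pmf (seeds b) (\<lambda>\<omega>s. map_pmf (\<lambda>\<omega>. \<omega> # \<omega>s) (round_pmf b))"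

fun alive :: "'x set \<Rightarrow> ('x set + 'x \<times> nat \<Rightarrow> bool) list \<Rightarrow> 'x set" where
  "alive A [] = A"
| "alive A (\<omega> # \<omega>s) = step (M (length \<omega>s)) \<omega> (alive A \<omega>s)"

fun matching :: "'x set \<Rightarrow> ('x set + 'x \<times> nat \<Rightarrow> bool) list \<Rightarrow> 'x set set" where
  "matching A [] = {}"
| "matching A (\<omega> # \<omega>s) = matching A \<omega>s \<union> hits \<omega> (alive A \<omega>s)"

lemma finite_coin_set: "finite (coin_set b)"
  unfolding coin_set_def using fin_E fin_V by auto

lemma killers_subset: "x \<in> V \<Longrightarrow> killers (M b) A x \<subseteq> coin_set b"
  by (auto simp: killers_def coin_set_def)

lemma rate_bounds: "0 \<le> rate b" "rate b \<le> 1"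
  using \<delta>_nonneg by (auto simp: rate_def)

lemma rate_le: "rate b \<le> \<delta> / M b"
  using exp_ge_add_one_self[of "- \<delta> / M b"] by (simp add: rate_def)

lemma rate_compl: "(1 - rate b) ^ j = exp (- \<delta> / M b * j)"
  by (simp add: rate_def mult.commute flip: exp_of_nat_mult)

lemma finite_round: "finite (set_pmf (round_pmf b))"
  unfolding round_pmf_def by (rule finite_set_coins[OF finite_coin_set])

lemma finite_seeds: "finite (set_pmf (seeds b))"
  by (induction b) (auto simp: finite_round)

lemma length_seeds: "\<omega>s \<in> set_pmf (seeds b) \<Longrightarrow> length \<omega>s = b"
  by (induction b arbitrary: \<omega>s) auto

lemma expect_seeds_Suc:
  "expect (seeds (Suc b)) F = expect (seeds b) (\<lambda>\<omega>s. expect (round_pmf b) (\<lambda>\<omega>. F (\<omega> # \<omega>s)))"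
  by (simp add: expect_bind finite_seeds finite_round)

lemma alive_subset: "alive A \<omega>s \<subseteq> A"
  by (induction \<omega>s) (auto simp: step_def)

lemma matching_dead: "h \<in> matching A \<omega>s \<Longrightarrow> h \<inter> alive A \<omega>s = {}"
proof (induction \<omega>s)
  case (Cons \<omega> \<omega>s)
  then show ?case using hits_dead[of h \<omega> "alive A \<omega>s"] step_subset[of _ \<omega> "alive A \<omega>s"] by auto
qed auto

lemma matching_subset: "h \<in> matching A \<omega>s \<Longrightarrow> h \<in> E \<and> h \<subseteq> A"
proof (induction \<omega>s)
  case (Cons \<omega> \<omega>s)
  then show ?case using alive_subset[of A \<omega>s] by (auto simp: hits_def)
qed auto

lemma matching_disjoint:
  "h \<in> matching A \<omega>s \<Longrightarrow> h' \<in> matching A \<omega>s \<Longrightarrow> h \<noteq> h' \<Longrightarrow> h \<inter> h' = {}"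
proof (induction \<omega>s)
  case (Cons \<omega> \<omega>s)
  have "g \<inter> g' = {}" if "g \<in> matching A \<omega>s" "g' \<in> hits \<omega> (alive A \<omega>s)" for g g'
    using matching_dead[OF that(1)] that(2) by (auto simp: hits_def)
  with Cons show ?case using hits_disjoint[of h \<omega> "alive A \<omega>s" h'] by auto
qed auto

lemma pr_survive_step:
  assumes "finite X" "X \<subseteq> A" "A \<subseteq> V"
  shows "pr (round_pmf b) (\<lambda>\<omega>. X \<subseteq> step (M b) \<omega> A) =
    exp (- \<delta> / M b * card (\<Union>x\<in>X. killers (M b) A x))"
proof -
  have "pr (round_pmf b) (\<lambda>\<omega>. X \<subseteq> step (M b) \<omega> A) =
    pr (coins (coin_set b) (rate b)) (\<lambda>\<omega>. \<forall>i\<in>(\<Union>x\<in>X. killers (M b) A x). \<not> \<omega> i)"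
    using assms by (simp add: subset_step_iff round_pmf_def)
  also have "\<dots> = (1 - rate b) ^ card (\<Union>x\<in>X. killers (M b) A x)"
    using assms rate_bounds
    by (intro pr_coins_none finite_coin_set UN_least killers_subset) auto
  finally show ?thesis by (simp add: rate_compl)
qed

lemma pr_survive_step_le:
  assumes "finite X" "X \<subseteq> A" "A \<subseteq> V"
  shows "pr (round_pmf b) (\<lambda>\<omega>. X \<subseteq> step (M b) \<omega> A) \<le>
    exp (- \<delta> * card X + (card X)\<^sup>2 * (\<delta> / M b))"
proof -
  let ?u = "card (\<Union>x\<in>X. killers (M b) A x)"
  have "real (card X * M b) \<le> ?u + (card X)\<^sup>2"
    using card_UN_killers_ge[OF assms(1,2)] by (simp flip: of_nat_add del: of_nat_mult)
  then have "\<delta> / M b * (card X * M b) \<le> \<delta> / M b * (?u + (card X)\<^sup>2)"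
    using \<delta>_nonneg by (intro mult_left_mono) auto
  then have "\<delta> * card X \<le> \<delta> / M b * ?u + (card X)\<^sup>2 * (\<delta> / M b)"
    using M_pos'[of b] by (simp add: field_simps)
  then show ?thesis unfolding pr_survive_step[OF assms] by simp
qed

text \<open>The one-round bound depends on the history only through whether \<open>X\<close> is
  still alive, so the bounds multiply over the rounds.\<close>

lemma pr_survive_le_aux:
  assumes "finite X" "A \<subseteq> V"
  shows "pr (seeds b) (\<lambda>\<omega>s. X \<subseteq> alive A \<omega>s) \<le>
    exp (- \<delta> * b * card X + (card X)\<^sup>2 * (\<Sum>i<b. \<delta> / M i))"
proof (induction b)
  case (Suc b)
  let ?c = "exp (- \<delta> * card X + (card X)\<^sup>2 * (\<delta> / M b))"
  have "pr (seeds (Suc b)) (\<lambda>\<omega>s. X \<subseteq> alive A \<omega>s) =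
    expect (seeds b) (\<lambda>\<omega>s. pr (round_pmf b) (\<lambda>\<omega>. X \<subseteq> alive A (\<omega> # \<omega>s)))"
    unfolding pr_expect expect_seeds_Suc ..
  also have "\<dots> \<le> expect (seeds b) (\<lambda>\<omega>s. of_bool (X \<subseteq> alive A \<omega>s) * ?c)"
  proof (rule expect_mono[OF finite_seeds])
    fix \<omega>s assume "\<omega>s \<in> set_pmf (seeds b)"
    then have l: "length \<omega>s = b" by (rule length_seeds)
    show "pr (round_pmf b) (\<lambda>\<omega>. X \<subseteq> alive A (\<omega> # \<omega>s)) \<le> of_bool (X \<subseteq> alive A \<omega>s) * ?c"
    proof (cases "X \<subseteq> alive A \<omega>s")
      case True
      then show ?thesis
        using pr_survive_step_le[OF assms(1) True] alive_subset[of A \<omega>s] assms(2) l by simp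
    next
      case False
      then have "\<not> X \<subseteq> alive A (\<omega> # \<omega>s)" for \<omega>
        by (auto simp: step_def)
      then show ?thesis by simp
    qed
  qed
  also have "\<dots> = pr (seeds b) (\<lambda>\<omega>s. X \<subseteq> alive A \<omega>s) * ?c"
    by (simp add: pr_expect)
  also have "\<dots> \<le> exp (- \<delta> * b * card X + (card X)\<^sup>2 * (\<Sum>i<b. \<delta> / M i)) * ?c"
    using Suc by (intro mult_right_mono) auto
  also have "\<dots> = exp (- \<delta> * Suc b * card X + (card X)\<^sup>2 * (\<Sum>i<Suc b. \<delta> / M i))"
    by (simp add: algebra_simps flip: exp_add)
  finally show ?case .
qed auto

text \<open>By \<open>error_le\<close> the accumulated correction is at most \<open>ln 2\<close>: up
  to a factor 2, small sets survive no more often than independent vertices with survival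
  probability \<open>exp (- \<delta>)\<close> per round.\<close>

lemma pr_survive_le:
  assumes "finite X" "A \<subseteq> V" "b \<le> T" "card X \<le> 2 * k + 3"
  shows "pr (seeds b) (\<lambda>\<omega>s. X \<subseteq> alive A \<omega>s) \<le> 2 * exp (- \<delta> * b * card X)"
proof -
  have "(card X)\<^sup>2 * (\<Sum>i<b. \<delta> / M i) \<le> (2 * k + 3)\<^sup>2 * (\<Sum>i<T. \<delta> / M i)"
    using assms \<delta>_nonneg by (intro mult_mono sum_mono2 power_mono of_nat_mono sum_nonneg) auto
  then have "(card X)\<^sup>2 * (\<Sum>i<b. \<delta> / M i) \<le> ln 2" using error_le by simp
  then have "exp ((card X)\<^sup>2 * (\<Sum>i<b. \<delta> / M i)) \<le> 2"
    by (metis exp_le_cancel_iff exp_ln zero_less_numeral)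
  then have "exp (- \<delta> * b * card X) * exp ((card X)\<^sup>2 * (\<Sum>i<b. \<delta> / M i)) \<le> exp (- \<delta> * b * card X) * 2"
    by (intro mult_left_mono) auto
  then show ?thesis using pr_survive_le_aux[OF assms(1,2), of b]
    unfolding exp_add by linarith
qed

end

text \<open>\<open>fact k * (c choose k)\<close> is a falling factorial whose smallest factor is
  \<open>c + 1 - k\<close>.\<close>

lemma power_le_fact_binomial: "(c + 1 - k) ^ k \<le> fact k * (c choose k)"
proof (induction k)
  case (Suc k)
  have "Suc k * (c choose Suc k) = (c - k) * (c choose k)"
    using binomial_absorb_comp[of c k] binomial_absorption[of k c] by (cases c) (auto simp: Suc_times_binomial_eq mult.commute)
  then have "fact (Suc k) * (c choose Suc k) = (c - k) * (fact k * (c choose k))"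
    by (metis fact_Suc mult.assoc mult.commute of_nat_id)
  moreover have "(c - k) ^ k \<le> (c + 1 - k) ^ k" by (intro power_mono) auto
  then have "(c - k) * (c - k) ^ k \<le> (c - k) * (fact k * (c choose k))"
    using Suc by (intro mult_left_mono) (auto intro: order_trans)
  ultimately show ?case by simp
qed auto

text \<open>Uses that \<open>D choose k\<close> is at most \<open>D ^ k / fact k\<close> while
  \<open>c choose k\<close> is at least \<open>(c + 1 - k) ^ k / fact k\<close>. A threshold that
  beats the mean \<open>D * e\<close> by a factor \<open>a\<close> thus gains \<open>a ^ k\<close>
  in the \<open>k\<close>-th factorial moment.\<close>

lemma binomial_ratio_le:
  fixes a e :: real
  assumes "0 < a" "0 \<le> e" "a * real D * e \<le> real (c + 1 - k)"
  shows "real (D choose k) * e ^ k \<le> real (c choose k) / a ^ k"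
proof -
  have "real (D choose k) * fact k \<le> real D ^ k"
    using binomial_fact_pow[of D k] by (metis of_nat_fact of_nat_le_iff of_nat_mult of_nat_power)
  then have "(real (D choose k) * fact k) * (a * e) ^ k \<le> real D ^ k * (a * e) ^ k"
    using assms by (intro mult_right_mono) auto
  also have "\<dots> = (a * real D * e) ^ k" by (simp add: power_mult_distrib mult_ac)
  also have "\<dots> \<le> real (c + 1 - k) ^ k" using assms by (intro power_mono) auto
  also have "\<dots> \<le> fact k * real (c choose k)"
    using power_le_fact_binomial[of c k] by (metis of_nat_fact of_nat_le_iff of_nat_mult of_nat_power)
  finally have "fact k * (real (D choose k) * (a * e) ^ k) \<le> fact k * real (c choose k)"
    by (simp add: mult_ac)
  then have "real (D choose k) * (a * e) ^ k \<le> real (c choose k)" by simp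
  then show ?thesis using assms by (simp add: field_simps power_mult_distrib)
qed

section \<open>Overloaded vertices, surviving hyperedges and hits\<close>

context nibble
begin

text \<open>Factorial moment method. If \<open>x\<close> is overloaded, many \<open>k\<close>-sets
  of hyperedges at \<open>x\<close> are still present, and Markov's inequality applies to their
  number. By linearity the hyperedges of a \<open>k\<close>-set are disjoint outside
  \<open>x\<close>, so together with \<open>X\<close> they form a set of
  \<open>card X + 2 * k\<close> vertices, to which \<open>pr_survive_le\<close> applies. Keeping
  \<open>X\<close> inside the event preserves the factor
  \<open>exp (- \<delta> * b * card X)\<close>, so that the bound is relative to the survival of
  \<open>X\<close>.\<close>

lemma overfull_le:
  assumes "A \<subseteq> V" "finite X" "card X \<le> 3" "b \<le> T" "nb A x \<le> D"
  shows "pr (seeds b) (\<lambda>\<omega>s. X \<subseteq> alive A \<omega>s \<and> M b < nb (alive A \<omega>s) x) \<le>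
    2 * exp (- \<delta> * b * card X) / (1 + \<eta>) ^ k"
proof -
  \<comment> \<open>Hyperedges that meet \<open>X\<close> outside \<open>x\<close> are discarded, so
    that every \<open>U W\<close> has exactly \<open>card X + 2 * k\<close> elements.\<close>
  define S where "S = {h \<in> E. x \<in> h \<and> h - {x} \<subseteq> A \<and> (h - {x}) \<inter> X = {}}"
  \<comment> \<open>An overloaded vertex has at least \<open>M b + 1\<close> hyperedges, of which at
    most three meet \<open>X\<close> outside \<open>x\<close>, since each vertex other than
    \<open>x\<close> shares at most one hyperedge with it.\<close>
  define c where "c = M b - 2"
  define WW where "WW = {W. W \<subseteq> S \<and> card W = k}"
  define U where "U W = X \<union> (\<Union>h\<in>W. h - {x})" for W
  have finS: "finite S" unfolding S_def using fin_E by auto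
  then have finWW: "finite WW" unfolding WW_def by auto
  have "card S \<le> nb A x" unfolding S_def nb_def using fin_E by (intro card_mono) auto
  with assms have "card S \<le> D" by simp
  then have card_WW: "card WW \<le> D choose k"
    unfolding WW_def using n_subsets[OF finS, of k] by (simp add: binomial_right_mono)
  have Mb: "(1 + \<eta>) * D * exp (- 2 * \<delta> * b) + k + 3 \<le> M b" using M_ge assms by auto
  moreover have "0 \<le> (1 + \<eta>) * D * exp (- 2 * \<delta> * b)" using \<eta>_nonneg by simp
  ultimately have "real k + 3 \<le> M b" by linarith
  then have kM: "k + 3 \<le> M b" by linarith
  have cardU: "finite (U W)" "card (U W) = card X + 2 * k" if "W \<in> WW" for W
  proof -
    have W: "W \<subseteq> S" "card W = k" "finite W"
      using that finS finite_subset by (auto simp: WW_def)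
    have fh: "finite (h - {x})" "card (h - {x}) = 2" if "h \<in> W" for h
      using that W finite_edge card_edge by (auto simp: S_def)
    show "finite (U W)" unfolding U_def using W fh assms(2) by blast
    have "card (\<Union>h\<in>W. h - {x}) = (\<Sum>h\<in>W. card (h - {x}))"
    proof (intro card_UN_disjoint ballI impI)
      fix h h' assume hh: "h \<in> W" "h' \<in> W" "h \<noteq> h'"
      have "y = x" if "y \<in> h" "y \<in> h'" for y
        using edge_unique[of h h' x y] hh W(1) that by (auto simp: S_def)
      then show "(h - {x}) \<inter> (h' - {x}) = {}" by auto
    qed (use W fh in auto)
    also have "\<dots> = 2 * k" using fh W by simp
    finally have "card (\<Union>h\<in>W. h - {x}) = 2 * k" .
    moreover have "X \<inter> (\<Union>h\<in>W. h - {x}) = {}" using W by (auto simp: S_def)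
    ultimately show "card (U W) = card X + 2 * k"
      unfolding U_def using W fh assms(2) by (subst card_Un_disjoint) auto
  qed
  have "pr (seeds b) (\<lambda>\<omega>s. X \<subseteq> alive A \<omega>s \<and> M b < nb (alive A \<omega>s) x) \<le>
    expect (seeds b) (\<lambda>\<omega>s. \<Sum>W\<in>WW. of_bool (U W \<subseteq> alive A \<omega>s)) / real (c choose k)"
  proof (rule pr_markov[OF finite_seeds])
    fix \<omega>s assume hyp: "X \<subseteq> alive A \<omega>s \<and> M b < nb (alive A \<omega>s) x"
    let ?A = "alive A \<omega>s"
    define S' where "S' = {h \<in> S. h - {x} \<subseteq> ?A}"
    have "nb ?A x \<le> card (S' \<union> (\<Union>y\<in>X. {h \<in> E. x \<in> h \<and> y \<in> h - {x}}))"
      unfolding nb_def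
    proof (rule card_mono)
      show "{h \<in> E. x \<in> h \<and> h - {x} \<subseteq> ?A} \<subseteq> S' \<union> (\<Union>y\<in>X. {h \<in> E. x \<in> h \<and> y \<in> h - {x}})"
        using alive_subset[of A \<omega>s] by (auto simp: S'_def S_def)
    qed (use finS fin_E assms in \<open>auto simp: S'_def\<close>)
    also have "\<dots> \<le> card S' + card (\<Union>y\<in>X. {h \<in> E. x \<in> h \<and> y \<in> h - {x}})" by (rule card_Un_le)
    also have "card (\<Union>y\<in>X. {h \<in> E. x \<in> h \<and> y \<in> h - {x}}) \<le> (\<Sum>y\<in>X. 1)"
    proof (rule order_trans[OF card_UN_le[OF assms(2)] sum_mono])
      fix y
      show "card {h \<in> E. x \<in> h \<and> y \<in> h - {x}} \<le> 1"
        using fin_E edge_unique[of _ _ x y] by (auto simp: card_le_Suc0_iff_eq)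
    qed
    finally have "nb ?A x \<le> card S' + card X" by simp
    then have "c \<le> card S'" using hyp assms(3) unfolding c_def by linarith
    then have "(c choose k) \<le> (card S' choose k)" by (rule binomial_right_mono)
    also have "\<dots> = card {W. W \<subseteq> S' \<and> card W = k}"
      using finS by (subst n_subsets) (auto simp: S'_def)
    also have "\<dots> \<le> card {W \<in> WW. U W \<subseteq> ?A}"
      using hyp by (intro card_mono finite_subset[OF _ finWW]) (auto simp: WW_def S'_def U_def)
    finally have "real (c choose k) \<le> real (card {W \<in> WW. U W \<subseteq> ?A})" by simp
    also have "\<dots> = (\<Sum>W\<in>WW. of_bool (U W \<subseteq> ?A))"
      using finWW by (simp add: of_bool_def sum.If_cases Int_def)
    finally show "real (c choose k) \<le> (\<Sum>W\<in>WW. of_bool (U W \<subseteq> ?A))" .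
  next
    show "0 < real (c choose k)" using kM by (simp add: c_def)
  qed (auto intro: sum_nonneg)
  also have "expect (seeds b) (\<lambda>\<omega>s. \<Sum>W\<in>WW. of_bool (U W \<subseteq> alive A \<omega>s)) =
    (\<Sum>W\<in>WW. pr (seeds b) (\<lambda>\<omega>s. U W \<subseteq> alive A \<omega>s))"
    by (simp add: expect_sum finite_seeds pr_expect)
  also have "\<dots> \<le> (\<Sum>W\<in>WW. 2 * exp (- \<delta> * b * (card X + 2 * k)))"
  proof (rule sum_mono)
    fix W assume W: "W \<in> WW"
    show "pr (seeds b) (\<lambda>\<omega>s. U W \<subseteq> alive A \<omega>s) \<le> 2 * exp (- \<delta> * b * (card X + 2 * k))"
      using pr_survive_le[OF cardU(1)[OF W] assms(1,4)] cardU(2)[OF W] assms by simp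
  qed
  also have "\<dots> \<le> real (D choose k) * (2 * exp (- \<delta> * b * (card X + 2 * k)))"
    using card_WW by simp
  also have "\<dots> = 2 * exp (- \<delta> * b * card X) * (real (D choose k) * exp (- 2 * \<delta> * b) ^ k)"
    by (simp add: algebra_simps flip: exp_of_nat_mult exp_add)
  also have "\<dots> \<le> 2 * exp (- \<delta> * b * card X) * (real (c choose k) / (1 + \<eta>) ^ k)"
  proof (intro mult_left_mono binomial_ratio_le)
    have "real (c + 1 - k) = real (M b) - 1 - k" using kM by (simp add: c_def of_nat_diff)
    then show "(1 + \<eta>) * real D * exp (- 2 * \<delta> * b) \<le> real (c + 1 - k)" using Mb by simp
  qed (use \<eta>_nonneg in auto)
  finally show ?thesis
    using kM by (auto simp: c_def field_simps split: if_splits)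
qed

text \<open>The overload bound \<open>2 / (1 + \<eta>) ^ k\<close> summed over the three vertices of
  a hyperedge: the relative loss charged per round.\<close>

definition slack :: real where "slack = 6 / (1 + \<eta>) ^ k"

text \<open>As long as its three vertices are within capacity, a live hyperedge has at most
  \<open>3 * M b\<close> killers and survives the round with probability at least
  \<open>exp (- 3 * \<delta>)\<close>. Overload costs only \<open>slack\<close> relative to
  \<open>exp (- 3 * \<delta> * b)\<close>, so the losses add up linearly. The second claim at time
  \<open>b\<close> is the induction step of the first.\<close>

lemma edge_survives_ge:
  assumes "A \<subseteq> V" "h \<in> E" "h \<subseteq> A" "\<And>x. x \<in> h \<Longrightarrow> nb A x \<le> D" "b \<le> T"
  shows "exp (- 3 * \<delta> * b) * (1 - b * slack) \<le> pr (seeds b) (\<lambda>\<omega>s. h \<subseteq> alive A \<omega>s)" (is ?surv)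
    and "exp (- 3 * \<delta> * b) * (1 - Suc b * slack) \<le>
      pr (seeds b) (\<lambda>\<omega>s. h \<subseteq> alive A \<omega>s \<and> (\<forall>x\<in>h. nb (alive A \<omega>s) x \<le> M b))" (is ?full)
proof -
  have fh: "finite h" "card h = 3" using finite_edge card_edge assms by auto
  have full: "exp (- 3 * \<delta> * b) * (1 - Suc b * slack) \<le>
      pr (seeds b) (\<lambda>\<omega>s. h \<subseteq> alive A \<omega>s \<and> (\<forall>x\<in>h. nb (alive A \<omega>s) x \<le> M b))"
    if "b \<le> T" "exp (- 3 * \<delta> * b) * (1 - b * slack) \<le> pr (seeds b) (\<lambda>\<omega>s. h \<subseteq> alive A \<omega>s)" for b
  proof -
    let ?Q = "\<lambda>\<omega>s. h \<subseteq> alive A \<omega>s \<and> (\<forall>x\<in>h. nb (alive A \<omega>s) x \<le> M b)"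
    have "pr (seeds b) (\<lambda>\<omega>s. h \<subseteq> alive A \<omega>s) \<le>
        expect (seeds b) (\<lambda>\<omega>s. of_bool (?Q \<omega>s) + (\<Sum>x\<in>h. of_bool (h \<subseteq> alive A \<omega>s \<and> M b < nb (alive A \<omega>s) x)))"
      unfolding pr_expect
    proof (rule expect_mono[OF finite_seeds])
      fix \<omega>s
      show "of_bool (h \<subseteq> alive A \<omega>s) \<le> of_bool (?Q \<omega>s) + (\<Sum>x\<in>h. of_bool (h \<subseteq> alive A \<omega>s \<and> M b < nb (alive A \<omega>s) x) :: real)"
      proof (cases "?Q \<omega>s \<or> \<not> h \<subseteq> alive A \<omega>s")
        case True
        then show ?thesis by (auto intro: sum_nonneg)
      next
        case False
        then obtain x where "x \<in> h" "M b < nb (alive A \<omega>s) x" by (auto simp: not_le)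
        then have "(1::real) \<le> (\<Sum>x\<in>h. of_bool (h \<subseteq> alive A \<omega>s \<and> M b < nb (alive A \<omega>s) x))"
          using member_le_sum[of x h "\<lambda>x. of_bool (h \<subseteq> alive A \<omega>s \<and> M b < nb (alive A \<omega>s) x) :: real"] fh False
          by auto
        then show ?thesis by (auto simp: of_bool_def)
      qed
    qed
    also have "\<dots> = pr (seeds b) ?Q + (\<Sum>x\<in>h. pr (seeds b) (\<lambda>\<omega>s. h \<subseteq> alive A \<omega>s \<and> M b < nb (alive A \<omega>s) x))"
      by (simp add: pr_expect expect_add expect_sum finite_seeds)
    also have "(\<Sum>x\<in>h. pr (seeds b) (\<lambda>\<omega>s. h \<subseteq> alive A \<omega>s \<and> M b < nb (alive A \<omega>s) x)) \<le>
      (\<Sum>x\<in>h. 2 * exp (- \<delta> * b * card h) / (1 + \<eta>) ^ k)"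
      using assms fh that by (intro sum_mono overfull_le) auto
    also have "\<dots> = exp (- 3 * \<delta> * b) * slack" using fh by (simp add: slack_def mult_ac)
    finally have "pr (seeds b) (\<lambda>\<omega>s. h \<subseteq> alive A \<omega>s) \<le> pr (seeds b) ?Q + exp (- 3 * \<delta> * b) * slack" by simp
    then show ?thesis using that by (simp add: algebra_simps)
  qed
  show surv: ?surv using assms(5)
  proof (induction b)
    case 0
    then show ?case using assms by (simp add: pr_expect)
  next
    case (Suc b)
    then have b: "b \<le> T" by simp
    let ?Q = "\<lambda>\<omega>s. h \<subseteq> alive A \<omega>s \<and> (\<forall>x\<in>h. nb (alive A \<omega>s) x \<le> M b)"
    have "exp (- 3 * \<delta> * Suc b) * (1 - Suc b * slack) = exp (- 3 * \<delta>) * (exp (- 3 * \<delta> * b) * (1 - Suc b * slack))"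
      by (simp add: algebra_simps flip: exp_add)
    also have "\<dots> \<le> exp (- 3 * \<delta>) * pr (seeds b) ?Q"
      using full[OF b Suc.IH[OF b]] by (intro mult_left_mono) auto
    also have "\<dots> = expect (seeds b) (\<lambda>\<omega>s. of_bool (?Q \<omega>s) * exp (- 3 * \<delta>))"
      by (simp add: pr_expect)
    also have "\<dots> \<le> expect (seeds b) (\<lambda>\<omega>s. pr (round_pmf b) (\<lambda>\<omega>. h \<subseteq> alive A (\<omega> # \<omega>s)))"
    proof (rule expect_mono[OF finite_seeds])
      fix \<omega>s assume "\<omega>s \<in> set_pmf (seeds b)"
      then have l: "length \<omega>s = b" by (rule length_seeds)
      show "of_bool (?Q \<omega>s) * exp (- 3 * \<delta>) \<le> pr (round_pmf b) (\<lambda>\<omega>. h \<subseteq> alive A (\<omega> # \<omega>s))"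
      proof (cases "?Q \<omega>s")
        case True
        then have "card (\<Union>x\<in>h. killers (M b) (alive A \<omega>s) x) \<le> 3 * M b"
          using card_UN_killers_le[of h "alive A \<omega>s" "M b"] fh by auto
        then have "\<delta> / M b * card (\<Union>x\<in>h. killers (M b) (alive A \<omega>s) x) \<le> \<delta> / M b * (3 * M b)"
          using \<delta>_nonneg by (intro mult_left_mono) (auto simp flip: of_nat_mult)
        then have "exp (- 3 * \<delta>) \<le> exp (- \<delta> / M b * card (\<Union>x\<in>h. killers (M b) (alive A \<omega>s) x))"
          using M_pos'[of b] by simp
        also have "\<dots> = pr (round_pmf b) (\<lambda>\<omega>. h \<subseteq> alive A (\<omega> # \<omega>s))"
          using pr_survive_step[of h "alive A \<omega>s" b] fh True alive_subset[of A \<omega>s] assms l by auto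
        finally show ?thesis using True by simp
      qed auto
    qed
    also have "\<dots> = pr (seeds (Suc b)) (\<lambda>\<omega>s. h \<subseteq> alive A \<omega>s)"
      unfolding pr_expect expect_seeds_Suc ..
    finally show ?case .
  qed
  show ?full by (rule full[OF assms(5) surv])
qed

text \<open>A live hyperedge with vertices within capacity has at most \<open>3 * M b\<close>
  competitors; all their coins fail with probability at least \<open>exp (- 3 * \<delta>)\<close>,
  independently of its own coin.\<close>

lemma pr_hit_ge:
  assumes "A \<subseteq> V" "h \<in> E" "h \<subseteq> A" "\<And>x. x \<in> h \<Longrightarrow> nb A x \<le> D" "b \<le> T"
  shows "rate b * exp (- 3 * \<delta> * Suc b) * (1 - Suc b * slack) \<le>
    expect (seeds b) (\<lambda>\<omega>s. pr (round_pmf b) (\<lambda>\<omega>. h \<in> hits \<omega> (alive A \<omega>s)))"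
proof -
  let ?Q = "\<lambda>\<omega>s. h \<subseteq> alive A \<omega>s \<and> (\<forall>x\<in>h. nb (alive A \<omega>s) x \<le> M b)"
  have fh: "finite h" "card h = 3" using finite_edge card_edge assms by auto
  have "rate b * exp (- 3 * \<delta> * Suc b) * (1 - Suc b * slack) =
    (rate b * exp (- 3 * \<delta>)) * (exp (- 3 * \<delta> * b) * (1 - Suc b * slack))"
    by (simp add: algebra_simps flip: exp_add)
  also have "\<dots> \<le> (rate b * exp (- 3 * \<delta>)) * pr (seeds b) ?Q"
    using edge_survives_ge(2)[OF assms] rate_bounds by (intro mult_left_mono) auto
  also have "\<dots> = expect (seeds b) (\<lambda>\<omega>s. of_bool (?Q \<omega>s) * (rate b * exp (- 3 * \<delta>)))"
    by (simp add: pr_expect)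
  also have "\<dots> \<le> expect (seeds b) (\<lambda>\<omega>s. pr (round_pmf b) (\<lambda>\<omega>. h \<in> hits \<omega> (alive A \<omega>s)))"
  proof (rule expect_mono[OF finite_seeds])
    fix \<omega>s
    let ?A = "alive A \<omega>s"
    show "of_bool (?Q \<omega>s) * (rate b * exp (- 3 * \<delta>)) \<le> pr (round_pmf b) (\<lambda>\<omega>. h \<in> hits \<omega> ?A)"
    proof (cases "?Q \<omega>s")
      case True
      define R where "R = {h' \<in> E. h' \<subseteq> ?A \<and> h' \<noteq> h \<and> h' \<inter> h \<noteq> {}}"
      have "card R \<le> card (\<Union>x\<in>h. {h' \<in> E. x \<in> h' \<and> h' \<subseteq> ?A})"
        unfolding R_def using fin_E fh by (intro card_mono) auto
      also have "\<dots> \<le> (\<Sum>x\<in>h. card {h' \<in> E. x \<in> h' \<and> h' \<subseteq> ?A})" using fh by (intro card_UN_le)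
      also have "\<dots> = (\<Sum>x\<in>h. nb ?A x)" using True by (intro sum.cong) (auto simp: nb_alt)
      also have "\<dots> \<le> (\<Sum>x\<in>h. M b)" using True by (intro sum_mono) auto
      finally have "card R \<le> 3 * M b" using fh by simp
      then have "\<delta> / M b * card R \<le> \<delta> / M b * (3 * M b)"
        using \<delta>_nonneg by (intro mult_left_mono) (auto simp flip: of_nat_mult)
      then have "exp (- 3 * \<delta>) \<le> exp (- \<delta> / M b * card (Inl ` R :: ('x set + 'x \<times> nat) set))"
        using M_pos'[of b] by (simp add: card_image)
      then have "exp (- 3 * \<delta>) * rate b \<le> exp (- \<delta> / M b * card (Inl ` R :: ('x set + 'x \<times> nat) set)) * rate b"
        using rate_bounds by (intro mult_right_mono)
      also have "\<dots> = pr (round_pmf b) (\<lambda>\<omega>. (\<forall>i\<in>Inl ` R. \<not> \<omega> i) \<and> \<omega> (Inl h))"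
        unfolding round_pmf_def rate_compl[symmetric]
        using assms(2) rate_bounds by (intro pr_coins_one[symmetric] finite_coin_set) (auto simp: coin_set_def R_def)
      also have "\<dots> = pr (round_pmf b) (\<lambda>\<omega>. h \<in> hits \<omega> ?A)"
        using True assms(2) by (intro arg_cong[where f = "measure_pmf.prob _"]) (auto simp: hits_def R_def)
      finally show ?thesis using True by (simp add: mult.commute)
    qed auto
  qed
  finally show ?thesis .
qed

text \<open>The events that a given hyperedge at \<open>e\<close> is hit in a given round exclude
  each other: two hits in one round are disjoint, and once matched \<open>e\<close> is dead. Their
  probabilities therefore simply add.\<close>

lemma pr_matched_ge_sum:
  assumes "A \<subseteq> V" "\<And>x. x \<in> A \<Longrightarrow> nb A x \<le> D" "b \<le> T" "e \<in> A"
  shows "(\<Sum>i<b. nb A e * (rate i * exp (- 3 * \<delta> * Suc i) * (1 - Suc i * slack))) \<le>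
    pr (seeds b) (\<lambda>\<omega>s. \<exists>h\<in>matching A \<omega>s. e \<in> h)"
  using assms(3)
proof (induction b)
  case (Suc b)
  let ?F = "{h \<in> E. e \<in> h \<and> h \<subseteq> A}"
  have finF: "finite ?F" using fin_E by auto
  let ?c = "\<lambda>\<omega>s. of_bool (\<exists>h\<in>matching A \<omega>s. e \<in> h) :: real"
  have "nb A e * (rate b * exp (- 3 * \<delta> * Suc b) * (1 - Suc b * slack)) =
    (\<Sum>h\<in>?F. rate b * exp (- 3 * \<delta> * Suc b) * (1 - Suc b * slack))"
    using assms(4) by (simp add: nb_alt)
  also have "\<dots> \<le> (\<Sum>h\<in>?F. expect (seeds b) (\<lambda>\<omega>s. pr (round_pmf b) (\<lambda>\<omega>. h \<in> hits \<omega> (alive A \<omega>s))))"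
    using assms Suc.prems by (intro sum_mono pr_hit_ge) auto
  also have "\<dots> = expect (seeds b) (\<lambda>\<omega>s. expect (round_pmf b) (\<lambda>\<omega>. \<Sum>h\<in>?F. of_bool (h \<in> hits \<omega> (alive A \<omega>s))))"
    by (simp add: expect_sum finite_seeds finite_round pr_expect)
  finally have new: "nb A e * (rate b * exp (- 3 * \<delta> * Suc b) * (1 - Suc b * slack)) \<le> \<dots>" .
  have "(\<Sum>i<Suc b. nb A e * (rate i * exp (- 3 * \<delta> * Suc i) * (1 - Suc i * slack))) \<le>
    expect (seeds b) ?c + expect (seeds b) (\<lambda>\<omega>s. expect (round_pmf b) (\<lambda>\<omega>. \<Sum>h\<in>?F. of_bool (h \<in> hits \<omega> (alive A \<omega>s))))"
    using Suc new by (simp add: pr_expect)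
  also have "\<dots> = expect (seeds b) (\<lambda>\<omega>s. expect (round_pmf b) (\<lambda>\<omega>. ?c \<omega>s + (\<Sum>h\<in>?F. of_bool (h \<in> hits \<omega> (alive A \<omega>s)))))"
    by (simp add: expect_add finite_seeds finite_round)
  also have "\<dots> \<le> expect (seeds b) (\<lambda>\<omega>s. expect (round_pmf b) (\<lambda>\<omega>. ?c (\<omega> # \<omega>s)))"
  proof (intro expect_mono finite_seeds finite_round)
    fix \<omega>s \<omega>
    let ?H = "{h \<in> ?F. h \<in> hits \<omega> (alive A \<omega>s)}"
    have sumH: "(\<Sum>h\<in>?F. of_bool (h \<in> hits \<omega> (alive A \<omega>s))) = real (card ?H)"
      using finF by (simp add: of_bool_def sum.If_cases Int_def)
    have "card ?H \<le> 1"
    proof -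
      have "h = h'" if "h \<in> ?H" "h' \<in> ?H" for h h'
        using that hits_disjoint[of h \<omega> "alive A \<omega>s" h'] by auto
      moreover have "finite ?H" using finF by (rule rev_finite_subset) auto
      ultimately show ?thesis unfolding One_nat_def by (subst card_le_Suc0_iff_eq) blast+
    qed
    moreover have "?H = {}" if "\<exists>h\<in>matching A \<omega>s. e \<in> h"
      using that matching_dead[of _ A \<omega>s] by (auto simp: hits_def disjoint_iff)
    moreover have "\<exists>h\<in>matching A (\<omega> # \<omega>s). e \<in> h" if "?H \<noteq> {}"
      using that by auto
    ultimately show "?c \<omega>s + (\<Sum>h\<in>?F. of_bool (h \<in> hits \<omega> (alive A \<omega>s))) \<le> ?c (\<omega> # \<omega>s)"
      unfolding sumH
    proof (cases "?H = {}")
      case True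
      then have "real (card ?H) = 0" by (simp only: card.empty of_nat_0)
      then show "?c \<omega>s + real (card ?H) \<le> ?c (\<omega> # \<omega>s)" by (auto simp: of_bool_def)
    qed (auto simp del: matching.simps simp: of_bool_def)
  qed
  also have "\<dots> = pr (seeds (Suc b)) (\<lambda>\<omega>s. \<exists>h\<in>matching A \<omega>s. e \<in> h)"
    unfolding pr_expect expect_seeds_Suc ..
  finally show ?case .
qed simp

end

section \<open>Spread of a disagreement between two runs with the same coins\<close>

context linear_hypergraph
begin

lemma nb_le_card: "nb A x \<le> nb B x + card {h \<in> E. x \<in> h \<and> (h \<subseteq> A) \<noteq> (h \<subseteq> B)}"
  if "x \<in> A" "x \<in> B"
proof -
  have "nb A x \<le> card ({h \<in> E. x \<in> h \<and> h \<subseteq> B} \<union> {h \<in> E. x \<in> h \<and> (h \<subseteq> A) \<noteq> (h \<subseteq> B)})"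
    unfolding nb_alt[OF that(1)] using fin_E by (intro card_mono) auto
  also have "\<dots> \<le> nb B x + card {h \<in> E. x \<in> h \<and> (h \<subseteq> A) \<noteq> (h \<subseteq> B)}"
    unfolding nb_alt[OF that(2)] by (rule card_Un_le)
  finally show ?thesis .
qed

text \<open>A changed hyperedge alters its own coin and shifts the number of dummies by at most one,
  which gives the factor 2.\<close>

lemma card_killers_diff:
  assumes "x \<in> A" "x \<in> B"
  shows "card (sym_diff (killers m A x) (killers m B x)) \<le> 2 * card {h \<in> E. x \<in> h \<and> (h \<subseteq> A) \<noteq> (h \<subseteq> B)}"
proof -
  let ?R = "{h \<in> E. x \<in> h \<and> (h \<subseteq> A) \<noteq> (h \<subseteq> B)}"
  let ?I = "{nb A x..<nb B x} \<union> {nb B x..<nb A x}"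
  have "finite ?R" using fin_E by auto
  have "sym_diff (killers m A x) (killers m B x) \<subseteq> Inl ` ?R \<union> (\<lambda>j. Inr (x, j)) ` ?I"
  proof
    fix i assume i: "i \<in> sym_diff (killers m A x) (killers m B x)"
    then consider h where "i = Inl h" "h \<in> ?R" | j where "i = Inr (x, j)" "j \<in> ?I"
      unfolding killers_def by (cases i) (simp_all add: image_iff, blast, force)
    then show "i \<in> Inl ` ?R \<union> (\<lambda>j. Inr (x, j)) ` ?I" by cases auto
  qed
  then have "card (sym_diff (killers m A x) (killers m B x)) \<le> card (Inl ` ?R \<union> (\<lambda>j. Inr (x, j)) ` ?I :: ('x set + 'x \<times> nat) set)"
    using \<open>finite ?R\<close> by (intro card_mono) auto
  also have "\<dots> \<le> card (Inl ` ?R :: ('x set + 'x \<times> nat) set) + card ((\<lambda>j. Inr (x, j)) ` ?I :: ('x set + 'x \<times> nat) set)"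
    by (rule card_Un_le)
  also have "\<dots> \<le> card ?R + card ?I"
    using \<open>finite ?R\<close> by (intro add_mono card_image_le) auto
  also have "card ?I = (nb B x - nb A x) + (nb A x - nb B x)"
    by (subst card_Un_disjoint) auto
  also have "\<dots> \<le> card ?R"
    using nb_le_card[OF assms] nb_le_card[OF assms(2,1)] by (auto simp: eq_commute[of "_ \<subseteq> B"])
  finally show ?thesis by simp
qed

lemma card_changed_edges:
  assumes "finite Z" "Z = sym_diff A B"
  shows "card {h \<in> E. (h \<subseteq> A) \<noteq> (h \<subseteq> B)} \<le> (\<Sum>z\<in>Z. nb A z + nb B z)"
proof -
  have "{h \<in> E. (h \<subseteq> A) \<noteq> (h \<subseteq> B)} \<subseteq>
    (\<Union>z\<in>Z. {h \<in> E. z \<in> h \<and> h - {z} \<subseteq> A} \<union> {h \<in> E. z \<in> h \<and> h - {z} \<subseteq> B})"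
    unfolding assms(2) by blast
  then have "card {h \<in> E. (h \<subseteq> A) \<noteq> (h \<subseteq> B)} \<le>
    card (\<Union>z\<in>Z. {h \<in> E. z \<in> h \<and> h - {z} \<subseteq> A} \<union> {h \<in> E. z \<in> h \<and> h - {z} \<subseteq> B})"
    using fin_E assms by (intro card_mono) auto
  also have "\<dots> \<le> (\<Sum>z\<in>Z. card ({h \<in> E. z \<in> h \<and> h - {z} \<subseteq> A} \<union> {h \<in> E. z \<in> h \<and> h - {z} \<subseteq> B}))"
    by (rule card_UN_le[OF assms(1)])
  also have "\<dots> \<le> (\<Sum>z\<in>Z. nb A z + nb B z)"
    unfolding nb_def by (intro sum_mono card_Un_le)
  finally show ?thesis .
qed

text \<open>Double counting: a hyperedge live in only one run contains a vertex of the disagreement,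
  so at most two of its vertices are common to both sets. With the factor 2 of
  \<open>card_killers_diff\<close> this makes 4.\<close>

lemma sum_killers_diff:
  assumes "finite A" "finite B"
  shows "(\<Sum>x\<in>A \<inter> B. card (sym_diff (killers m A x) (killers m B x))) \<le>
    4 * (\<Sum>z\<in>sym_diff A B. nb A z + nb B z)"
proof -
  let ?R = "{h \<in> E. (h \<subseteq> A) \<noteq> (h \<subseteq> B)}"
  have "(\<Sum>x\<in>A \<inter> B. card (sym_diff (killers m A x) (killers m B x))) \<le>
    (\<Sum>x\<in>A \<inter> B. 2 * card {h \<in> E. x \<in> h \<and> (h \<subseteq> A) \<noteq> (h \<subseteq> B)})"
    by (intro sum_mono card_killers_diff) auto
  also have "\<dots> = 2 * (\<Sum>x\<in>A \<inter> B. \<Sum>h | h \<in> ?R \<and> x \<in> h. (1::nat))"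
    by (simp add: sum_distrib_left conj_ac)
  also have "(\<Sum>x\<in>A \<inter> B. \<Sum>h | h \<in> ?R \<and> x \<in> h. (1::nat)) = (\<Sum>h\<in>?R. \<Sum>x | x \<in> A \<inter> B \<and> x \<in> h. 1)"
    using assms fin_E by (intro sum.swap_restrict) auto
  also have "\<dots> \<le> (\<Sum>h\<in>?R. (2::nat))"
  proof (rule sum_mono)
    fix h assume h: "h \<in> ?R"
    then have "{x. x \<in> A \<inter> B \<and> x \<in> h} \<subset> h" by auto
    then have "card {x. x \<in> A \<inter> B \<and> x \<in> h} < card h"
      using finite_edge h by (intro psubset_card_mono) auto
    then show "(\<Sum>x | x \<in> A \<inter> B \<and> x \<in> h. 1) \<le> (2::nat)" using card_edge h by simp
  qed
  also have "\<dots> = 2 * card ?R" by simp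
  also have "\<dots> \<le> 2 * (\<Sum>z\<in>sym_diff A B. nb A z + nb B z)"
    using assms by (intro mult_left_mono card_changed_edges) auto
  finally show ?thesis by simp
qed

lemma step_sym_diff:
  "sym_diff (step m \<omega> A) (step m \<omega> B) \<subseteq>
    sym_diff A B \<union> {x \<in> A \<inter> B. \<exists>i\<in>sym_diff (killers m A x) (killers m B x). \<omega> i}"
  unfolding step_def by blast

definition near :: "'x set \<Rightarrow> 'x set \<Rightarrow> 'x set set" where
  "near A Z = {h \<in> E. h \<subseteq> A \<and> (\<exists>h'\<in>E. h' \<subseteq> A \<and> h' \<inter> h \<noteq> {} \<and> h' \<inter> Z \<noteq> {})}"

text \<open>A hit of one run is lost in the other only if the hyperedge itself has a vertex in the
  disagreement, or a selected competitor is live only in the other run and hence has such a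
  vertex.\<close>

lemma hits_sym_diff:
  assumes "A \<subseteq> C" "B \<subseteq> C"
  shows "sym_diff (hits \<omega> A) (hits \<omega> B) \<subseteq> near C (sym_diff A B)"
proof -
  have "h \<in> near C (sym_diff A B)" if hyp: "h \<in> hits \<omega> A" "h \<notin> hits \<omega> B" "A \<subseteq> C" "B \<subseteq> C" for h A B
  proof (cases "h \<subseteq> B")
    case False
    then obtain x where "x \<in> h" "x \<notin> B" by auto
    then have "h \<inter> sym_diff A B \<noteq> {}" "h \<noteq> {}" using hyp by (auto simp: hits_def)
    then show ?thesis using hyp unfolding near_def hits_def by auto
  next
    case True
    then obtain h' where h': "h' \<in> E" "h' \<subseteq> B" "h' \<noteq> h" "h' \<inter> h \<noteq> {}" "\<omega> (Inl h')"
      using hyp by (auto simp: hits_def)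
    then have "\<not> h' \<subseteq> A" using hyp by (auto simp: hits_def)
    then have "h' \<inter> sym_diff A B \<noteq> {}" using h' by auto
    moreover have "h \<in> E" "h \<subseteq> C" "h' \<subseteq> C" using hyp h' by (auto simp: hits_def)
    ultimately show ?thesis using h'(1,4) unfolding near_def by blast
  qed
  from this[of _ A B] this[of _ B A] assms show ?thesis by (auto simp: Un_commute)
qed

lemma card_edges_at_le: "card {h \<in> E. x \<in> h \<and> h \<subseteq> A} \<le> d" if "\<And>x. x \<in> A \<Longrightarrow> nb A x \<le> d"
proof (cases "x \<in> A")
  case False
  then have "{h \<in> E. x \<in> h \<and> h \<subseteq> A} = {}" by auto
  then show ?thesis by (metis card.empty zero_le)
qed (use that in \<open>auto simp: nb_alt\<close>)

lemma card_near_le: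
  assumes "finite Z" "\<And>x. x \<in> A \<Longrightarrow> nb A x \<le> d"
  shows "card (near A Z) \<le> 3 * d\<^sup>2 * card Z"
proof -
  let ?N = "\<lambda>x. {h \<in> E. x \<in> h \<and> h \<subseteq> A}"
  have N: "finite (?N x)" "card (?N x) \<le> d" for x
    using fin_E card_edges_at_le[OF assms(2)] by auto
  have "near A Z \<subseteq> (\<Union>z\<in>Z. \<Union>h'\<in>?N z. \<Union>y\<in>h'. ?N y)"
    unfolding near_def by blast
  then have "card (near A Z) \<le> card (\<Union>z\<in>Z. \<Union>h'\<in>?N z. \<Union>y\<in>h'. ?N y)"
    using assms N finite_edge by (intro card_mono finite_UN_I) auto
  also have "\<dots> \<le> (\<Sum>z\<in>Z. \<Sum>h'\<in>?N z. \<Sum>y\<in>h'. card (?N y))"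
    using assms(1) N finite_edge by (intro order_trans[OF card_UN_le] sum_mono) auto
  also have "\<dots> \<le> (\<Sum>z\<in>Z. \<Sum>h'\<in>?N z. \<Sum>y\<in>h'. d)"
    using N by (intro sum_mono) auto
  also have "\<dots> = (\<Sum>z\<in>Z. card (?N z) * (3 * d))"
    using card_edge by simp
  also have "\<dots> \<le> (\<Sum>z\<in>Z. d * (3 * d))"
    using N by (intro sum_mono mult_right_mono) auto
  finally show ?thesis by (simp add: power2_eq_square mult_ac)
qed

text \<open>A region fixed in advance that confines the disagreement. The disagreement itself is
  random and correlated with overload, so overload is union-bounded over this region.\<close>

fun ball :: "'x set \<Rightarrow> 'x \<Rightarrow> nat \<Rightarrow> 'x set" where
  "ball A e 0 = {e}"
| "ball A e (Suc b) = ball A e b \<union> \<Union>{h \<in> E. h \<subseteq> A \<and> h \<inter> ball A e b \<noteq> {}}"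

lemma finite_ball: "finite (ball A e b)"
  using fin_E finite_edge by (induction b) auto

lemma ball_subset: "e \<in> A \<Longrightarrow> ball A e b \<subseteq> A"
  by (induction b) auto

lemma card_ball_le:
  assumes "\<And>x. x \<in> A \<Longrightarrow> nb A x \<le> d"
  shows "card (ball A e b) \<le> (2 * d + 1) ^ b"
proof (induction b)
  case (Suc b)
  let ?B = "ball A e b"
  let ?N = "\<lambda>x. {h \<in> E. x \<in> h \<and> h \<subseteq> A}"
  have N: "finite (?N x)" "card (?N x) \<le> d" for x
    using fin_E card_edges_at_le[OF assms] by auto
  have "ball A e (Suc b) \<subseteq> ?B \<union> (\<Union>z\<in>?B. \<Union>h\<in>?N z. h - {z})" by auto
  then have "card (ball A e (Suc b)) \<le> card (?B \<union> (\<Union>z\<in>?B. \<Union>h\<in>?N z. h - {z}))"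
    using finite_ball N finite_edge by (intro card_mono finite_UnI finite_UN_I) auto
  also have "\<dots> \<le> card ?B + card (\<Union>z\<in>?B. \<Union>h\<in>?N z. h - {z})" by (rule card_Un_le)
  also have "card (\<Union>z\<in>?B. \<Union>h\<in>?N z. h - {z}) \<le> (\<Sum>z\<in>?B. \<Sum>h\<in>?N z. card (h - {z}))"
    using finite_ball N by (intro order_trans[OF card_UN_le] sum_mono) auto
  also have "\<dots> = (\<Sum>z\<in>?B. card (?N z) * 2)"
    using card_edge finite_edge by (simp add: card_Diff_singleton)
  also have "\<dots> \<le> (\<Sum>z\<in>?B. d * 2)"
    using N by (intro sum_mono mult_right_mono) auto
  finally have "card (ball A e (Suc b)) \<le> card ?B * (2 * d + 1)" by (simp add: algebra_simps)
  also have "\<dots> \<le> (2 * d + 1) ^ b * (2 * d + 1)" using Suc by (rule mult_right_mono) simp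
  finally show ?case by (simp add: mult.commute)
qed simp

end

context nibble
begin

text \<open>A vertex alive in both runs starts to differ only if a coin fires that kills it in
  exactly one of them. With degrees within the capacity, \<open>rate b * M b\<close> is at most
  \<delta>, so each disagreement spawns at most \<open>8 * \<delta>\<close> new ones on
  average.\<close>

lemma expect_step_diff:
  assumes "A \<subseteq> V" "B \<subseteq> V"
  shows "expect (round_pmf b) (\<lambda>\<omega>. card (sym_diff (step (M b) \<omega> A) (step (M b) \<omega> B))) \<le>
    card (sym_diff A B) + 4 * rate b * (\<Sum>z\<in>sym_diff A B. nb A z + nb B z)"
proof -
  have fin: "finite A" "finite B" using assms fin_V finite_subset by auto
  let ?K = "\<lambda>x. sym_diff (killers (M b) A x) (killers (M b) B x)"
  let ?new = "\<lambda>\<omega>. {x \<in> A \<inter> B. \<exists>i\<in>?K x. \<omega> i}"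
  have "expect (round_pmf b) (\<lambda>\<omega>. card (sym_diff (step (M b) \<omega> A) (step (M b) \<omega> B))) \<le>
    expect (round_pmf b) (\<lambda>\<omega>. real (card (sym_diff A B)) + real (card (?new \<omega>)))"
  proof (rule expect_mono[OF finite_round])
    fix \<omega>
    have "card (sym_diff (step (M b) \<omega> A) (step (M b) \<omega> B)) \<le> card (sym_diff A B \<union> ?new \<omega>)"
      using fin by (intro card_mono step_sym_diff) auto
    also have "\<dots> \<le> card (sym_diff A B) + card (?new \<omega>)" by (rule card_Un_le)
    finally show "real (card (sym_diff (step (M b) \<omega> A) (step (M b) \<omega> B))) \<le>
      real (card (sym_diff A B)) + real (card (?new \<omega>))" by linarith
  qed
  also have "\<dots> = card (sym_diff A B) + expect (round_pmf b) (\<lambda>\<omega>. real (card (?new \<omega>)))"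
    by (simp add: expect_add finite_round)
  also have "expect (round_pmf b) (\<lambda>\<omega>. real (card (?new \<omega>))) =
    (\<Sum>x\<in>A \<inter> B. pr (round_pmf b) (\<lambda>\<omega>. x \<in> ?new \<omega>))"
    using fin by (intro expect_card_le_sum_pr finite_round) auto
  also have "\<dots> \<le> (\<Sum>x\<in>A \<inter> B. rate b * card (?K x))"
  proof (rule sum_mono)
    fix x assume x: "x \<in> A \<inter> B"
    then have "?K x \<subseteq> coin_set b" using killers_subset[of x b A] killers_subset[of x b B] assms by auto
    then have "pr (round_pmf b) (\<lambda>\<omega>. \<exists>i\<in>?K x. \<omega> i) \<le> rate b * card (?K x)"
      unfolding round_pmf_def using rate_bounds by (intro pr_coins_some_le finite_coin_set)
    then show "pr (round_pmf b) (\<lambda>\<omega>. x \<in> ?new \<omega>) \<le> rate b * card (?K x)" using x by simp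
  qed
  also have "\<dots> = rate b * real (\<Sum>x\<in>A \<inter> B. card (?K x))" by (simp add: sum_distrib_left)
  also have "\<dots> \<le> rate b * real (4 * (\<Sum>z\<in>sym_diff A B. nb A z + nb B z))"
    using rate_bounds by (intro mult_left_mono of_nat_mono sum_killers_diff fin)
  finally show ?thesis by simp
qed

abbreviation dis :: "'x set \<Rightarrow> 'x \<Rightarrow> ('x set + 'x \<times> nat \<Rightarrow> bool) list \<Rightarrow> 'x set" where
  "dis A e \<omega>s \<equiv> sym_diff (alive A \<omega>s) (alive (A - {e}) \<omega>s)"

lemma dis_subset_ball: "dis A e \<omega>s \<subseteq> ball A e (length \<omega>s)"
proof (induction \<omega>s)
  case (Cons \<omega> \<omega>s)
  let ?A = "alive A \<omega>s" and ?B = "alive (A - {e}) \<omega>s" and ?m = "M (length \<omega>s)"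
  have sub: "?A \<subseteq> A" "?B \<subseteq> A" using alive_subset[of A \<omega>s] alive_subset[of "A - {e}" \<omega>s] by auto
  have "x \<in> ball A e (Suc (length \<omega>s))"
    if x: "x \<in> ?A" "x \<in> ?B" and ne: "killers ?m ?A x \<noteq> killers ?m ?B x" for x
  proof -
    have "\<exists>h\<in>E. x \<in> h \<and> (h \<subseteq> ?A) \<noteq> (h \<subseteq> ?B)"
    proof (rule ccontr)
      assume "\<not> ?thesis"
      then have "{h \<in> E. x \<in> h \<and> h \<subseteq> ?A} = {h \<in> E. x \<in> h \<and> h \<subseteq> ?B}" by auto
      then show False using ne x by (simp add: killers_def nb_alt)
    qed
    then obtain h where h: "h \<in> E" "x \<in> h" "(h \<subseteq> ?A) \<noteq> (h \<subseteq> ?B)" by auto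
    then have "h \<inter> dis A e \<omega>s \<noteq> {}" by auto
    then have "h \<inter> ball A e (length \<omega>s) \<noteq> {}" using Cons.IH by auto
    moreover have "h \<subseteq> A" using h sub by auto
    ultimately show ?thesis using h by auto
  qed
  moreover have "dis A e \<omega>s \<subseteq> ball A e (Suc (length \<omega>s))" using Cons.IH by auto
  moreover have "dis A e (\<omega> # \<omega>s) \<subseteq> dis A e \<omega>s \<union> {x \<in> ?A \<inter> ?B. killers ?m ?A x \<noteq> killers ?m ?B x}"
    using step_sym_diff[of ?m \<omega> ?A ?B] by auto
  ultimately show ?case by (simp del: ball.simps alive.simps) blast
qed auto

text \<open>Vertices within capacity contribute the growth factor \<open>1 + 8 * \<delta>\<close>.
  Overloaded ones are charged their initial degree bound \<open>D\<close>, with probability at most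
  \<open>slack / 3\<close> in each run, over the whole ball. This is crude but affordable because
  \<open>slack\<close> decays exponentially in \<open>k\<close>.\<close>

lemma expect_dis_Suc:
  assumes "A \<subseteq> V" "e \<in> A" "\<And>x. x \<in> A \<Longrightarrow> nb A x \<le> D" "Suc b \<le> T"
  shows "expect (seeds (Suc b)) (\<lambda>\<omega>s. card (dis A e \<omega>s)) \<le>
    (1 + 8 * \<delta>) * expect (seeds b) (\<lambda>\<omega>s. card (dis A e \<omega>s)) + 3 * D * (2 * D + 1) ^ T * slack"
proof -
  let ?bad = "\<lambda>C z \<omega>s. of_bool (M b < nb (alive C \<omega>s) z) :: real"
  let ?B = "ball A e b"
  have "expect (seeds (Suc b)) (\<lambda>\<omega>s. card (dis A e \<omega>s)) \<le>
    expect (seeds b) (\<lambda>\<omega>s. (1 + 8 * \<delta>) * card (dis A e \<omega>s) + 4 * D * (\<Sum>z\<in>?B. ?bad A z \<omega>s + ?bad (A - {e}) z \<omega>s))"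
    unfolding expect_seeds_Suc
  proof (rule expect_mono[OF finite_seeds])
    fix \<omega>s assume "\<omega>s \<in> set_pmf (seeds b)"
    then have l: "length \<omega>s = b" by (rule length_seeds)
    let ?A = "alive A \<omega>s" and ?A' = "alive (A - {e}) \<omega>s"
    have sub: "?A \<subseteq> V" "?A' \<subseteq> V"
      using alive_subset[of A \<omega>s] alive_subset[of "A - {e}" \<omega>s] assms by auto
    have nbD: "real (nb (alive C \<omega>s) z) \<le> M b + D * ?bad C z \<omega>s" if "z \<in> ?B" "C \<subseteq> A" for C z
    proof -
      have "nb (alive C \<omega>s) z \<le> nb A z" using that alive_subset[of C \<omega>s] by (intro nb_mono) auto
      also have "\<dots> \<le> D" using that ball_subset[OF assms(2), of b] assms by auto
      finally show ?thesis by (auto simp: of_bool_def)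
    qed
    have dB: "dis A e \<omega>s \<subseteq> ?B" using dis_subset_ball[where A = A and e = e and \<omega>s = \<omega>s] l by simp
    have "expect (round_pmf b) (\<lambda>\<omega>. real (card (dis A e (\<omega> # \<omega>s)))) \<le>
      card (dis A e \<omega>s) + 4 * rate b * (\<Sum>z\<in>dis A e \<omega>s. nb ?A z + nb ?A' z)"
      using expect_step_diff[OF sub, of b] l by simp
    also have "\<dots> \<le> card (dis A e \<omega>s) + 4 * rate b * (\<Sum>z\<in>dis A e \<omega>s. 2 * M b + D * (?bad A z \<omega>s + ?bad (A - {e}) z \<omega>s))"
      unfolding of_nat_sum of_nat_add
    proof (intro add_left_mono mult_left_mono sum_mono)
      fix z assume "z \<in> dis A e \<omega>s"
      then have "z \<in> ?B" using dB by blast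
      then show "real (nb ?A z) + real (nb ?A' z) \<le> 2 * M b + D * (?bad A z \<omega>s + ?bad (A - {e}) z \<omega>s)"
        using nbD[of z A] nbD[of z "A - {e}"] by (auto simp: algebra_simps)
    qed (use rate_bounds in auto)
    also have "\<dots> = card (dis A e \<omega>s) + 8 * (rate b * M b) * card (dis A e \<omega>s) +
       rate b * (4 * D * (\<Sum>z\<in>dis A e \<omega>s. ?bad A z \<omega>s + ?bad (A - {e}) z \<omega>s))"
      by (simp add: sum.distrib sum_distrib_left algebra_simps)
    \<comment> \<open>Only in the overload term is the random disagreement replaced by the ball and
      \<open>rate b\<close> by 1; the main term keeps the product of rate and capacity.\<close>
    also have "\<dots> \<le> card (dis A e \<omega>s) + 8 * \<delta> * card (dis A e \<omega>s) +
       1 * (4 * D * (\<Sum>z\<in>?B. ?bad A z \<omega>s + ?bad (A - {e}) z \<omega>s))"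
    proof (intro add_mono mult_mono order_refl sum_mono2 finite_ball dB)
      show "rate b * M b \<le> \<delta>" using rate_le[of b] M_pos'[of b] by (simp add: field_simps)
    qed (use rate_bounds \<delta>_nonneg in \<open>auto intro!: mult_nonneg_nonneg sum_nonneg\<close>)
    finally show "expect (round_pmf b) (\<lambda>\<omega>. real (card (dis A e (\<omega> # \<omega>s)))) \<le>
      (1 + 8 * \<delta>) * card (dis A e \<omega>s) + 4 * D * (\<Sum>z\<in>?B. ?bad A z \<omega>s + ?bad (A - {e}) z \<omega>s)"
      by (simp add: algebra_simps)
  qed
  also have "\<dots> = (1 + 8 * \<delta>) * expect (seeds b) (\<lambda>\<omega>s. card (dis A e \<omega>s)) +
    4 * D * (\<Sum>z\<in>?B. pr (seeds b) (\<lambda>\<omega>s. M b < nb (alive A \<omega>s) z) + pr (seeds b) (\<lambda>\<omega>s. M b < nb (alive (A - {e}) \<omega>s) z))"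
    by (simp add: expect_add expect_sum finite_seeds pr_expect)
  also have "\<dots> \<le> (1 + 8 * \<delta>) * expect (seeds b) (\<lambda>\<omega>s. card (dis A e \<omega>s)) + 4 * D * (\<Sum>z\<in>?B. 2 / 3 * slack)"
  proof (intro add_left_mono mult_left_mono sum_mono)
    fix z assume "z \<in> ?B"
    then have z: "z \<in> A" using ball_subset[OF assms(2), of b] by auto
    have "pr (seeds b) (\<lambda>\<omega>s. M b < nb (alive C \<omega>s) z) \<le> slack / 3" if "C \<subseteq> A" for C
    proof -
      have "nb C z \<le> D" using nb_mono[OF that, of z] assms(3)[OF z] by simp
      then show ?thesis using overfull_le[of C "{}" b z] assms that by (auto simp: slack_def)
    qed
    from this[of A] this[of "A - {e}"]
    show "pr (seeds b) (\<lambda>\<omega>s. M b < nb (alive A \<omega>s) z) + pr (seeds b) (\<lambda>\<omega>s. M b < nb (alive (A - {e}) \<omega>s) z) \<le> 2 / 3 * slack"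
      by auto
  qed auto
  also have "4 * D * (\<Sum>z\<in>?B. 2 / 3 * slack) \<le> 3 * D * (2 * D + 1) ^ T * slack"
  proof -
    have s: "0 \<le> slack" using \<eta>_nonneg by (simp add: slack_def)
    have "card ?B \<le> (2 * D + 1) ^ b" by (rule card_ball_le) (use assms in auto)
    also have "\<dots> \<le> (2 * D + 1) ^ T" using assms by (intro power_increasing) auto
    finally have c: "real (card ?B) \<le> (2 * D + 1) ^ T" by (metis of_nat_le_iff)
    have "4 * D * (\<Sum>z\<in>?B. 2 / 3 * slack) = 8 / 3 * D * slack * card ?B" by simp
    also have "\<dots> \<le> 3 * D * slack * (2 * D + 1) ^ T"
      using s c by (intro mult_mono) auto
    finally show ?thesis by (simp add: mult_ac)
  qed
  finally show ?thesis by simp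
qed

text \<open>Iterating the recursion from a single disagreement at \<open>e\<close>; the condition
  \<open>small\<close> keeps the accumulated overload terms from more than doubling the
  result.\<close>

lemma expect_dis_le:
  assumes "A \<subseteq> V" "e \<in> A" "\<And>x. x \<in> A \<Longrightarrow> nb A x \<le> D" "b \<le> T"
    and small: "T * (3 * D * (2 * D + 1) ^ T * slack) \<le> 1"
  shows "expect (seeds b) (\<lambda>\<omega>s. card (dis A e \<omega>s)) \<le> 2 * exp (8 * \<delta> * T)"
proof -
  define a where "a = 3 * D * (2 * D + 1) ^ T * slack"
  have a: "0 \<le> a" using \<eta>_nonneg by (simp add: a_def slack_def)
  have "expect (seeds b) (\<lambda>\<omega>s. card (dis A e \<omega>s)) \<le> (1 + 8 * \<delta>) ^ b * (1 + b * a)"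
    using assms(4)
  proof (induction b)
    case 0
    have "sym_diff A (A - {e}) = {e}" using assms(2) by auto
    then show ?case by simp
  next
    case (Suc b)
    have "expect (seeds (Suc b)) (\<lambda>\<omega>s. card (dis A e \<omega>s)) \<le>
      (1 + 8 * \<delta>) * expect (seeds b) (\<lambda>\<omega>s. card (dis A e \<omega>s)) + a"
      unfolding a_def by (rule expect_dis_Suc) (use assms Suc.prems in auto)
    also have "\<dots> \<le> (1 + 8 * \<delta>) * ((1 + 8 * \<delta>) ^ b * (1 + b * a)) + (1 + 8 * \<delta>) ^ Suc b * a"
    proof (intro add_mono mult_left_mono)
      show "a \<le> (1 + 8 * \<delta>) ^ Suc b * a"
        using a \<delta>_nonneg mult_right_mono[OF one_le_power[of "1 + 8 * \<delta>" "Suc b"], of a] by simp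
    qed (use Suc \<delta>_nonneg in auto)
    also have "\<dots> = (1 + 8 * \<delta>) ^ Suc b * (1 + Suc b * a)" by (simp add: algebra_simps)
    finally show ?case .
  qed
  also have "\<dots> \<le> exp (8 * \<delta> * T) * 2"
  proof (intro mult_mono)
    have "(1 + 8 * \<delta>) ^ b \<le> exp (8 * \<delta>) ^ b"
      using \<delta>_nonneg exp_ge_add_one_self[of "8 * \<delta>"] by (intro power_mono) auto
    also have "\<dots> = exp (b * (8 * \<delta>))" by (simp add: exp_of_nat_mult)
    also have "\<dots> \<le> exp (8 * \<delta> * T)" using assms \<delta>_nonneg by (auto simp: mult_ac intro!: mult_left_mono)
    finally show "(1 + 8 * \<delta>) ^ b \<le> exp (8 * \<delta> * T)" .
    have "b * a \<le> T * a" using assms a by (intro mult_right_mono) auto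
    then show "1 + b * a \<le> 2" using small by (simp add: a_def)
  qed (use a in auto)
  finally show ?thesis by simp
qed

text \<open>In each round the hits differ only within two hyperedges of the disagreement, at most
  \<open>3 * D\<^sup>2\<close> hyperedges per disagreeing vertex, and the expected disagreement is
  bounded uniformly over the rounds.\<close>

lemma expect_matching_diff_le:
  assumes "A \<subseteq> V" "e \<in> A" "\<And>x. x \<in> A \<Longrightarrow> nb A x \<le> D"
    and small: "T * (3 * D * (2 * D + 1) ^ T * slack) \<le> 1"
  shows "expect (seeds T) (\<lambda>\<omega>s. card (sym_diff (matching A \<omega>s) (matching (A - {e}) \<omega>s))) \<le>
    T * (6 * D\<^sup>2 * exp (8 * \<delta> * T))"
proof -
  have "expect (seeds b) (\<lambda>\<omega>s. card (sym_diff (matching A \<omega>s) (matching (A - {e}) \<omega>s))) \<le>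
    b * (6 * D\<^sup>2 * exp (8 * \<delta> * T))" if "b \<le> T" for b
    using that
  proof (induction b)
    case (Suc b)
    let ?m = "\<lambda>\<omega>s. sym_diff (matching A \<omega>s) (matching (A - {e}) \<omega>s)"
    have arith: "real x \<le> real y + real z" if "x \<le> y + z" for x y z :: nat
      using that by simp
    have "expect (seeds (Suc b)) (\<lambda>\<omega>s. card (?m \<omega>s)) \<le>
      expect (seeds b) (\<lambda>\<omega>s. expect (round_pmf b) (\<lambda>\<omega>. real (card (?m \<omega>s)) + 3 * D\<^sup>2 * card (dis A e \<omega>s)))"
      unfolding expect_seeds_Suc
    proof (intro expect_mono finite_seeds finite_round)
      fix \<omega>s \<omega>
      let ?n = "near A (dis A e \<omega>s)"
      have fin: "finite (?m \<omega>s)" "finite ?n" "finite (dis A e \<omega>s)"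
      proof -
        show "finite (?m \<omega>s)" using matching_subset by (intro finite_subset[OF _ fin_E]) auto
        show "finite ?n" using fin_E by (auto simp: near_def)
        show "finite (dis A e \<omega>s)" using dis_subset_ball finite_ball finite_subset by metis
      qed
      have "?m (\<omega> # \<omega>s) \<subseteq> ?m \<omega>s \<union> sym_diff (hits \<omega> (alive A \<omega>s)) (hits \<omega> (alive (A - {e}) \<omega>s))"
        by auto
      also have "\<dots> \<subseteq> ?m \<omega>s \<union> ?n"
        using alive_subset[of A \<omega>s] alive_subset[of "A - {e}" \<omega>s]
        by (intro Un_mono hits_sym_diff) auto
      finally have "card (?m (\<omega> # \<omega>s)) \<le> card (?m \<omega>s \<union> ?n)" using fin by (intro card_mono) auto
      also have "\<dots> \<le> card (?m \<omega>s) + card ?n" by (rule card_Un_le)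
      also have "card ?n \<le> 3 * D\<^sup>2 * card (dis A e \<omega>s)" using fin assms by (intro card_near_le) auto
      finally have "card (?m (\<omega> # \<omega>s)) \<le> card (?m \<omega>s) + 3 * D\<^sup>2 * card (dis A e \<omega>s)" by simp
      then show "real (card (?m (\<omega> # \<omega>s))) \<le> real (card (?m \<omega>s)) + 3 * D\<^sup>2 * card (dis A e \<omega>s)"
        by (rule arith)
    qed
    also have "\<dots> = expect (seeds b) (\<lambda>\<omega>s. card (?m \<omega>s)) + 3 * D\<^sup>2 * expect (seeds b) (\<lambda>\<omega>s. card (dis A e \<omega>s))"
      by (simp add: expect_add finite_seeds)
    also have "\<dots> \<le> b * (6 * D\<^sup>2 * exp (8 * \<delta> * T)) + 3 * D\<^sup>2 * (2 * exp (8 * \<delta> * T))"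
      using Suc assms by (intro add_mono mult_left_mono expect_dis_le) auto
    finally show ?case by (simp add: algebra_simps)
  qed simp
  then show ?thesis by simp
qed

end

section \<open>The probability of being matched\<close>

context nibble
begin

text \<open>With capacity near \<open>D * exp (- 2 * \<delta> * b)\<close> the hit probability in
  round \<open>b\<close> is about \<open>D * (\<delta> / M b) * exp (- 3 * \<delta> * b)\<close>,
  that is \<open>\<delta> * exp (- \<delta> * b)\<close>, and the sum telescopes to
  \<open>1 - exp (- \<delta> * T)\<close>. Of the loss \<open>exp (- 4 * \<delta>)\<close>, three
  parts are the isolation of a hit and one is the gap between \<open>rate b\<close> and
  \<open>\<delta> / M b\<close>; the divisor \<open>1 + 2 * \<eta>\<close> is the surplus
  capacity.\<close>

lemma pr_matched_ge:
  assumes "A \<subseteq> V" "\<And>x. x \<in> A \<Longrightarrow> nb A x \<le> D" "e \<in> A" "nb A e = D"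
    and M_le: "\<And>b. b < T \<Longrightarrow> M b \<le> (1 + 2 * \<eta>) * D * exp (- 2 * \<delta> * b)"
    and small: "T * slack \<le> 1"
  shows "(1 - exp (- \<delta> * T)) * (exp (- 4 * \<delta>) * (1 - T * slack) / (1 + 2 * \<eta>)) \<le>
    pr (seeds T) (\<lambda>\<omega>s. \<exists>h\<in>matching A \<omega>s. e \<in> h)"
proof -
  have s: "0 \<le> slack" using \<eta>_nonneg by (simp add: slack_def)
  let ?c = "exp (- 4 * \<delta>) * (1 - T * slack) / (1 + 2 * \<eta>)"
  have c: "0 \<le> ?c" using small \<eta>_nonneg by simp
  have "(1 - exp (- \<delta> * T)) * ?c = (\<Sum>b<T. exp (- \<delta> * b) - exp (- \<delta> * Suc b)) * ?c"
    by (subst sum_lessThan_telescope') simp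
  also have "\<dots> \<le> (\<Sum>b<T. nb A e * (rate b * exp (- 3 * \<delta> * Suc b) * (1 - Suc b * slack)))"
    unfolding sum_distrib_right
  proof (rule sum_mono)
    fix b assume "b \<in> {..<T}"
    then have b: "b < T" by simp
    have Mb: "0 < real (M b)" using M_pos' by simp
    have D0: "0 < real D"
    proof (rule ccontr)
      assume "\<not> 0 < real D"
      then show False using M_le[OF b] Mb by simp
    qed
    have "exp (- \<delta> * b) - exp (- \<delta> * Suc b) = exp (- \<delta> * b) * (1 - exp (- \<delta>))"
      by (simp add: algebra_simps flip: exp_add)
    also have "\<dots> \<le> exp (- \<delta> * b) * \<delta>"
      using exp_ge_add_one_self[of "- \<delta>"] by (intro mult_left_mono) auto
    finally have "(exp (- \<delta> * b) - exp (- \<delta> * Suc b)) * ?c \<le> exp (- \<delta> * b) * \<delta> * ?c"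
      using c by (rule mult_right_mono)
    also have "\<dots> = (D * (\<delta> / ((1 + 2 * \<eta>) * D * exp (- 2 * \<delta> * b)) * exp (- \<delta>))) * exp (- 3 * \<delta> * Suc b) * (1 - T * slack)"
    proof -
      have "exp (- \<delta> * b) * exp (- 4 * \<delta>) = exp (2 * \<delta> * b) * exp (- \<delta>) * exp (- 3 * \<delta> * Suc b)"
        by (simp add: algebra_simps flip: exp_add)
      moreover have "D * (\<delta> / ((1 + 2 * \<eta>) * D * exp (- 2 * \<delta> * b)) * exp (- \<delta>)) = \<delta> * exp (2 * \<delta> * b) * exp (- \<delta>) / (1 + 2 * \<eta>)"
      proof -
        have "D * (\<delta> / (c * D * exp (- 2 * \<delta> * b)) * z) = \<delta> * exp (2 * \<delta> * b) * z / c" for c z :: real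
          using D0 by (cases "c = 0") (simp_all add: exp_minus field_simps)
        then show ?thesis .
      qed
      ultimately show ?thesis
        by (simp add: mult_ac)
    qed
    also have "\<dots> \<le> (D * rate b) * exp (- 3 * \<delta> * Suc b) * (1 - Suc b * slack)"
    proof (intro mult_mono mult_left_mono)
      have "\<delta> / ((1 + 2 * \<eta>) * D * exp (- 2 * \<delta> * b)) * exp (- \<delta>) \<le> \<delta> / M b * exp (- \<delta> / M b)"
      proof (intro mult_mono divide_left_mono M_le b mult_pos_pos)
        have "\<delta> / M b \<le> \<delta> / 1" using Mb \<delta>_nonneg by (intro divide_left_mono) auto
        then show "exp (- \<delta>) \<le> exp (- \<delta> / M b)" by simp
      qed (use Mb \<delta>_nonneg \<eta>_nonneg D0 in auto)
      also have "\<dots> \<le> rate b"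
        unfolding rate_def using exp_ge_add_one_self[of "\<delta> / M b"]
        by (simp add: exp_minus field_simps)
      finally show "\<delta> / ((1 + 2 * \<eta>) * D * exp (- 2 * \<delta> * b)) * exp (- \<delta>) \<le> rate b" .
      have "Suc b * slack \<le> T * slack" using s b by (intro mult_right_mono) auto
      then show "1 - T * slack \<le> 1 - Suc b * slack" by simp
    qed (use small rate_bounds \<delta>_nonneg \<eta>_nonneg in auto)
    finally show "(exp (- \<delta> * b) - exp (- \<delta> * Suc b)) * ?c \<le>
      nb A e * (rate b * exp (- 3 * \<delta> * Suc b) * (1 - Suc b * slack))"
      using assms(4) by (simp add: mult_ac)
  qed
  also have "\<dots> \<le> pr (seeds T) (\<lambda>\<omega>s. \<exists>h\<in>matching A \<omega>s. e \<in> h)"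
    using assms by (intro pr_matched_ge_sum) auto
  finally show ?thesis .
qed

end

subsection \<open>Choice of parameters\<close>

text \<open>Over all rounds the capacity stays above
  \<open>group_size \<theta> * \<theta>\<^sup>2 / 4\<close>. The inclusion-exclusion error is then
  of order \<open>\<theta>\<^sup>2 * ln (1 / \<theta>)\<close>, and \<open>moment \<theta>\<close>
  is negligible against \<theta> times the capacity.\<close>

definition group_size :: "real \<Rightarrow> nat" where "group_size \<theta> = nat \<lceil>1 / \<theta> ^ 12\<rceil>"
definition moment :: "real \<Rightarrow> nat" where "moment \<theta> = nat \<lceil>1 / \<theta> ^ 4\<rceil>"
definition rounds :: "real \<Rightarrow> nat" where "rounds \<theta> = nat \<lceil>ln (1 / \<theta>) / \<theta>\<rceil>"
definition capacity :: "real \<Rightarrow> nat \<Rightarrow> nat" where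
  "capacity \<theta> b = nat \<lceil>(1 + \<theta>) * group_size \<theta> * exp (- 2 * \<theta> * b)\<rceil> + moment \<theta> + 3"

text \<open>The conditions of the nibble and its two final estimates, with \<delta> and \<eta> both
  set to \<theta>. All ceilings are first replaced by closed forms, whose limits at 0 are then a
  matter of asymptotics in one variable.\<close>

lemma parameters:
  "\<forall>\<^sub>F \<theta>::real in at_right 0.
     (2 * moment \<theta> + 3)\<^sup>2 * (\<Sum>b<rounds \<theta>. \<theta> / capacity \<theta> b) \<le> ln 2 \<and>
     (\<forall>b<rounds \<theta>. capacity \<theta> b \<le> (1 + 2 * \<theta>) * group_size \<theta> * exp (- 2 * \<theta> * b)) \<and>
     rounds \<theta> * (3 * group_size \<theta> * (2 * group_size \<theta> + 1) ^ rounds \<theta> * (6 / (1 + \<theta>) ^ moment \<theta>)) \<le> 1 \<and>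
     exp (- \<theta> * rounds \<theta>) \<le> \<theta> \<and>
     rounds \<theta> * (6 * (group_size \<theta>)\<^sup>2 * exp (8 * \<theta> * rounds \<theta>)) \<le> 1 / \<theta> ^ 35"
proof -
  have e1: "\<forall>\<^sub>F \<theta>::real in at_right 0. \<theta> > 0 \<and> \<theta> < 1/2"
    using eventually_at_right_real[of 0 "1/2"] by simp
  have e2: "\<forall>\<^sub>F \<theta>::real in at_right 0.
    (2 / \<theta> ^ 4 + 5)\<^sup>2 * ((ln (1 / \<theta>) / \<theta> + 1) * (\<theta> / (1 / \<theta> ^ 12 * (\<theta> / 2)\<^sup>2))) \<le> ln 2"
    by real_asymp
  have e3: "\<forall>\<^sub>F \<theta>::real in at_right 0. 1 / \<theta> ^ 4 + 5 \<le> \<theta> * (1 / \<theta> ^ 12) * (\<theta> / 2)\<^sup>2"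
    by real_asymp
  have e4: "\<forall>\<^sub>F \<theta>::real in at_right 0.
    (ln (1 / \<theta>) / \<theta> + 1) * (3 * (1 / \<theta> ^ 12 + 1) * exp ((ln (1 / \<theta>) / \<theta> + 1) * ln (2 * (1 / \<theta> ^ 12 + 1) + 1)) *
      (6 * exp (- (1 / \<theta> ^ 4) * (\<theta> / 2)))) \<le> 1"
    by real_asymp
  have e5: "\<forall>\<^sub>F \<theta>::real in at_right 0.
    (ln (1 / \<theta>) / \<theta> + 1) * (6 * (1 / \<theta> ^ 12 + 1)\<^sup>2 * (2 / \<theta>) ^ 8) \<le> 1 / \<theta> ^ 35"
    by real_asymp
  show ?thesis
    using e1 e2 e3 e4 e5
  proof eventually_elim
    case (elim \<theta>)
    then have \<theta>: "0 < \<theta>" "\<theta> < 1 / 2" by auto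
    define D where "D = real (group_size \<theta>)"
    define k where "k = real (moment \<theta>)"
    define t where "t = real (rounds \<theta>)"
    have D: "1 / \<theta> ^ 12 \<le> D" "D \<le> 1 / \<theta> ^ 12 + 1"
      unfolding D_def group_size_def using \<theta> by (auto simp: of_nat_nat)
    have k: "1 / \<theta> ^ 4 \<le> k" "k \<le> 1 / \<theta> ^ 4 + 1"
      unfolding k_def moment_def using \<theta> by (auto simp: of_nat_nat)
    have l: "0 \<le> ln (1 / \<theta>)" using \<theta> by simp
    have t: "ln (1 / \<theta>) / \<theta> \<le> t" "t \<le> ln (1 / \<theta>) / \<theta> + 1"
      unfolding t_def rounds_def using \<theta> l by (auto simp: of_nat_nat)
    have D0: "0 < D" using D(1) \<theta> by (meson less_le_trans zero_less_divide_1_iff zero_less_power)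
    have t0: "0 \<le> t" by (simp add: t_def)
    have tl: "ln (1 / \<theta>) \<le> \<theta> * t" "\<theta> * t \<le> ln (1 / \<theta>) + \<theta>"
      using t \<theta> by (auto simp: field_simps)
    have "exp (- (\<theta> * t)) \<le> exp (- ln (1 / \<theta>))" using tl by simp
    also have "\<dots> = \<theta>" using \<theta> by (simp add: exp_minus)
    finally have a: "exp (- \<theta> * t) \<le> \<theta>" by simp
    have "exp \<theta> \<le> exp (1/2)" using \<theta> by simp
    also have "\<dots> \<le> 2" using exp_le_quadratic[of "1/2"] by (simp add: power2_eq_square)
    finally have e: "exp \<theta> \<le> 2" .
    have "exp (\<theta> * t) \<le> exp (ln (1 / \<theta>) + \<theta>)" using tl by simp
    also have "\<dots> = 1 / \<theta> * exp \<theta>" using \<theta> by (simp only: exp_add exp_ln zero_less_divide_1_iff)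
    also have "\<dots> \<le> 1 / \<theta> * 2" using e \<theta> by (intro mult_left_mono) auto
    finally have b: "exp (\<theta> * t) \<le> 2 / \<theta>" by simp
    \<comment> \<open>\<open>\<theta> * t\<close> is at most
      \<open>ln (1 / \<theta>) + \<theta>\<close>, so even at the last round the decay factor is not
      below \<open>(\<theta> / 2)\<^sup>2\<close>.\<close>
    have low: "(\<theta> / 2)\<^sup>2 \<le> exp (- 2 * \<theta> * real j)" if "j \<le> rounds \<theta>" for j
    proof -
      have "\<theta> * j \<le> \<theta> * t" using that \<theta> by (intro mult_left_mono) (auto simp: t_def)
      then have "exp (\<theta> * j) \<le> exp (\<theta> * t)" by simp
      then have "exp (\<theta> * j) \<le> 2 / \<theta>" using b by (rule order_trans)
      then have "\<theta> / 2 \<le> exp (- (\<theta> * j))"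
        using \<theta> by (simp add: exp_minus field_simps)
      then have "(\<theta> / 2)\<^sup>2 \<le> (exp (- (\<theta> * j)))\<^sup>2" using \<theta> by (intro power_mono) auto
      then show ?thesis by (simp add: exp_double[symmetric] mult_ac)
    qed
    have cap_ge: "D * (\<theta> / 2)\<^sup>2 \<le> capacity \<theta> j" if "j \<le> rounds \<theta>" for j
    proof -
      have "D * (\<theta> / 2)\<^sup>2 \<le> D * exp (- 2 * \<theta> * real j)"
        using low[OF that] D0 by (intro mult_left_mono) auto
      also have "\<dots> \<le> (1 + \<theta>) * (D * exp (- 2 * \<theta> * real j))"
        using \<theta> D0 by (simp add: mult_le_cancel_right1 not_le[symmetric] algebra_simps)
      also have "\<dots> \<le> capacity \<theta> j"
        unfolding capacity_def D_def by (simp add: mult.assoc) linarith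
      finally show ?thesis .
    qed
    have A: "(2 * moment \<theta> + 3)\<^sup>2 * (\<Sum>j<rounds \<theta>. \<theta> / capacity \<theta> j) \<le> ln 2"
    proof -
      have "(\<Sum>j<rounds \<theta>. \<theta> / capacity \<theta> j) \<le> (\<Sum>j<rounds \<theta>. \<theta> / (1 / \<theta> ^ 12 * (\<theta> / 2)\<^sup>2))"
      proof (intro sum_mono divide_left_mono)
        fix j assume "j \<in> {..<rounds \<theta>}"
        then have "D * (\<theta> / 2)\<^sup>2 \<le> capacity \<theta> j" by (intro cap_ge) auto
        moreover have "1 / \<theta> ^ 12 * (\<theta> / 2)\<^sup>2 \<le> D * (\<theta> / 2)\<^sup>2" using D by (intro mult_right_mono) auto
        ultimately show c: "1 / \<theta> ^ 12 * (\<theta> / 2)\<^sup>2 \<le> capacity \<theta> j" by simp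
        have "0 < 1 / \<theta> ^ 12 * (\<theta> / 2)\<^sup>2" using \<theta> by simp
        with c show "0 < capacity \<theta> j * (1 / \<theta> ^ 12 * (\<theta> / 2)\<^sup>2)" by (intro mult_pos_pos) auto
      qed (use \<theta> in auto)
      also have "\<dots> = t * (\<theta> / (1 / \<theta> ^ 12 * (\<theta> / 2)\<^sup>2))" by (simp add: t_def)
      also have "\<dots> \<le> (ln (1 / \<theta>) / \<theta> + 1) * (\<theta> / (1 / \<theta> ^ 12 * (\<theta> / 2)\<^sup>2))"
        using t \<theta> by (intro mult_right_mono) auto
      finally have s: "(\<Sum>j<rounds \<theta>. \<theta> / capacity \<theta> j) \<le> \<dots>" .
      have "2 * k + 3 \<le> 2 / \<theta> ^ 4 + 5" using k by simp
      then have "(2 * k + 3)\<^sup>2 \<le> (2 / \<theta> ^ 4 + 5)\<^sup>2" by (intro power_mono) (auto simp: k_def)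
      then have "(2 * k + 3)\<^sup>2 * (\<Sum>j<rounds \<theta>. \<theta> / capacity \<theta> j) \<le>
        (2 / \<theta> ^ 4 + 5)\<^sup>2 * ((ln (1 / \<theta>) / \<theta> + 1) * (\<theta> / (1 / \<theta> ^ 12 * (\<theta> / 2)\<^sup>2)))"
        using s \<theta> by (intro mult_mono) (auto intro!: sum_nonneg)
      also have "\<dots> \<le> ln 2" using elim by simp
      finally show ?thesis by (simp add: k_def)
    qed
    have B: "capacity \<theta> j \<le> (1 + 2 * \<theta>) * group_size \<theta> * exp (- 2 * \<theta> * j)" if "j < rounds \<theta>" for j
    proof -
      let ?x = "D * exp (- 2 * \<theta> * j)"
      have "0 \<le> (1 + \<theta>) * ?x" using \<theta> D0 by simp
      then have "capacity \<theta> j \<le> (1 + \<theta>) * ?x + 1 + k + 3"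
        unfolding capacity_def k_def D_def by (simp add: mult.assoc of_nat_nat) linarith
      moreover have "k + 4 \<le> \<theta> * ?x"
      proof -
        have "k + 4 \<le> \<theta> * (1 / \<theta> ^ 12) * (\<theta> / 2)\<^sup>2" using k elim by linarith
        also have "\<dots> \<le> \<theta> * D * exp (- 2 * \<theta> * j)"
          using low[of j] D that \<theta> D0 by (intro mult_mono) auto
        finally show ?thesis by (simp add: mult_ac)
      qed
      ultimately show ?thesis by (simp add: D_def algebra_simps)
    qed
    \<comment> \<open>The size of the ball is exponential in about
      \<open>ln (1 / \<theta>) ^ 2 / \<theta>\<close>, while
      \<open>(1 + \<theta>) ^ moment \<theta>\<close> is at least
      \<open>exp (1 / (2 * \<theta> ^ 3))\<close>.\<close>
    have C: "t * (3 * D * (2 * D + 1) ^ rounds \<theta> * (6 / (1 + \<theta>) ^ moment \<theta>)) \<le> 1"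
    proof -
      have "(2 * D + 1) ^ rounds \<theta> = exp (t * ln (2 * D + 1))"
        using D0 by (simp add: t_def exp_of_nat_mult)
      also have "\<dots> \<le> exp ((ln (1 / \<theta>) / \<theta> + 1) * ln (2 * (1 / \<theta> ^ 12 + 1) + 1))"
        using t t0 D D0 l \<theta> by (subst exp_le_cancel_iff, intro mult_mono) auto
      finally have 1: "(2 * D + 1) ^ rounds \<theta> \<le> \<dots>" .
      have "exp (1 / \<theta> ^ 4 * (\<theta> / 2)) \<le> exp (k * ln (1 + \<theta>))"
      proof (subst exp_le_cancel_iff, intro mult_mono k)
        have "\<theta> / 2 \<le> \<theta> - \<theta>\<^sup>2" using \<theta> mult_right_mono[of \<theta> "1/2" \<theta>] by (simp add: power2_eq_square)
        also have "\<dots> \<le> ln (1 + \<theta>)" using \<theta> by (intro ln_one_plus_pos_lower_bound) auto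
        finally show "\<theta> / 2 \<le> ln (1 + \<theta>)" .
      qed (use \<theta> k_def in auto)
      also have "\<dots> = (1 + \<theta>) ^ moment \<theta>" using \<theta> by (simp add: k_def exp_of_nat_mult)
      finally have 2: "6 / (1 + \<theta>) ^ moment \<theta> \<le> 6 / exp (1 / \<theta> ^ 4 * (\<theta> / 2))"
        using \<theta> by (intro divide_left_mono) auto
      have 3: "6 / exp (1 / \<theta> ^ 4 * (\<theta> / 2)) = 6 * exp (- (1 / \<theta> ^ 4) * (\<theta> / 2))"
        by (simp add: exp_minus field_simps)
      have "t * (3 * D * (2 * D + 1) ^ rounds \<theta> * (6 / (1 + \<theta>) ^ moment \<theta>)) \<le>
        (ln (1 / \<theta>) / \<theta> + 1) * (3 * (1 / \<theta> ^ 12 + 1) * exp ((ln (1 / \<theta>) / \<theta> + 1) * ln (2 * (1 / \<theta> ^ 12 + 1) + 1)) *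
          (6 * exp (- (1 / \<theta> ^ 4) * (\<theta> / 2))))"
        using 1 2[unfolded 3] t t0 D D0 \<theta> l by (intro mult_mono) auto
      also have "\<dots> \<le> 1" using elim by simp
      finally show ?thesis .
    qed
    \<comment> \<open>Of the exponent 35, two factors \<open>D\<close> take 24, the growth
      \<open>exp (8 * \<theta> * t)\<close> takes 8 and the number of rounds takes 1; the rest
      absorbs the logarithm and the constants.\<close>
    have G: "t * (6 * D\<^sup>2 * exp (8 * \<theta> * t)) \<le> 1 / \<theta> ^ 35"
    proof -
      have "exp (8 * \<theta> * t) = exp (\<theta> * t) ^ 8" by (simp flip: exp_of_nat_mult add: mult_ac)
      also have "\<dots> \<le> (2 / \<theta>) ^ 8" using b by (intro power_mono) auto
      finally have "exp (8 * \<theta> * t) \<le> (2 / \<theta>) ^ 8" .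
      then have "t * (6 * D\<^sup>2 * exp (8 * \<theta> * t)) \<le> (ln (1 / \<theta>) / \<theta> + 1) * (6 * (1 / \<theta> ^ 12 + 1)\<^sup>2 * (2 / \<theta>) ^ 8)"
        using t t0 D D0 \<theta> l by (intro mult_mono power_mono) auto
      also have "\<dots> \<le> 1 / \<theta> ^ 35" using elim by simp
      finally show ?thesis .
    qed
    show ?case
      using A B C G a by (simp add: D_def t_def add.commute)
  qed
qed

subsection \<open>Nibble colourings of graphs of bounded degree\<close>

text \<open>A hyperedge \<open>hyp e c\<close> stands for giving colour \<open>c\<close> to \<open>e\<close>: its vertices are the edge
  itself and the two slots of colour \<open>c\<close> at its endpoints, so that matchings are partial proper
  edge colourings.\<close>

type_synonym slot = "edge + nat \<times> nat"

definition hyp :: "edge \<Rightarrow> nat \<Rightarrow> slot set" where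
  "hyp e c = insert (Inl e) ((\<lambda>v. Inr (v, c)) ` e)"

definition all_edges :: "nat \<Rightarrow> graph" where "all_edges n = {e. e \<subseteq> {..<n} \<and> card e = 2}"

definition hyps :: "nat \<Rightarrow> nat \<Rightarrow> slot set set" where
  "hyps n D = (\<lambda>(e, c). hyp e c) ` (all_edges n \<times> {..<D})"

text \<open>The hyperedges are those of the complete graph and stay fixed; the current graph enters
  only as a set of alive vertices. An edge update is then the insertion or removal of the single
  vertex \<open>Inl e\<close>, the perturbation for which the nibble has been analysed.\<close>

definition slots :: "nat \<Rightarrow> nat \<Rightarrow> graph \<Rightarrow> slot set" where
  "slots n D H = Inl ` H \<union> Inr ` ({..<n} \<times> {..<D})"

lemma graph_on_iff: "graph_on n H \<longleftrightarrow> H \<subseteq> all_edges n"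
  by (auto simp: graph_on_def all_edges_def)

lemma finite_all_edges: "finite (all_edges n)"
  by (rule finite_subset[of _ "Pow {..<n}"]) (auto simp: all_edges_def)

lemma finite_graph_on: "graph_on n H \<Longrightarrow> finite H"
  using finite_all_edges finite_subset by (auto simp: graph_on_iff)

lemma all_edges_nonempty: "e \<in> all_edges n \<Longrightarrow> e \<noteq> {}"
  by (auto simp: all_edges_def)

lemma finite_mem_all_edges: "e \<in> all_edges n \<Longrightarrow> finite e"
  by (auto simp: all_edges_def intro: finite_subset)

lemma Inl_hyp [simp]: "Inl f \<in> hyp e c \<longleftrightarrow> f = e"
  and Inr_hyp [simp]: "Inr (v, d) \<in> hyp e c \<longleftrightarrow> v \<in> e \<and> d = c"
  by (auto simp: hyp_def)

lemma hyp_inject: "e \<noteq> {} \<Longrightarrow> hyp e c = hyp f d \<longleftrightarrow> e = f \<and> c = d"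
  by (metis Inl_hyp Inr_hyp ex_in_conv)

lemma card_hyp: "e \<in> all_edges n \<Longrightarrow> card (hyp e c) = 3"
  unfolding hyp_def using finite_mem_all_edges[of e n]
  by (subst card_insert_disjoint) (auto simp: card_image inj_on_def all_edges_def)

lemma card_edge_Int_le:
  assumes "e \<in> all_edges n" "f \<in> all_edges n" "e \<noteq> f"
  shows "card (e \<inter> f) \<le> 1"
proof -
  have fin: "finite e" "finite f" "card e = 2" "card f = 2"
    using assms(1,2) finite_mem_all_edges[OF assms(1)] finite_mem_all_edges[OF assms(2)]
    by (simp_all add: all_edges_def)
  have "e \<inter> f \<subset> e"
  proof (rule psubsetI)
    show "e \<inter> f \<noteq> e"
      using card_subset_eq[of f e] fin assms(3) by (metis inf.absorb_iff1)
  qed auto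
  then show ?thesis using psubset_card_mono[of e "e \<inter> f"] fin by simp
qed

text \<open>Two colours of one edge share only the vertex of that edge, and two different edges
  share at most one endpoint, hence at most one slot.\<close>

lemma linear_hyps: "linear_hypergraph (hyps n D)"
proof
  show "finite (hyps n D)" by (simp add: hyps_def finite_all_edges)
  show "card h = 3" if "h \<in> hyps n D" for h using that by (auto simp: hyps_def card_hyp)
  fix h h' assume "h \<in> hyps n D" "h' \<in> hyps n D" "h \<noteq> h'"
  then obtain e c f d where h: "h = hyp e c" "h' = hyp f d" "e \<in> all_edges n" "f \<in> all_edges n" "\<not> (e = f \<and> c = d)"
    by (auto simp: hyps_def)
  show "card (h \<inter> h') \<le> 1"
  proof (cases "e = f")
    case True
    then have "hyp e c \<inter> hyp f d \<subseteq> {Inl e}" using h by (auto simp: hyp_def)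
    then show ?thesis using card_mono[of "{Inl e}" "h \<inter> h'"] h by auto
  next
    case False
    have "hyp e c \<inter> hyp f d \<subseteq> (\<lambda>v. Inr (v, c)) ` (e \<inter> f)" using False by (auto simp: hyp_def)
    then have "card (h \<inter> h') \<le> card (e \<inter> f)"
      using h finite_mem_all_edges[of e n] by (intro surj_card_le) auto
    then show ?thesis using card_edge_Int_le[OF h(3,4) False] by simp
  qed
qed

lemma nb_slots_edge:
  assumes "e \<in> all_edges n" "H \<subseteq> all_edges n"
  shows "linear_hypergraph.nb (hyps n D) (slots n D H) (Inl e) = D"
proof -
  interpret linear_hypergraph "hyps n D" by (rule linear_hyps)
  have "{h \<in> hyps n D. Inl e \<in> h \<and> h - {Inl e} \<subseteq> slots n D H} = hyp e ` {..<D}"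
    using assms by (auto simp: hyps_def slots_def hyp_def all_edges_def)
  moreover have "inj_on (hyp e) {..<D}" using hyp_inject[OF all_edges_nonempty[OF assms(1)]] by (auto simp: inj_on_def)
  ultimately show ?thesis by (simp add: nb_def card_image)
qed

lemma nb_slots_color:
  assumes "H \<subseteq> all_edges n"
  shows "linear_hypergraph.nb (hyps n D) (slots n D H) (Inr (v, c)) \<le> node_degree H v"
proof -
  interpret linear_hypergraph "hyps n D" by (rule linear_hyps)
  have "{h \<in> hyps n D. Inr (v, c) \<in> h \<and> h - {Inr (v, c)} \<subseteq> slots n D H} \<subseteq> (\<lambda>e. hyp e c) ` {e \<in> H. v \<in> e}"
  proof
    fix h assume h: "h \<in> {h \<in> hyps n D. Inr (v, c) \<in> h \<and> h - {Inr (v, c)} \<subseteq> slots n D H}"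
    then obtain e where e: "h = hyp e c" "v \<in> e" by (auto simp: hyps_def)
    then have "Inl e \<in> slots n D H" using h by auto
    then show "h \<in> (\<lambda>e. hyp e c) ` {e \<in> H. v \<in> e}" using e by (auto simp: slots_def)
  qed
  moreover have "finite {e \<in> H. v \<in> e}"
    using assms by (intro finite_subset[OF _ finite_all_edges[of n]]) auto
  ultimately show ?thesis unfolding nb_def node_degree_def
    by (meson card_image_le card_mono finite_imageI order_trans)
qed

lemma nb_slots_le:
  assumes "graph_on n H" "max_degree_le n H D" "x \<in> slots n D H"
  shows "linear_hypergraph.nb (hyps n D) (slots n D H) x \<le> D"
  using assms nb_slots_edge[of _ n H D] nb_slots_color[of H n D]
  by (auto simp: slots_def graph_on_iff max_degree_le_def intro: order_trans[OF nb_slots_color[unfolded slots_def]])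

lemma nibble_hyps:
  assumes "(2 * moment \<theta> + 3)\<^sup>2 * (\<Sum>b<rounds \<theta>. \<theta> / capacity \<theta> b) \<le> ln 2" "0 < \<theta>"
  shows "nibble (hyps n (group_size \<theta>)) (slots n (group_size \<theta>) (all_edges n)) (capacity \<theta>) \<theta> \<theta>
    (group_size \<theta>) (moment \<theta>) (rounds \<theta>)"
proof (intro nibble.intro linear_hyps nibble_axioms.intro)
  show "finite (slots n (group_size \<theta>) (all_edges n))" by (simp add: slots_def finite_all_edges)
  show "(1 + \<theta>) * group_size \<theta> * exp (- 2 * \<theta> * b) + moment \<theta> + 3 \<le> capacity \<theta> b" for b
    unfolding capacity_def by simp linarith
qed (use assms in \<open>auto simp: capacity_def\<close>)

definition edge_color :: "slot set set \<Rightarrow> edge \<Rightarrow> nat option" where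
  "edge_color \<M> e = (if \<exists>c. hyp e c \<in> \<M> then Some (SOME c. hyp e c \<in> \<M>) else None)"

lemma edge_color_Some: "edge_color \<M> e = Some c \<Longrightarrow> hyp e c \<in> \<M>"
  by (auto simp: edge_color_def split: if_splits intro: someI)

text \<open>An edge whose set of candidate colours is the same in both matchings gets the same
  choice; so a changed edge owns a changed hyperedge, from which it can be recovered.\<close>

lemma card_edge_color_diff:
  assumes "finite (sym_diff \<M> \<N>)"
  shows "card {f. edge_color \<M> f \<noteq> edge_color \<N> f} \<le> card (sym_diff \<M> \<N>)"
proof (rule surj_card_le[OF assms])
  show "{f. edge_color \<M> f \<noteq> edge_color \<N> f} \<subseteq> (\<lambda>h. THE f. Inl f \<in> h) ` sym_diff \<M> \<N>"
  proof
    fix f assume "f \<in> {f. edge_color \<M> f \<noteq> edge_color \<N> f}"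
    then have ne: "edge_color \<M> f \<noteq> edge_color \<N> f" by simp
    have "\<exists>c. hyp f c \<in> sym_diff \<M> \<N>"
    proof (rule ccontr)
      assume "\<nexists>c. hyp f c \<in> sym_diff \<M> \<N>"
      then have iff: "hyp f c \<in> \<M> \<longleftrightarrow> hyp f c \<in> \<N>" for c by auto
      then have eq: "(SOME c. hyp f c \<in> \<M>) = (SOME c. hyp f c \<in> \<N>)" by (intro arg_cong[where f = Eps] ext)
      have "edge_color \<M> f = edge_color \<N> f"
        by (simp only: edge_color_def eq) (simp only: iff)
      then show False using ne by simp
    qed
    then obtain c where "hyp f c \<in> sym_diff \<M> \<N>" ..
    moreover have "(THE g. Inl g \<in> hyp f c) = f" by auto
    ultimately show "f \<in> (\<lambda>h. THE f. Inl f \<in> h) ` sym_diff \<M> \<N>" by (metis image_eqI)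
  qed
qed

text \<open>All that is used of the nibble from here on. Properness is required for every seed and
  every graph on the nodes; the two quantitative bounds are required only for graphs of maximum
  degree \<open>D\<close>. The distribution \<open>p\<close> does not depend on the graph.\<close>

definition nibble_coloring ::
  "real \<Rightarrow> nat \<Rightarrow> nat \<Rightarrow> 'r pmf \<Rightarrow> ('r \<Rightarrow> graph \<Rightarrow> edge \<Rightarrow> nat option) \<Rightarrow> bool" where
  "nibble_coloring \<theta> n D p col \<longleftrightarrow> finite (set_pmf p) \<and>
    (\<forall>\<omega> H e c. graph_on n H \<longrightarrow> col \<omega> H e = Some c \<longrightarrow> e \<in> H \<and> c < D) \<and>
    (\<forall>\<omega> H e f c. graph_on n H \<longrightarrow> col \<omega> H e = Some c \<longrightarrow> col \<omega> H f = Some c \<longrightarrow> e \<noteq> f \<longrightarrow> e \<inter> f = {}) \<and>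
    (\<forall>H e. graph_on n H \<longrightarrow> max_degree_le n H D \<longrightarrow> e \<in> H \<longrightarrow>
      pr p (\<lambda>\<omega>. col \<omega> H e = None) \<le> 9 * \<theta> \<and>
      expect p (\<lambda>\<omega>. card {f. col \<omega> H f \<noteq> col \<omega> (H - {e}) f}) \<le> 1 / \<theta> ^ 35)"

lemma nibble_coloring_exists:
  "\<forall>\<^sub>F \<theta>::real in at_right 0. \<forall>n. \<exists>(p :: (slot set + slot \<times> nat \<Rightarrow> bool) list pmf) col.
     nibble_coloring \<theta> n (group_size \<theta>) p col"
proof -
  have "\<forall>\<^sub>F \<theta>::real in at_right 0. \<theta> > 0 \<and> \<theta> < 1/2"
    using eventually_at_right_real[of 0 "1/2"] by simp
  then show ?thesis using parameters
  proof eventually_elim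
    case (elim \<theta>)
    then have \<theta>: "0 < \<theta>" "\<theta> < 1 / 2" by auto
    show ?case
    proof
      fix n
      define D where "D = group_size \<theta>"
      let ?V = "slots n D (all_edges n)"
      interpret nibble "hyps n D" ?V "capacity \<theta>" \<theta> \<theta> D "moment \<theta>" "rounds \<theta>"
        unfolding D_def using elim \<theta> by (intro nibble_hyps) auto
      define col where "col \<omega> H = edge_color (matching (slots n D H) \<omega>)" for \<omega> H
      let ?p = "seeds (rounds \<theta>)"
      have D1: "1 \<le> D" "1 / \<theta> \<le> D"
      proof -
        have "1 / \<theta> = 1 / \<theta> ^ 1" by simp
        also have "\<dots> \<le> 1 / \<theta> ^ 12" using \<theta> by (intro divide_left_mono power_decreasing) auto
        also have "\<dots> \<le> D" unfolding D_def group_size_def using \<theta> by (auto simp: of_nat_nat)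
        finally show "1 / \<theta> \<le> D" .
        moreover have "1 \<le> 1 / \<theta>" using \<theta> by simp
        ultimately show "1 \<le> D" by linarith
      qed
      have sl: "slack = 6 / (1 + \<theta>) ^ moment \<theta>" by (simp add: slack_def)
      have s0: "0 \<le> slack" using \<theta> by (simp add: slack_def)
      have small: "rounds \<theta> * (3 * D * (2 * D + 1) ^ rounds \<theta> * slack) \<le> 1"
        using elim by (simp add: sl D_def)
      \<comment> \<open>Since \<open>D\<close> is at least \<open>1 / \<theta>\<close>, this already
        follows from the much stronger \<open>small\<close>.\<close>
      have Tsl: "rounds \<theta> * slack \<le> \<theta>"
      proof -
        have "1 / \<theta> * (rounds \<theta> * slack) \<le> (3 * D * (2 * D + 1) ^ rounds \<theta>) * (rounds \<theta> * slack)"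
        proof (intro mult_right_mono)
          have "1 / \<theta> \<le> real D * 1" using D1 by simp
          also have "\<dots> \<le> real (3 * D) * real (2 * D + 1) ^ rounds \<theta>"
            by (intro mult_mono one_le_power) auto
          finally show "1 / \<theta> \<le> 3 * D * (2 * D + 1) ^ rounds \<theta>" by simp
        qed (use s0 in auto)
        also have "\<dots> \<le> 1" using small by (simp add: mult_ac)
        finally show ?thesis using \<theta> by (simp add: field_simps)
      qed
      have some: "e \<in> H \<and> c < D" if "graph_on n H" "col \<omega> H e = Some c" for \<omega> H e c
      proof -
        have "hyp e c \<in> hyps n D" "hyp e c \<subseteq> slots n D H"
          using matching_subset[of "hyp e c" "slots n D H" \<omega>] edge_color_Some that(2) by (auto simp: col_def)
        moreover have "Inl e \<in> hyp e c" by simp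
        ultimately have "Inl e \<in> slots n D H" by blast
        then have "e \<in> H" by (auto simp: slots_def)
        from \<open>hyp e c \<in> hyps n D\<close> obtain f d where f: "hyp f d = hyp e c" "f \<in> all_edges n" "d < D"
          by (auto simp: hyps_def)
        have "f = e \<and> d = c" using hyp_inject[OF all_edges_nonempty[OF f(2)]] f(1) by simp
        with f \<open>e \<in> H\<close> show ?thesis by simp
      qed
      have disj: "e \<inter> f = {}" if "graph_on n H" "col \<omega> H e = Some c" "col \<omega> H f = Some c" "e \<noteq> f" for \<omega> H e f c
      proof (rule ccontr)
        assume "e \<inter> f \<noteq> {}"
        then obtain v where "v \<in> e" "v \<in> f" by auto
        then have "hyp e c \<inter> hyp f c \<noteq> {}" by (auto simp: hyp_def)
        moreover have "hyp e c \<noteq> hyp f c" using that(4) by (metis Inl_hyp)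
        ultimately show False
          using matching_disjoint[of "hyp e c" "slots n D H" \<omega> "hyp f c"] edge_color_Some that by (auto simp: col_def)
      qed
      have fail: "pr ?p (\<lambda>\<omega>. col \<omega> H e = None) \<le> 9 * \<theta>"
        if "graph_on n H" "max_degree_le n H D" "e \<in> H" for H e
      proof -
        have e: "e \<in> all_edges n" "H \<subseteq> all_edges n" using that by (auto simp: graph_on_iff)
        have "(1 - exp (- \<theta> * rounds \<theta>)) * (exp (- 4 * \<theta>) * (1 - rounds \<theta> * slack) / (1 + 2 * \<theta>)) \<le>
          pr ?p (\<lambda>\<omega>s. \<exists>h\<in>matching (slots n D H) \<omega>s. Inl e \<in> h)"
        proof (rule pr_matched_ge)
          show "slots n D H \<subseteq> ?V" using e by (auto simp: slots_def)
          show "nb (slots n D H) (Inl e) = D" using nb_slots_edge e by auto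
          show "Inl e \<in> slots n D H" using that by (simp add: slots_def)
        qed (use nb_slots_le that elim Tsl \<theta> in \<open>auto simp: D_def\<close>)
        also have "\<dots> \<le> pr ?p (\<lambda>\<omega>. col \<omega> H e \<noteq> None)"
        proof (rule pr_mono)
          fix \<omega> assume "\<exists>h\<in>matching (slots n D H) \<omega>. Inl e \<in> h"
          then obtain h where h: "h \<in> matching (slots n D H) \<omega>" "Inl e \<in> h" by auto
          then obtain c where "h = hyp e c" using matching_subset[OF h(1)] by (auto simp: hyps_def)
          then show "col \<omega> H e \<noteq> None" using h by (auto simp: col_def edge_color_def)
        qed
        finally have 1: "(1 - exp (- \<theta> * rounds \<theta>)) * (exp (- 4 * \<theta>) * (1 - rounds \<theta> * slack) / (1 + 2 * \<theta>)) \<le> \<dots>" .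
        \<comment> \<open>The losses are \<theta> for edges alive after all rounds,
          \<open>4 * \<theta>\<close> from \<open>exp (- 4 * \<theta>)\<close>, \<theta> from
          \<open>slack\<close> and \<open>2 * \<theta>\<close> from the surplus capacity: 8 in
          total, rounded up to 9.\<close>
        have 2: "1 - 9 * \<theta> \<le> (1 - exp (- \<theta> * rounds \<theta>)) * (exp (- 4 * \<theta>) * (1 - rounds \<theta> * slack) / (1 + 2 * \<theta>))"
        proof (cases "9 * \<theta> < 1")
          case False
          have "0 \<le> 1 - exp (- \<theta> * rounds \<theta>)" "0 \<le> 1 - rounds \<theta> * slack" "0 \<le> 1 + 2 * \<theta>"
            using \<theta> Tsl by auto
          then have "0 \<le> (1 - exp (- \<theta> * rounds \<theta>)) * (exp (- 4 * \<theta>) * (1 - rounds \<theta> * slack) / (1 + 2 * \<theta>))"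
            by (intro mult_nonneg_nonneg divide_nonneg_nonneg exp_ge_zero)
          then show ?thesis using False by linarith
        next
          case True
          have "1 - 9 * \<theta> \<le> (1 - \<theta>) * ((1 - 4 * \<theta>) * (1 - \<theta>) * (1 - 2 * \<theta>))"
          proof -
            have "1 - 5 * \<theta> \<le> (1 - 4 * \<theta>) * (1 - \<theta>)" using \<theta> by (simp add: algebra_simps)
            then have "(1 - 5 * \<theta>) * (1 - 2 * \<theta>) \<le> (1 - 4 * \<theta>) * (1 - \<theta>) * (1 - 2 * \<theta>)"
              using \<theta> by (intro mult_right_mono) auto
            moreover have "1 - 7 * \<theta> \<le> (1 - 5 * \<theta>) * (1 - 2 * \<theta>)" using \<theta> by (simp add: algebra_simps)
            ultimately have "1 - 7 * \<theta> \<le> (1 - 4 * \<theta>) * (1 - \<theta>) * (1 - 2 * \<theta>)" by linarith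
            then have "(1 - \<theta>) * (1 - 7 * \<theta>) \<le> (1 - \<theta>) * ((1 - 4 * \<theta>) * (1 - \<theta>) * (1 - 2 * \<theta>))"
              using \<theta> by (intro mult_left_mono) auto
            moreover have "1 - 9 * \<theta> \<le> (1 - \<theta>) * (1 - 7 * \<theta>)" using \<theta> by (simp add: algebra_simps)
            ultimately show ?thesis by linarith
          qed
          also have "\<dots> \<le> (1 - exp (- \<theta> * rounds \<theta>)) * (exp (- 4 * \<theta>) * (1 - rounds \<theta> * slack) * (1 / (1 + 2 * \<theta>)))"
          proof (intro mult_mono)
            show "1 - 4 * \<theta> \<le> exp (- 4 * \<theta>)" using exp_ge_add_one_self[of "- 4 * \<theta>"] by simp
            show "1 - 2 * \<theta> \<le> 1 / (1 + 2 * \<theta>)" using \<theta> by (simp add: field_simps)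
          qed (use elim Tsl \<theta> True in auto)
          finally show ?thesis by simp
        qed
        have "1 - 9 * \<theta> \<le> pr ?p (\<lambda>\<omega>. col \<omega> H e \<noteq> None)" using 2 1 by (rule order_trans)
        then show ?thesis using pr_neg[of ?p "\<lambda>\<omega>. col \<omega> H e \<noteq> None"] by (simp only: not_not)
      qed
      have sens: "expect ?p (\<lambda>\<omega>. card {f. col \<omega> H f \<noteq> col \<omega> (H - {e}) f}) \<le> 1 / \<theta> ^ 35"
        if "graph_on n H" "max_degree_le n H D" "e \<in> H" for H e
      proof -
        have e: "e \<in> all_edges n" "H \<subseteq> all_edges n" using that by (auto simp: graph_on_iff)
        have eq: "slots n D (H - {e}) = slots n D H - {Inl e}" by (auto simp: slots_def)
        have "expect ?p (\<lambda>\<omega>. card {f. col \<omega> H f \<noteq> col \<omega> (H - {e}) f}) \<le>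
          expect ?p (\<lambda>\<omega>. card (sym_diff (matching (slots n D H) \<omega>) (matching (slots n D H - {Inl e}) \<omega>)))"
        proof (rule expect_mono[OF finite_seeds], rule of_nat_mono)
          fix \<omega>
          have "finite (sym_diff (matching (slots n D H) \<omega>) (matching (slots n D H - {Inl e}) \<omega>))"
            using matching_subset by (intro finite_subset[OF _ fin_E]) auto
          then show "card {f. col \<omega> H f \<noteq> col \<omega> (H - {e}) f} \<le>
            card (sym_diff (matching (slots n D H) \<omega>) (matching (slots n D H - {Inl e}) \<omega>))"
            unfolding col_def eq by (rule card_edge_color_diff)
        qed
        also have "\<dots> \<le> rounds \<theta> * (6 * D\<^sup>2 * exp (8 * \<theta> * rounds \<theta>))"
        proof (rule expect_matching_diff_le)
          show "slots n D H \<subseteq> ?V" using e by (auto simp: slots_def)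
          show "Inl e \<in> slots n D H" using that by (simp add: slots_def)
        qed (use nb_slots_le that small in auto)
        also have "\<dots> \<le> 1 / \<theta> ^ 35" using elim by (simp add: D_def)
        finally show ?thesis .
      qed
      have "nibble_coloring \<theta> n D ?p col"
        unfolding nibble_coloring_def
      proof (intro conjI[OF finite_seeds] conjI[OF _ conjI] allI impI)
        show "e \<in> H \<and> c < D" if "graph_on n H" "col \<omega> H e = Some c" for \<omega> H e c
          using that by (rule some)
        show "e \<inter> f = {}" if "graph_on n H" "col \<omega> H e = Some c" "col \<omega> H f = Some c" "e \<noteq> f" for \<omega> H e f c
          using that by (rule disj)
        show "pr ?p (\<lambda>\<omega>. col \<omega> H e = None) \<le> 9 * \<theta> \<and>
          expect ?p (\<lambda>\<omega>. card {f. col \<omega> H f \<noteq> col \<omega> (H - {e}) f}) \<le> 1 / \<theta> ^ 35"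
          if "graph_on n H" "max_degree_le n H D" "e \<in> H" for H e
          using fail[OF that] sens[OF that] by (rule conjI)
      qed
      then show "\<exists>(p :: (slot set + slot \<times> nat \<Rightarrow> bool) list pmf) col. nibble_coloring \<theta> n (group_size \<theta>) p col"
        unfolding D_def by blast
    qed
  qed
qed

subsection \<open>Random groups\<close>

lemma node_degree_mono: "finite H \<Longrightarrow> G \<subseteq> H \<Longrightarrow> node_degree G v \<le> node_degree H v"
  unfolding node_degree_def by (intro card_mono) auto

definition group :: "graph \<Rightarrow> (edge \<Rightarrow> nat) \<Rightarrow> nat \<Rightarrow> graph" where
  "group G g j = {e \<in> G. g e = j}"

text \<open>At a node overloaded within a group all edges of that group are dropped, not just the
  surplus. The core is thus a canonical function of graph and labels and has degree at most
  \<open>D\<close> for any labels, so the nibble always applies to it.\<close>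

definition core :: "nat \<Rightarrow> graph \<Rightarrow> (edge \<Rightarrow> nat) \<Rightarrow> nat \<Rightarrow> graph" where
  "core D G g j = {e \<in> group G g j. \<forall>v\<in>e. node_degree (group G g j) v \<le> D}"

lemma core_subset: "core D G g j \<subseteq> group G g j" "core D G g j \<subseteq> G"
  by (auto simp: core_def group_def)

lemma graph_on_subset: "graph_on n G \<Longrightarrow> H \<subseteq> G \<Longrightarrow> graph_on n H"
  by (auto simp: graph_on_def)

lemma max_degree_le_subset:
  "graph_on n G \<Longrightarrow> max_degree_le n G D \<Longrightarrow> H \<subseteq> G \<Longrightarrow> max_degree_le n H D"
  using node_degree_mono[OF finite_graph_on[of n G], of H] by (auto simp: max_degree_le_def intro: order_trans)

lemma graph_on_core: "graph_on n G \<Longrightarrow> graph_on n (core D G g j)"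
  using core_subset graph_on_subset by metis

lemma max_degree_core:
  assumes "graph_on n G" shows "max_degree_le n (core D G g j) D"
  unfolding max_degree_le_def
proof (intro allI impI)
  fix v
  let ?C = "core D G g j"
  have fin: "finite (group G g j)" using finite_graph_on[OF assms] by (auto simp: group_def)
  show "node_degree ?C v \<le> D"
  proof (cases "\<exists>e\<in>?C. v \<in> e")
    case True
    then have "node_degree (group G g j) v \<le> D" by (auto simp: core_def)
    then show ?thesis using node_degree_mono[OF fin core_subset(1)] order_trans by blast
  next
    case False
    then have "{e \<in> ?C. v \<in> e} = {}" by auto
    then show ?thesis unfolding node_degree_def by (metis card.empty zero_le)
  qed
qed

locale group_coloring =
  fixes \<theta> :: real and n D m :: nat and p :: "'r pmf" and col :: "'r \<Rightarrow> graph \<Rightarrow> edge \<Rightarrow> nat option"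
  assumes nib: "nibble_coloring \<theta> n D p col" and \<theta>_pos: "0 < \<theta>" and m_pos: "0 < m"
begin

lemmas nibD = nib[unfolded nibble_coloring_def]

lemma finite_p: "finite (set_pmf p)"
  by (rule nibD[THEN conjunct1])

lemma col_Some: "graph_on n H \<Longrightarrow> col \<omega> H e = Some c \<Longrightarrow> e \<in> H \<and> c < D"
  by (rule nibD[THEN conjunct2, THEN conjunct1, rule_format])

lemma col_disjoint:
  "graph_on n H \<Longrightarrow> col \<omega> H e = Some c \<Longrightarrow> col \<omega> H f = Some c \<Longrightarrow> e \<noteq> f \<Longrightarrow> e \<inter> f = {}"
  by (rule nibD[THEN conjunct2, THEN conjunct2, THEN conjunct1, rule_format])

lemma pr_col_None:
  "graph_on n H \<Longrightarrow> max_degree_le n H D \<Longrightarrow> e \<in> H \<Longrightarrow> pr p (\<lambda>\<omega>. col \<omega> H e = None) \<le> 9 * \<theta>"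
  by (rule nibD[THEN conjunct2, THEN conjunct2, THEN conjunct2, rule_format, THEN conjunct1])

lemma expect_col_diff:
  "graph_on n H \<Longrightarrow> max_degree_le n H D \<Longrightarrow> e \<in> H \<Longrightarrow>
    expect p (\<lambda>\<omega>. card {f. col \<omega> H f \<noteq> col \<omega> (H - {e}) f}) \<le> 1 / \<theta> ^ 35"
  by (rule nibD[THEN conjunct2, THEN conjunct2, THEN conjunct2, rule_format, THEN conjunct2])

definition label_pmf :: "(edge \<Rightarrow> nat) pmf" where
  "label_pmf = Pi_pmf (all_edges n) 0 (\<lambda>_. pmf_of_set {..<m})"

definition seeds_pmf :: "(nat \<Rightarrow> 'r) pmf" where
  "seeds_pmf = Pi_pmf {..<m} undefined (\<lambda>_. p)"

definition space_pmf :: "((edge \<Rightarrow> nat) \<times> (nat \<Rightarrow> 'r)) pmf" where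
  "space_pmf = pair_pmf label_pmf seeds_pmf"

text \<open>Group \<open>j\<close> owns the \<open>D\<close> colours from \<open>j * D\<close> on,
  so different groups can never conflict. \<open>None\<close> covers both the edges outside the core
  and those that the nibble missed.\<close>

fun status :: "(edge \<Rightarrow> nat) \<times> (nat \<Rightarrow> 'r) \<Rightarrow> graph \<Rightarrow> edge \<Rightarrow> nat option" where
  "status (g, \<xi>) G e = (if e \<in> G then map_option (\<lambda>c. g e * D + c) (col (\<xi> (g e)) (core D G g (g e)) e) else None)"

definition left :: "(edge \<Rightarrow> nat) \<times> (nat \<Rightarrow> 'r) \<Rightarrow> graph \<Rightarrow> graph" where
  "left \<omega> G = {e \<in> G. status \<omega> G e = None}"

lemma finite_labels: "finite (set_pmf (pmf_of_set {..<m}))"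
  using m_pos by (subst set_pmf_of_set) auto

lemma finite_label_pmf: "finite (set_pmf label_pmf)"
  unfolding label_pmf_def by (intro finite_set_Pi_pmf finite_all_edges finite_labels)

lemma finite_seeds_pmf: "finite (set_pmf seeds_pmf)"
  unfolding seeds_pmf_def by (intro finite_set_Pi_pmf finite_p) auto

lemma finite_space: "finite (set_pmf space_pmf)"
  by (simp add: space_pmf_def finite_label_pmf finite_seeds_pmf)

lemma label_less: "g \<in> set_pmf label_pmf \<Longrightarrow> e \<in> all_edges n \<Longrightarrow> g e < m"
  using m_pos set_pmf_of_set[of "{..<m}"]
  by (auto simp: label_pmf_def set_Pi_pmf finite_all_edges PiE_dflt_def lessThan_empty_iff)

lemma expect_seeds_component:
  assumes "j < m" shows "expect seeds_pmf (\<lambda>\<xi>. F (\<xi> j)) = expect p F"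
proof -
  have "expect seeds_pmf (\<lambda>\<xi>. F (\<xi> j)) = expect (map_pmf (\<lambda>\<xi>. \<xi> j) seeds_pmf) F" by simp
  also have "map_pmf (\<lambda>\<xi>. \<xi> j) seeds_pmf = p"
    unfolding seeds_pmf_def using assms by (subst Pi_pmf_component) auto
  finally show ?thesis .
qed

lemma status_less:
  assumes "graph_on n G" "g \<in> set_pmf label_pmf" "status (g, \<xi>) G e = Some x"
  shows "x < m * D"
proof -
  obtain c where c: "e \<in> G" "col (\<xi> (g e)) (core D G g (g e)) e = Some c" "x = g e * D + c"
    using assms(3) by (auto split: if_splits)
  have "c < D" using col_Some[OF graph_on_core[OF assms(1)] c(2)] by auto
  moreover have "g e < m" using label_less assms c by (auto simp: graph_on_iff)
  then have "(g e + 1) * D \<le> m * D" by (intro mult_le_mono1) auto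
  ultimately show ?thesis using c by simp
qed

lemma status_disjoint:
  assumes "graph_on n G" "status (g, \<xi>) G e = Some x" "status (g, \<xi>) G f = Some x" "e \<noteq> f"
  shows "e \<inter> f = {}"
proof -
  obtain c where c: "col (\<xi> (g e)) (core D G g (g e)) e = Some c" "x = g e * D + c"
    using assms(2) by (auto split: if_splits)
  obtain d where d: "col (\<xi> (g f)) (core D G g (g f)) f = Some d" "x = g f * D + d"
    using assms(3) by (auto split: if_splits)
  have cd: "c < D" "d < D" using col_Some graph_on_core assms(1) c(1) d(1) by blast+
  have "x div D = g e" "x mod D = c" using c cd by auto
  moreover have "x div D = g f" "x mod D = d" using d cd by auto
  ultimately have "g e = g f" "c = d" by auto
  then show ?thesis using col_disjoint[OF graph_on_core[OF assms(1)]] c d assms(4) by metis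
qed

section \<open>Effect of one edge update on the grouped colouring\<close>

lemma expect_col_diff_subset:
  assumes "graph_on n H" "max_degree_le n H D" "K \<subseteq> H"
  shows "expect p (\<lambda>\<omega>. card {f. col \<omega> H f \<noteq> col \<omega> K f}) \<le> card (H - K) * (1 / \<theta> ^ 35)"
proof -
  have finH: "finite H" using finite_graph_on assms by auto
  have fin_diff: "finite {f. col \<omega> A f \<noteq> col \<omega> B f}" if "A \<subseteq> H" "B \<subseteq> H" for \<omega> A B
  proof (rule finite_subset[OF _ finH], rule subsetI)
    fix f assume "f \<in> {f. col \<omega> A f \<noteq> col \<omega> B f}"
    then have "col \<omega> A f \<noteq> None \<or> col \<omega> B f \<noteq> None" by auto
    then show "f \<in> H" using col_Some graph_on_subset[OF assms(1)] that by blast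
  qed
  \<comment> \<open>The edges of \<open>F\<close> are removed one at a time; every intermediate
    graph is a subgraph of \<open>H\<close>, so it keeps the degree bound and the single-edge
    estimate applies.\<close>
  have "expect p (\<lambda>\<omega>. card {f. col \<omega> H f \<noteq> col \<omega> (H - F) f}) \<le> card F * (1 / \<theta> ^ 35)"
    if "finite F" "F \<subseteq> H" for F
    using that
  proof (induction F rule: finite_induct)
    case (insert e F)
    let ?H = "H - F"
    have eq: "H - insert e F = ?H - {e}" by auto
    have "expect p (\<lambda>\<omega>. card {f. col \<omega> H f \<noteq> col \<omega> (H - insert e F) f}) \<le>
      expect p (\<lambda>\<omega>. real (card {f. col \<omega> H f \<noteq> col \<omega> ?H f}) + real (card {f. col \<omega> ?H f \<noteq> col \<omega> (?H - {e}) f}))"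
    proof (rule expect_mono[OF finite_p])
      fix \<omega>
      have "{f. col \<omega> H f \<noteq> col \<omega> (H - insert e F) f} \<subseteq>
        {f. col \<omega> H f \<noteq> col \<omega> ?H f} \<union> {f. col \<omega> ?H f \<noteq> col \<omega> (?H - {e}) f}"
        unfolding eq by auto
      then have "card {f. col \<omega> H f \<noteq> col \<omega> (H - insert e F) f} \<le>
        card ({f. col \<omega> H f \<noteq> col \<omega> ?H f} \<union> {f. col \<omega> ?H f \<noteq> col \<omega> (?H - {e}) f})"
        using fin_diff[of H ?H \<omega>] fin_diff[of ?H "?H - {e}" \<omega>] by (intro card_mono finite_UnI) auto
      also have "\<dots> \<le> card {f. col \<omega> H f \<noteq> col \<omega> ?H f} + card {f. col \<omega> ?H f \<noteq> col \<omega> (?H - {e}) f}"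
        by (rule card_Un_le)
      finally show "real (card {f. col \<omega> H f \<noteq> col \<omega> (H - insert e F) f}) \<le>
        real (card {f. col \<omega> H f \<noteq> col \<omega> ?H f}) + real (card {f. col \<omega> ?H f \<noteq> col \<omega> (?H - {e}) f})"
        by linarith
    qed
    also have "\<dots> = expect p (\<lambda>\<omega>. real (card {f. col \<omega> H f \<noteq> col \<omega> ?H f})) +
      expect p (\<lambda>\<omega>. real (card {f. col \<omega> ?H f \<noteq> col \<omega> (?H - {e}) f}))"
      by (rule expect_add[OF finite_p])
    also have "\<dots> \<le> card F * (1 / \<theta> ^ 35) + 1 / \<theta> ^ 35"
    proof (rule add_mono)
      show "expect p (\<lambda>\<omega>. real (card {f. col \<omega> ?H f \<noteq> col \<omega> (?H - {e}) f})) \<le> 1 / \<theta> ^ 35"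
        using insert assms graph_on_subset[OF assms(1)] max_degree_le_subset[OF assms(1,2)]
        by (intro expect_col_diff) auto
    qed (use insert in auto)
    also have "\<dots> = card (insert e F) * (1 / \<theta> ^ 35)" using insert by (simp add: add_divide_distrib)
    finally show ?case .
  qed simp
  from this[of "H - K"] show ?thesis using assms(3) finH by (simp add: double_diff)
qed

text \<open>Removing \<open>e\<close> lowers group degrees only at its two endpoints. An edge can
  enter the core only at an endpoint whose degree has dropped to at most \<open>D\<close>, so at
  most \<open>D\<close> edges enter at each.\<close>

lemma core_remove:
  assumes "graph_on n G" "e \<in> G" "g e = j"
  defines "H \<equiv> core D G g j" and "H' \<equiv> core D (G - {e}) g j"
  shows "H - {e} \<subseteq> H'" "e \<notin> H'" "card (H' - H) \<le> 2 * D"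
proof -
  let ?A = "group G g j" and ?B = "group (G - {e}) g j"
  have fin: "finite G" using finite_graph_on assms by auto
  have A: "finite ?A" "finite ?B" "?B \<subseteq> ?A" "?A = insert e ?B"
    using fin assms by (auto simp: group_def)
  show "H - {e} \<subseteq> H'"
  proof
    fix f assume f: "f \<in> H - {e}"
    have "node_degree ?B v \<le> D" if "v \<in> f" for v
      using node_degree_mono[OF A(1,3), of v] f that by (fastforce simp: H_def core_def)
    then show "f \<in> H'" using f by (auto simp: H_def H'_def core_def group_def)
  qed
  show "e \<notin> H'" by (auto simp: H'_def core_def group_def)
  have "H' - H \<subseteq> (\<Union>w\<in>{w \<in> e. node_degree ?B w \<le> D}. {f \<in> ?B. w \<in> f})"
  proof
    fix f assume f: "f \<in> H' - H"
    then have fB: "f \<in> ?B" "\<And>v. v \<in> f \<Longrightarrow> node_degree ?B v \<le> D" by (auto simp: H'_def core_def)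
    moreover have "f \<in> ?A" using fB A by auto
    ultimately obtain w where w: "w \<in> f" "\<not> node_degree ?A w \<le> D" using f by (auto simp: H_def core_def)
    have "w \<in> e"
    proof (rule ccontr)
      assume "w \<notin> e"
      then have "{f \<in> ?A. w \<in> f} = {f \<in> ?B. w \<in> f}" using A(4) by auto
      then show False using w fB(2)[OF w(1)] by (simp add: node_degree_def)
    qed
    then show "f \<in> (\<Union>w\<in>{w \<in> e. node_degree ?B w \<le> D}. {f \<in> ?B. w \<in> f})" using w fB by auto
  qed
  have e: "card e = 2" "finite e" using assms finite_mem_all_edges[of e n] by (auto simp: graph_on_iff all_edges_def)
  then have "card (H' - H) \<le> card (\<Union>w\<in>{w \<in> e. node_degree ?B w \<le> D}. {f \<in> ?B. w \<in> f})"
    using A \<open>H' - H \<subseteq> _\<close> by (intro card_mono finite_UN_I) auto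
  also have "\<dots> \<le> (\<Sum>w\<in>{w \<in> e. node_degree ?B w \<le> D}. node_degree ?B w)"
    unfolding node_degree_def using e by (intro card_UN_le) auto
  also have "\<dots> \<le> (\<Sum>w\<in>{w \<in> e. node_degree ?B w \<le> D}. D)" by (intro sum_mono) auto
  also have "\<dots> \<le> 2 * D"
    using e card_mono[of e "{w \<in> e. node_degree ?B w \<le> D}"] by (simp add: mult_le_mono1)
  finally show "card (H' - H) \<le> 2 * D" .
qed

text \<open>For fixed labels only the group of \<open>e\<close> is affected. Its old and new cores
  are both compared with the old core without \<open>e\<close>, a subset of both, from which they
  differ by at most 1 and \<open>2 * D\<close> edges; the final 1 accounts for \<open>e\<close>
  itself.\<close>

lemma expect_status_diff:
  assumes "graph_on n G" "e \<in> G"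
  shows "expect space_pmf (\<lambda>\<omega>. card {f. status \<omega> G f \<noteq> status \<omega> (G - {e}) f}) \<le> (2 * D + 1) * (1 / \<theta> ^ 35) + 1"
proof -
  have finG: "finite G" using finite_graph_on assms by auto
  have "expect seeds_pmf (\<lambda>\<xi>. card {f. status (g, \<xi>) G f \<noteq> status (g, \<xi>) (G - {e}) f}) \<le> (2 * D + 1) * (1 / \<theta> ^ 35) + 1"
    if g: "g \<in> set_pmf label_pmf" for g
  proof -
    define j where "j = g e"
    define H where "H = core D G g j"
    define H' where "H' = core D (G - {e}) g j"
    have jm: "j < m" using label_less[OF g] assms by (auto simp: j_def graph_on_iff)
    have gr: "graph_on n H" "max_degree_le n H D" "graph_on n H'" "max_degree_le n H' D" "graph_on n (G - {e})"
      using assms graph_on_subset[OF assms(1), of "G - {e}"] unfolding H_def H'_def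
      by (auto intro!: graph_on_core max_degree_core)
    note cr = core_remove[OF assms(1,2), of g j, folded H_def H'_def, OF j_def[symmetric]]
    have finHH: "finite H" "finite H'" using finite_graph_on gr by auto
    have sub: "H \<subseteq> G" "H' \<subseteq> G" unfolding H_def H'_def using core_subset(2) by blast+
    have fin_diff: "finite {f. col \<omega> A f \<noteq> col \<omega> B f}" if "A \<subseteq> G" "B \<subseteq> G" for \<omega> A B
    proof (rule finite_subset[OF _ finG], rule subsetI)
      fix f assume "f \<in> {f. col \<omega> A f \<noteq> col \<omega> B f}"
      then have "col \<omega> A f \<noteq> None \<or> col \<omega> B f \<noteq> None" by auto
      then show "f \<in> G" using col_Some graph_on_subset[OF assms(1)] that by blast
    qed
    let ?K = "H - {e}"
    have "expect seeds_pmf (\<lambda>\<xi>. card {f. status (g, \<xi>) G f \<noteq> status (g, \<xi>) (G - {e}) f}) \<le>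
      expect seeds_pmf (\<lambda>\<xi>. 1 + (real (card {f. col (\<xi> j) H f \<noteq> col (\<xi> j) ?K f}) + real (card {f. col (\<xi> j) H' f \<noteq> col (\<xi> j) ?K f})))"
    proof (rule expect_mono[OF finite_seeds_pmf])
      fix \<xi>
      let ?d1 = "{f. col (\<xi> j) H f \<noteq> col (\<xi> j) ?K f}" and ?d2 = "{f. col (\<xi> j) H' f \<noteq> col (\<xi> j) ?K f}"
      have "{f. status (g, \<xi>) G f \<noteq> status (g, \<xi>) (G - {e}) f} \<subseteq> {e} \<union> (?d1 \<union> ?d2)"
      proof
        fix f assume f: "f \<in> {f. status (g, \<xi>) G f \<noteq> status (g, \<xi>) (G - {e}) f}"
        show "f \<in> {e} \<union> (?d1 \<union> ?d2)"
        proof (rule ccontr)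
          assume nf: "f \<notin> {e} \<union> (?d1 \<union> ?d2)"
          have "core D G g (g f) = core D (G - {e}) g (g f)" if "g f \<noteq> j"
          proof -
            have "group G g (g f) = group (G - {e}) g (g f)" using that by (auto simp: group_def j_def)
            then show ?thesis by (simp add: core_def)
          qed
          then have "col (\<xi> (g f)) (core D G g (g f)) f = col (\<xi> (g f)) (core D (G - {e}) g (g f)) f"
            using nf by (cases "g f = j") (simp_all add: H_def H'_def)
          moreover have "f \<noteq> e" using nf by simp
          ultimately have "status (g, \<xi>) G f = status (g, \<xi>) (G - {e}) f" by simp
          then show False using f by simp
        qed
      qed
      then have "card {f. status (g, \<xi>) G f \<noteq> status (g, \<xi>) (G - {e}) f} \<le> card ({e} \<union> (?d1 \<union> ?d2))"
        using fin_diff[of H ?K "\<xi> j"] fin_diff[of H' ?K "\<xi> j"] sub by (intro card_mono finite_UnI) auto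
      also have "\<dots> \<le> card {e} + card (?d1 \<union> ?d2)" by (rule card_Un_le)
      also have "card (?d1 \<union> ?d2) \<le> card ?d1 + card ?d2" by (rule card_Un_le)
      finally show "real (card {f. status (g, \<xi>) G f \<noteq> status (g, \<xi>) (G - {e}) f}) \<le> 1 + (real (card ?d1) + real (card ?d2))"
        by simp
    qed
    also have "\<dots> = 1 + (expect p (\<lambda>\<omega>. real (card {f. col \<omega> H f \<noteq> col \<omega> ?K f})) + expect p (\<lambda>\<omega>. real (card {f. col \<omega> H' f \<noteq> col \<omega> ?K f})))"
      using expect_seeds_component[OF jm, of "\<lambda>\<omega>. real (card {f. col \<omega> H f \<noteq> col \<omega> ?K f})"]
        expect_seeds_component[OF jm, of "\<lambda>\<omega>. real (card {f. col \<omega> H' f \<noteq> col \<omega> ?K f})"]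
      by (simp add: expect_add finite_seeds_pmf)
    also have "\<dots> \<le> 1 + (1 * (1 / \<theta> ^ 35) + 2 * D * (1 / \<theta> ^ 35))"
    proof (intro add_left_mono add_mono)
      have "card (H - ?K) \<le> 1" using card_mono[of "{e}" "H - ?K"] by auto
      then have "card (H - ?K) * (1 / \<theta> ^ 35) \<le> 1 * (1 / \<theta> ^ 35)"
        using \<theta>_pos by (intro mult_right_mono) auto
      then show "expect p (\<lambda>\<omega>. real (card {f. col \<omega> H f \<noteq> col \<omega> ?K f})) \<le> 1 * (1 / \<theta> ^ 35)"
        using expect_col_diff_subset[of H ?K] gr by auto
      have "card (H' - ?K) \<le> 2 * D"
      proof -
        have "H' - ?K = H' - H" using cr(2) by auto
        then show ?thesis using cr(3) by simp
      qed
      then have "card (H' - ?K) * (1 / \<theta> ^ 35) \<le> 2 * D * (1 / \<theta> ^ 35)"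
        using \<theta>_pos by (intro mult_right_mono) auto
      then show "expect p (\<lambda>\<omega>. real (card {f. col \<omega> H' f \<noteq> col \<omega> ?K f})) \<le> 2 * D * (1 / \<theta> ^ 35)"
        using expect_col_diff_subset[of H' ?K] gr cr(1) by auto
    qed
    also have "\<dots> = (2 * D + 1) * (1 / \<theta> ^ 35) + 1" by (simp add: add_divide_distrib)
    finally show ?thesis .
  qed
  then show ?thesis unfolding space_pmf_def
    by (subst expect_pair[OF finite_label_pmf finite_seeds_pmf]) (rule expect_le[OF finite_label_pmf])
qed

end

subsection \<open>Few edges are left uncoloured at a node\<close>

text \<open>The mean group degree is at most \<open>\<Delta> / m\<close>; \<open>D_ge\<close> leaves
  a relative headroom \<theta>, and one place for the edge \<open>{v, u}\<close> that is looked at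
  separately when overload at \<open>u\<close> is studied. \<open>tail_le\<close> bounds the chance
  that the excess over the mean reaches half of the headroom. \<open>s\<close> is about
  \<open>\<theta> * m\<close>, the number of overloaded groups allowed for at a node.\<close>

locale group_coloring_params = group_coloring +
  fixes \<Delta> s :: nat
  assumes \<theta>_le: "\<theta> \<le> 1"
    and D_ge: "(1 + \<theta>) * \<Delta> / m + 1 \<le> D"
    and tail_le: "exp (- (\<theta>\<^sup>2 * \<Delta> / (16 * m))) \<le> \<theta>"
    and s_le: "s \<le> m" and s_ge: "\<theta> * m \<le> s"
begin

lemma D_pos: "0 < D"
proof -
  have "0 \<le> (1 + \<theta>) * \<Delta> / m" using \<theta>_pos by simp
  then have "0 < real D" using D_ge by linarith
  then show ?thesis by simp
qed

lemma D_ge': "(1 + \<theta>) * \<Delta> / m \<le> D"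
  using D_ge by linarith

lemma card_edges_at: "graph_on n G \<Longrightarrow> max_degree_le n G \<Delta> \<Longrightarrow> card {f \<in> G. v \<in> f} \<le> \<Delta>"
proof (cases "v < n")
  case False
  assume "graph_on n G"
  then have "{f \<in> G. v \<in> f} = {}" using False by (auto simp: graph_on_def)
  then show ?thesis by (metis card.empty zero_le)
qed (auto simp: max_degree_le_def node_degree_def)

text \<open>For fixed labels the groups have independent seeds, and the number of core edges at
  \<open>v\<close> missed in a group is at most \<open>D\<close>, with mean at most
  \<open>9 * \<theta> * D\<close>. Concentration thus comes from the number of groups alone.\<close>

lemma uncolored_tail:
  assumes G: "graph_on n G" and g: "g \<in> set_pmf label_pmf"
  shows "pr seeds_pmf (\<lambda>\<xi>. 20 * \<theta> * m * D \<le>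
     card {f \<in> G. v \<in> f \<and> f \<in> core D G g (g f) \<and> status (g, \<xi>) G f = None}) \<le> exp (- (2 * \<theta> * m))"
proof -
  let ?C = "\<lambda>j. core D G g j"
  let ?X = "\<lambda>j \<omega>. {f \<in> ?C j. v \<in> f \<and> col \<omega> (?C j) f = None}"
  define F where "F j \<xi> = real (card (?X j (\<xi> j))) / D" for j and \<xi> :: "nat \<Rightarrow> 'a"
  have finC: "finite (?C j)" for j using finite_graph_on[OF graph_on_core[OF G]] .
  have Cv: "card {f \<in> ?C j. v \<in> f} \<le> D" for j
  proof (cases "v < n")
    case True
    then show ?thesis using max_degree_core[OF G] by (auto simp: max_degree_le_def node_degree_def)
  next
    case False
    then have "{f \<in> ?C j. v \<in> f} = {}" using graph_on_core[OF G, of D g j] by (auto simp: graph_on_def)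
    then show ?thesis by (metis card.empty zero_le)
  qed
  have XD: "card (?X j \<omega>) \<le> D" for j \<omega>
    using finC by (intro order_trans[OF card_mono Cv[of j]]) auto
  have "pr seeds_pmf (\<lambda>\<xi>. 20 * \<theta> * m * D \<le>
     card {f \<in> G. v \<in> f \<and> f \<in> core D G g (g f) \<and> status (g, \<xi>) G f = None}) \<le>
    pr seeds_pmf (\<lambda>\<xi>. 20 * \<theta> * m \<le> (\<Sum>j<m. F j \<xi>))"
  proof (rule pr_mono)
    fix \<xi>
    assume le: "20 * \<theta> * m * D \<le> card {f \<in> G. v \<in> f \<and> f \<in> core D G g (g f) \<and> status (g, \<xi>) G f = None}"
    have "{f \<in> G. v \<in> f \<and> f \<in> core D G g (g f) \<and> status (g, \<xi>) G f = None} \<subseteq> (\<Union>j<m. ?X j (\<xi> j))"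
    proof
      fix f assume f: "f \<in> {f \<in> G. v \<in> f \<and> f \<in> core D G g (g f) \<and> status (g, \<xi>) G f = None}"
      then have "g f < m" using label_less[OF g] G by (auto simp: graph_on_iff)
      then show "f \<in> (\<Union>j<m. ?X j (\<xi> j))" using f by auto
    qed
    then have "card {f \<in> G. v \<in> f \<and> f \<in> core D G g (g f) \<and> status (g, \<xi>) G f = None} \<le> card (\<Union>j<m. ?X j (\<xi> j))"
      using finC by (intro card_mono) auto
    also have "\<dots> \<le> (\<Sum>j<m. card (?X j (\<xi> j)))" by (rule card_UN_le) simp
    finally have "20 * \<theta> * m * D \<le> real (\<Sum>j<m. card (?X j (\<xi> j)))" using le by linarith
    also have "\<dots> = (\<Sum>j<m. F j \<xi>) * D" using D_pos by (simp add: F_def flip: sum_divide_distrib)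
    finally show "20 * \<theta> * m \<le> (\<Sum>j<m. F j \<xi>)" using D_pos by simp
  qed
  \<comment> \<open>With \<open>l = 1\<close> the threshold only has to exceed twice the mean sum
    \<open>9 * \<theta> * m\<close>, hence the 20.\<close>
  also have "\<dots> \<le> exp ((1 + 1\<^sup>2) * (\<Sum>j<m. 9 * \<theta>) - 1 * (20 * \<theta> * m))"
    unfolding seeds_pmf_def
  proof (rule chernoff_Pi_pmf[where S = "\<lambda>j. {j}"])
    fix j assume j: "j \<in> {..<m}"
    show "depends_on {j} (F j)" by (simp add: depends_on_def F_def)
    show "F j \<xi> \<in> {0..1}" for \<xi> using XD[of j "\<xi> j"] D_pos by (simp add: F_def)
    have "F j = (\<lambda>\<xi>. real (card (?X j (\<xi> j))) / D)" by (simp add: F_def fun_eq_iff)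
    then have "expect seeds_pmf (F j) = expect seeds_pmf (\<lambda>\<xi>. real (card (?X j (\<xi> j))) / D)" by (simp only:)
    also have "\<dots> = expect p (\<lambda>\<omega>. real (card (?X j \<omega>)) / D)"
      by (rule expect_seeds_component) (use j in auto)
    also have "\<dots> = expect p (\<lambda>\<omega>. real (card (?X j \<omega>))) / D" by (rule integral_divide_zero)
    also have "expect p (\<lambda>\<omega>. real (card (?X j \<omega>))) = (\<Sum>f\<in>{f \<in> ?C j. v \<in> f}. pr p (\<lambda>\<omega>. f \<in> ?X j \<omega>))"
      using finC by (intro expect_card_le_sum_pr finite_p) auto
    also have "\<dots> \<le> (\<Sum>f\<in>{f \<in> ?C j. v \<in> f}. 9 * \<theta>)"
    proof (rule sum_mono)
      fix f assume f: "f \<in> {f \<in> ?C j. v \<in> f}"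
      then have "pr p (\<lambda>\<omega>. col \<omega> (?C j) f = None) \<le> 9 * \<theta>"
        using graph_on_core[OF G] max_degree_core[OF G] by (intro pr_col_None) auto
      then show "pr p (\<lambda>\<omega>. f \<in> ?X j \<omega>) \<le> 9 * \<theta>" using f by simp
    qed
    also have "\<dots> = card {f \<in> ?C j. v \<in> f} * (9 * \<theta>)" by simp
    also have "\<dots> \<le> D * (9 * \<theta>)" using Cv[of j] \<theta>_pos by (intro mult_right_mono) auto
    finally show "expect (Pi_pmf {..<m} undefined (\<lambda>_. p)) (F j) \<le> 9 * \<theta>"
      using D_pos by (simp add: seeds_pmf_def divide_right_mono field_simps)
  qed (use finite_p in \<open>auto simp: disjoint_family_on_def\<close>)
  also have "\<dots> = exp (- (2 * \<theta> * m))" by simp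
  finally show ?thesis .
qed

section \<open>Edges dropped because of overloaded groups\<close>

lemma label_indicator_mean:
  assumes "f \<in> I" "finite I"
  shows "expect (Pi_pmf I 0 (\<lambda>_. pmf_of_set {..<m})) (\<lambda>g. of_bool (g f \<in> J)) \<le> card (J \<inter> {..<m}) / m"
proof -
  have "expect (Pi_pmf I 0 (\<lambda>_. pmf_of_set {..<m})) (\<lambda>g. of_bool (g f \<in> J)) =
    expect (map_pmf (\<lambda>g. g f) (Pi_pmf I 0 (\<lambda>_. pmf_of_set {..<m}))) (\<lambda>x. of_bool (x \<in> J))"
    by simp
  also have "map_pmf (\<lambda>g. g f) (Pi_pmf I 0 (\<lambda>_. pmf_of_set {..<m})) = pmf_of_set {..<m}"
    using assms by (subst Pi_pmf_component) auto
  also have "expect (pmf_of_set {..<m}) (\<lambda>x. of_bool (x \<in> J)) = card (J \<inter> {..<m}) / m"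
    using m_pos unfolding pr_expect[symmetric] by (subst measure_pmf_of_set) (auto simp: Int_commute)
  finally show ?thesis by simp
qed

text \<open>In the bad event some set \<open>J\<close> of exactly \<open>s\<close> groups receives
  at least \<open>s * D\<close> edges at \<open>v\<close>: either the overloaded groups fit into
  \<open>J\<close>, or there are more than \<open>s\<close> of them and any \<open>s\<close> will
  do. For fixed \<open>J\<close> this is a deviation of a sum of independent label indicators, whose
  mean is at most \<open>s * \<Delta> / m\<close>; the factor \<open>2 ^ m\<close> pays for the
  choice of \<open>J\<close>.\<close>

lemma overload_self_tail:
  assumes G: "graph_on n G" "max_degree_le n G \<Delta>"
  shows "pr label_pmf (\<lambda>g. s * D \<le> card {f \<in> G. v \<in> f \<and> D < node_degree (group G g (g f)) v}) \<le>
    2 ^ m * exp (- (\<theta> ^ 3 * \<Delta> / 4))"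
proof -
  let ?v = "{f \<in> G. v \<in> f}"
  have finv: "finite ?v" using finite_graph_on[OF G(1)] by auto
  have vI: "?v \<subseteq> all_edges n" using G by (auto simp: graph_on_iff)
  let ?NJ = "\<lambda>J g. \<Sum>f\<in>?v. of_bool (g f \<in> J) :: real"
  let ?JJ = "{J. J \<subseteq> {..<m} \<and> card J = s}"
  have card_NJ: "?NJ J g = real (card {f \<in> ?v. g f \<in> J})" for J g
    using finv by (simp add: of_bool_def sum.If_cases Int_def conj_ac)
  have finJ: "finite ?JJ" by (rule finite_subset[of _ "Pow {..<m}"]) auto
  have "pr label_pmf (\<lambda>g. s * D \<le> card {f \<in> G. v \<in> f \<and> D < node_degree (group G g (g f)) v}) \<le>
    pr label_pmf (\<lambda>g. \<exists>J\<in>?JJ. s * D \<le> ?NJ J g)"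
  proof (rule pr_mono)
    fix g assume g: "g \<in> set_pmf label_pmf"
      and le: "s * D \<le> card {f \<in> G. v \<in> f \<and> D < node_degree (group G g (g f)) v}"
    define J0 where "J0 = {j \<in> {..<m}. D < node_degree (group G g j) v}"
    have deg: "node_degree (group G g j) v = card {f \<in> ?v. g f = j}" for j
      unfolding node_degree_def group_def by (intro arg_cong[where f = card]) auto
    show "\<exists>J\<in>?JJ. s * D \<le> ?NJ J g"
    proof (cases "card J0 \<le> s")
      case True
      then obtain J where J: "J0 \<subseteq> J" "J \<subseteq> {..<m}" "card J = s"
        using exists_subset_between[of J0 s "{..<m}"] s_le by (auto simp: J0_def)
      have "{f \<in> G. v \<in> f \<and> D < node_degree (group G g (g f)) v} \<subseteq> {f \<in> ?v. g f \<in> J}"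
        using J label_less[OF g] vI by (auto simp: J0_def)
      then have "card {f \<in> G. v \<in> f \<and> D < node_degree (group G g (g f)) v} \<le> card {f \<in> ?v. g f \<in> J}"
        by (intro card_mono finite_subset[OF _ finv]) auto
      then have "real (s * D) \<le> ?NJ J g" using le by (simp only: card_NJ of_nat_le_iff)
      then show ?thesis using J by blast
    next
      case False
      then obtain J where J: "J \<subseteq> J0" "card J = s" using obtain_subset_with_card_n[of s J0] by auto
      then have finJ': "finite J" using finite_subset[of J "{..<m}"] by (auto simp: J0_def)
      have "s * D = (\<Sum>j\<in>J. D)" using J by simp
      also have "\<dots> \<le> (\<Sum>j\<in>J. card {f \<in> ?v. g f = j})"
        using J by (intro sum_mono) (auto simp: J0_def deg)
      also have "\<dots> = card (\<Union>j\<in>J. {f \<in> ?v. g f = j})"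
        using finJ' by (subst card_UN_disjoint) (auto intro: finite_subset[OF _ finv])
      also have "(\<Union>j\<in>J. {f \<in> ?v. g f = j}) = {f \<in> ?v. g f \<in> J}" by auto
      finally have "real (s * D) \<le> ?NJ J g" by (simp only: card_NJ of_nat_le_iff)
      then show ?thesis using J by (intro bexI[of _ J]) (auto simp: J0_def)
    qed
  qed
  also have "\<dots> \<le> (\<Sum>J\<in>?JJ. pr label_pmf (\<lambda>g. s * D \<le> ?NJ J g))"
    using finJ by (rule pr_UN_le)
  also have "\<dots> \<le> (\<Sum>J\<in>?JJ. exp (- (\<theta> ^ 3 * \<Delta> / 4)))"
  proof (rule sum_mono)
    fix J assume J: "J \<in> ?JJ"
    \<comment> \<open>Minimises \<open>l\<^sup>2 - l * \<theta>\<close>, what remains of the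
      exponent after the relative headroom \<theta> in \<open>D_ge\<close>.\<close>
    define l where "l = \<theta> / 2"
    have l: "0 \<le> l" "l \<le> 1" using \<theta>_pos \<theta>_le by (auto simp: l_def)
    have "pr label_pmf (\<lambda>g. s * D \<le> ?NJ J g) \<le> exp ((l + l\<^sup>2) * (\<Sum>f\<in>?v. s / m) - l * (s * D))"
      unfolding label_pmf_def
    proof (rule chernoff_Pi_pmf[where S = "\<lambda>f. {f}"])
      fix f assume f: "f \<in> ?v"
      have "J \<inter> {..<m} = J" using J by auto
      then show "expect (Pi_pmf (all_edges n) 0 (\<lambda>_. pmf_of_set {..<m})) (\<lambda>g. of_bool (g f \<in> J)) \<le> real s / real m"
        using label_indicator_mean[of f "all_edges n" J] f vI J finite_all_edges by auto
    qed (use finv vI l finite_all_edges finite_labels in \<open>auto simp: disjoint_family_on_def depends_on_def\<close>)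
    also have "(l + l\<^sup>2) * (\<Sum>f\<in>?v. s / m) - l * (s * D) \<le> - (\<theta> ^ 3 * \<Delta> / 4)"
    proof -
      have "(l + l\<^sup>2) * (\<Sum>f\<in>?v. s / m) \<le> (l + l\<^sup>2) * (\<Delta> * (s / m))"
        using card_edges_at[OF G, of v] l by (simp add: mult_left_mono mult_right_mono divide_right_mono)
      moreover have "l * (s * ((1 + \<theta>) * \<Delta> / m)) \<le> l * (s * D)"
        unfolding of_nat_mult using l by (intro mult_left_mono D_ge') auto
      ultimately have "(l + l\<^sup>2) * (\<Sum>f\<in>?v. s / m) - l * (s * D) \<le>
        (l + l\<^sup>2) * (\<Delta> * (s / m)) - l * (s * ((1 + \<theta>) * \<Delta> / m))" by (rule diff_mono)
      also have "\<dots> = - (s * (\<theta>\<^sup>2 * \<Delta> / (4 * m)))"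
        using m_pos by (simp add: l_def field_simps power2_eq_square)
      also have "\<dots> \<le> - ((\<theta> * m) * (\<theta>\<^sup>2 * \<Delta> / (4 * m)))"
        using s_ge by (intro le_imp_neg_le mult_right_mono) auto
      also have "\<dots> = - (\<theta> ^ 3 * \<Delta> / 4)"
        using m_pos by (simp add: field_simps power2_eq_square power3_eq_cube)
      finally show ?thesis .
    qed
    finally show "pr label_pmf (\<lambda>g. s * D \<le> ?NJ J g) \<le> exp (- (\<theta> ^ 3 * \<Delta> / 4))" by simp
  qed
  also have "\<dots> = card ?JJ * exp (- (\<theta> ^ 3 * \<Delta> / 4))" by simp
  also have "\<dots> \<le> 2 ^ m * exp (- (\<theta> ^ 3 * \<Delta> / 4))"
  proof (rule mult_right_mono)
    have "card ?JJ \<le> card (Pow {..<m})" by (intro card_mono) auto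
    then have "card ?JJ \<le> 2 ^ m" by (simp add: card_Pow)
    then show "real (card ?JJ) \<le> 2 ^ m" by (metis of_nat_le_iff of_nat_numeral of_nat_power)
  qed simp
  finally show ?thesis .
qed

definition nbrs :: "graph \<Rightarrow> nat \<Rightarrow> nat set" where
  "nbrs G v = {u. u \<noteq> v \<and> {v, u} \<in> G}"

lemma card_nbrs:
  assumes "graph_on n G" "max_degree_le n G \<Delta>"
  shows "finite (nbrs G v)" "card (nbrs G v) \<le> \<Delta>"
proof -
  have inj: "inj_on (\<lambda>u. {v, u}) (nbrs G v)" by (auto simp: inj_on_def doubleton_eq_iff)
  have sub: "(\<lambda>u. {v, u}) ` nbrs G v \<subseteq> {f \<in> G. v \<in> f}" by (auto simp: nbrs_def)
  have fin: "finite {f \<in> G. v \<in> f}" using finite_graph_on[OF assms(1)] by auto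
  show "finite (nbrs G v)" using finite_imageD[OF finite_subset[OF sub fin] inj] .
  show "card (nbrs G v) \<le> \<Delta>" using card_inj_on_le[OF inj sub fin] card_edges_at[OF assms, of v] by simp
qed

text \<open>The label of \<open>{v, u}\<close> and the labels of the edges owned by \<open>u\<close> are independent, and given
  the labels at \<open>v\<close> the events for different \<open>u\<close> are independent because ownership is disjoint.\<close>

lemma owned_tail:
  fixes Own :: "nat \<Rightarrow> graph"
  assumes G: "graph_on n G" "max_degree_le n G \<Delta>"
    and Own: "\<And>u. u \<in> nbrs G v \<Longrightarrow> Own u \<subseteq> {f \<in> G. u \<in> f \<and> v \<notin> f}" "disjoint_family_on Own (nbrs G v)"
  shows "pr label_pmf (\<lambda>g. 3 * \<theta> * \<Delta> \<le>
      card {u \<in> nbrs G v. card (Own u) / m + \<theta> * \<Delta> / (2 * m) \<le> card {f \<in> Own u. g f = g {v, u}}}) \<le>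
    exp (- (\<theta> * \<Delta>))"
proof -
  let ?N = "nbrs G v"
  define A where "A = {f \<in> all_edges n. v \<in> f}"
  define B where "B = {f \<in> all_edges n. v \<notin> f}"
  have AB: "all_edges n = A \<union> B" "A \<inter> B = {}" "finite A" "finite B"
    using finite_all_edges[of n] by (auto simp: A_def B_def)
  let ?PB = "Pi_pmf B 0 (\<lambda>_. pmf_of_set {..<m})"
  let ?thr = "\<lambda>u. card (Own u) / m + \<theta> * \<Delta> / (2 * m)"
  let ?ev = "\<lambda>j u r. ?thr u \<le> card {f \<in> Own u. r f = j}"
  have OwnB: "Own u \<subseteq> B" if "u \<in> ?N" for u using Own(1)[OF that] G by (auto simp: B_def graph_on_iff)
  have finOwn: "finite (Own u)" if "u \<in> ?N" for u using finite_subset[OF OwnB[OF that] AB(4)] .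
  have one: "pr ?PB (?ev j u) \<le> \<theta>" if u: "u \<in> ?N" for j u
  proof -
    let ?a = "card (Own u)"
    \<comment> \<open>Minimises \<open>l\<^sup>2 - l * \<theta> / 2\<close>, which yields exactly
      the exponent of \<open>tail_le\<close>.\<close>
    define l where "l = \<theta> / 4"
    have l: "0 \<le> l" "l \<le> 1" using \<theta>_pos \<theta>_le by (auto simp: l_def)
    have cs: "real (card {f \<in> Own u. r f = j}) = (\<Sum>f\<in>Own u. of_bool (r f \<in> {j}))" for r :: "edge \<Rightarrow> nat"
      using finOwn[OF u] by (simp add: of_bool_def sum.If_cases Int_def)
    have "pr ?PB (?ev j u) \<le> exp ((l + l\<^sup>2) * (\<Sum>f\<in>Own u. 1 / m) - l * ?thr u)"
      unfolding cs
    proof (rule chernoff_Pi_pmf[where S = "\<lambda>f. {f}"])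
      fix f assume f: "f \<in> Own u"
      have "expect ?PB (\<lambda>g. of_bool (g f \<in> {j})) \<le> card ({j} \<inter> {..<m}) / m"
        using f OwnB[OF u] AB by (intro label_indicator_mean) auto
      also have "card ({j} \<inter> {..<m}) \<le> card {j}" by (intro card_mono) auto
      then have "card ({j} \<inter> {..<m}) / m \<le> 1 / m" by (intro divide_right_mono) auto
      finally show "expect ?PB (\<lambda>g. of_bool (g f \<in> {j})) \<le> 1 / m" .
    qed (use finOwn[OF u] OwnB[OF u] l AB finite_labels in \<open>auto simp: disjoint_family_on_def depends_on_def\<close>)
    also have "(l + l\<^sup>2) * (\<Sum>f\<in>Own u. 1 / m) - l * ?thr u = l\<^sup>2 * (?a / m) - l * (\<theta> * \<Delta> / (2 * m))"
      by (simp add: algebra_simps add_divide_distrib)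
    also have "\<dots> \<le> l\<^sup>2 * (\<Delta> / m) - l * (\<theta> * \<Delta> / (2 * m))"
    proof -
      have "?a \<le> card {f \<in> G. u \<in> f}"
        using Own(1)[OF u] finite_graph_on[OF G(1)] by (intro card_mono) auto
      also have "\<dots> \<le> \<Delta>" by (rule card_edges_at[OF G])
      finally show ?thesis by (intro diff_right_mono mult_left_mono divide_right_mono) auto
    qed
    also have "\<dots> = - (\<theta>\<^sup>2 * \<Delta> / (16 * m))" by (simp add: l_def field_simps power2_eq_square)
    finally show ?thesis using tail_le by simp
  qed
  have inner: "pr ?PB (\<lambda>r. 3 * \<theta> * \<Delta> \<le> card {u \<in> ?N. ?ev (h {v, u}) u r}) \<le> exp (- (\<theta> * \<Delta>))" for h :: "edge \<Rightarrow> nat"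
  proof -
    have cs: "real (card {u \<in> ?N. ?ev (h {v, u}) u r}) = (\<Sum>u\<in>?N. of_bool (?ev (h {v, u}) u r))" for r
      using card_nbrs[OF G, of v] by (simp add: of_bool_def sum.If_cases Int_def)
    have "pr ?PB (\<lambda>r. 3 * \<theta> * \<Delta> \<le> card {u \<in> ?N. ?ev (h {v, u}) u r}) \<le>
      exp ((1 + 1\<^sup>2) * (\<Sum>u\<in>?N. \<theta>) - 1 * (3 * \<theta> * \<Delta>))"
      unfolding cs
    proof (rule chernoff_Pi_pmf[where S = Own])
      fix u assume u: "u \<in> ?N"
      show "depends_on (Own u) (\<lambda>r. of_bool (?ev (h {v, u}) u r) :: real)"
        unfolding depends_on_def
      proof (intro allI impI)
        fix r r' :: "edge \<Rightarrow> nat" assume "\<forall>i\<in>Own u. r i = r' i"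
        then have "{f \<in> Own u. r f = h {v, u}} = {f \<in> Own u. r' f = h {v, u}}" by auto
        then show "of_bool (?ev (h {v, u}) u r) = (of_bool (?ev (h {v, u}) u r') :: real)" by (simp only:)
      qed
      show "expect ?PB (\<lambda>r. of_bool (?ev (h {v, u}) u r)) \<le> \<theta>"
        using one[OF u, of "h {v, u}"] by (simp only: pr_expect)
    qed (use card_nbrs[OF G] OwnB AB Own(2) finite_labels in auto)
    also have "\<dots> \<le> exp (- (\<theta> * \<Delta>))"
      using card_nbrs(2)[OF G, of v] \<theta>_pos by (simp add: mult_right_mono)
    finally show ?thesis .
  qed
  have "pr label_pmf (\<lambda>g. 3 * \<theta> * \<Delta> \<le> card {u \<in> ?N. ?ev (g {v, u}) u g}) =
    expect (Pi_pmf A 0 (\<lambda>_. pmf_of_set {..<m})) (\<lambda>h. pr ?PB (\<lambda>r. 3 * \<theta> * \<Delta> \<le> card {u \<in> ?N. ?ev (h {v, u}) u r}))"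
    unfolding pr_expect label_pmf_def AB(1)
  proof (subst expect_Pi_split[OF AB(3,4,2) finite_labels], intro expect_cong arg_cong[where f = of_bool])
    fix h r :: "edge \<Rightarrow> nat"
    let ?g = "\<lambda>x. if x \<in> A then h x else r x"
    have eqs: "{f \<in> Own u. ?g f = ?g {v, u}} = {f \<in> Own u. r f = h {v, u}}" if "u \<in> ?N" for u
    proof -
      have "{v, u} \<in> A" using that G by (auto simp: nbrs_def A_def graph_on_iff)
      then show ?thesis using OwnB[OF that] AB(2) by auto
    qed
    have "{u \<in> ?N. ?ev (?g {v, u}) u ?g} = {u \<in> ?N. ?ev (h {v, u}) u r}"
      by (rule Collect_cong, rule conj_cong[OF refl], subst eqs, assumption, rule refl)
    then show "(3 * \<theta> * \<Delta> \<le> card {u \<in> ?N. ?ev (?g {v, u}) u ?g}) = (3 * \<theta> * \<Delta> \<le> card {u \<in> ?N. ?ev (h {v, u}) u r})"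
      by (simp only:)
  qed
  also have "\<dots> \<le> exp (- (\<theta> * \<Delta>))"
    by (intro expect_le finite_set_Pi_pmf AB finite_labels inner)
  finally show ?thesis .
qed

text \<open>Overload at different neighbours of \<open>v\<close> is dependent because two neighbours
  may be joined by an edge. Each edge avoiding \<open>v\<close> is therefore owned in
  \<open>O1\<close> by its largest endpoint among the neighbours, and in \<open>O2\<close> by the
  smaller one if both endpoints are neighbours. Each family is disjoint and satisfies
  \<open>owned_tail\<close>. If \<open>u\<close> is overloaded in the group of
  \<open>{v, u}\<close>, then one of its two owned sets exceeds its mean by half of the
  headroom.\<close>

lemma overload_other_tail:
  assumes G: "graph_on n G" "max_degree_le n G \<Delta>"
  shows "pr label_pmf (\<lambda>g. 6 * \<theta> * \<Delta> \<le> card {f \<in> G. v \<in> f \<and> (\<exists>u\<in>f. u \<noteq> v \<and> D < node_degree (group G g (g f)) u)}) \<le>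
    2 * exp (- (\<theta> * \<Delta>))"
proof -
  let ?N = "nbrs G v"
  define O1 where "O1 u = {f \<in> G. u \<in> f \<and> v \<notin> f \<and> (\<forall>w\<in>f. w \<in> ?N \<longrightarrow> w \<le> u)}" for u
  define O2 where "O2 u = {f \<in> G. u \<in> f \<and> v \<notin> f \<and> (\<exists>w\<in>f. w \<in> ?N \<and> u < w)}" for u
  let ?bad = "\<lambda>Own g. {u \<in> ?N. card (Own u) / m + \<theta> * \<Delta> / (2 * m) \<le> card {f \<in> Own u. g f = g {v, u}}}"
  have finG: "finite G" by (rule finite_graph_on[OF G(1)])
  have pair: "\<exists>x y. f = {x, y}" if "f \<in> G" for f
  proof -
    have "card f = 2" using that G(1) by (simp add: graph_on_def)
    then show ?thesis by (auto simp: card_2_iff)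
  qed
  have "disjoint_family_on O1 ?N"
    unfolding disjoint_family_on_def O1_def by (auto intro: antisym)
  moreover have "disjoint_family_on O2 ?N"
  proof -
    have False if f: "f \<in> O2 u" "f \<in> O2 u'" "u \<noteq> u'" for f u u'
    proof -
      obtain x y where "f = {x, y}" using pair[of f] f by (auto simp: O2_def)
      then show False using f by (auto simp: O2_def)
    qed
    then show ?thesis by (auto simp: disjoint_family_on_def)
  qed
  ultimately have tails: "pr label_pmf (\<lambda>g. 3 * \<theta> * \<Delta> \<le> card (?bad Own g)) \<le> exp (- (\<theta> * \<Delta>))"
    if "Own = O1 \<or> Own = O2" for Own
    using that by (intro owned_tail[OF G]) (auto simp: O1_def O2_def)
  have "pr label_pmf (\<lambda>g. 6 * \<theta> * \<Delta> \<le> card {f \<in> G. v \<in> f \<and> (\<exists>u\<in>f. u \<noteq> v \<and> D < node_degree (group G g (g f)) u)}) \<le>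
    pr label_pmf (\<lambda>g. \<exists>Own\<in>{O1, O2}. 3 * \<theta> * \<Delta> \<le> card (?bad Own g))"
  proof (rule pr_mono, rule ccontr)
    fix g
    let ?O = "{f \<in> G. v \<in> f \<and> (\<exists>u\<in>f. u \<noteq> v \<and> D < node_degree (group G g (g f)) u)}"
    assume le: "6 * \<theta> * \<Delta> \<le> card ?O"
      and nb: "\<not> (\<exists>Own\<in>{O1, O2}. 3 * \<theta> * \<Delta> \<le> card (?bad Own g))"
    have fin: "finite (?bad Own g)" for Own using card_nbrs[OF G, of v] by auto
    have "?O \<subseteq> (\<lambda>u. {v, u}) ` (?bad O1 g \<union> ?bad O2 g)"
    proof
      fix f assume f: "f \<in> ?O"
      then obtain u where u: "u \<in> f" "u \<noteq> v" "D < node_degree (group G g (g f)) u" by auto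
      have "\<exists>x y. f = {x, y}" using f by (intro pair) simp
      then obtain x y where "f = {x, y}" by blast
      then have fvu: "f = {v, u}" using f u by auto
      then have uN: "u \<in> ?N" using f u by (auto simp: nbrs_def)
      let ?j = "g {v, u}"
      have O12: "O1 u \<union> O2 u = {f \<in> G. u \<in> f \<and> v \<notin> f}" "O1 u \<inter> O2 u = {}" "finite (O1 u)" "finite (O2 u)"
        using finG by (auto simp: O1_def O2_def not_le)
      have "card (O1 u) + card (O2 u) = card {f \<in> G. u \<in> f \<and> v \<notin> f}"
        using O12 card_Un_disjoint by metis
      also have "\<dots> \<le> card {f \<in> G. u \<in> f}" using finG by (intro card_mono) auto
      also have "\<dots> \<le> \<Delta>" by (rule card_edges_at[OF G])
      finally have own: "real (card (O1 u)) + card (O2 u) \<le> \<Delta>" by (simp flip: of_nat_add)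
      have "node_degree (group G g ?j) u \<le> card ({{v, u}} \<union> ({f \<in> O1 u. g f = ?j} \<union> {f \<in> O2 u. g f = ?j}))"
        unfolding node_degree_def
      proof (rule card_mono)
        show "{e \<in> group G g ?j. u \<in> e} \<subseteq> {{v, u}} \<union> ({f \<in> O1 u. g f = ?j} \<union> {f \<in> O2 u. g f = ?j})"
        proof
          fix e assume e: "e \<in> {e \<in> group G g ?j. u \<in> e}"
          show "e \<in> {{v, u}} \<union> ({f \<in> O1 u. g f = ?j} \<union> {f \<in> O2 u. g f = ?j})"
          proof (cases "v \<in> e")
            case True
            obtain a b where "e = {a, b}" using pair[of e] e by (auto simp: group_def)
            then have "e = {v, u}" using True e u(2) by auto
            then show ?thesis by simp
          next
            case False
            then show ?thesis using e O12(1) by (auto simp: group_def)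
          qed
        qed
      qed (use O12 in auto)
      also have "\<dots> \<le> card {{v, u}} + card ({f \<in> O1 u. g f = ?j} \<union> {f \<in> O2 u. g f = ?j})" by (rule card_Un_le)
      also have "card ({f \<in> O1 u. g f = ?j} \<union> {f \<in> O2 u. g f = ?j}) \<le> card {f \<in> O1 u. g f = ?j} + card {f \<in> O2 u. g f = ?j}"
        by (rule card_Un_le)
      finally have deg: "node_degree (group G g ?j) u \<le> 1 + (card {f \<in> O1 u. g f = ?j} + card {f \<in> O2 u. g f = ?j})" by simp
      have "u \<in> ?bad O1 g \<union> ?bad O2 g"
      proof (rule ccontr)
        assume "u \<notin> ?bad O1 g \<union> ?bad O2 g"
        then have c: "card {f \<in> O1 u. g f = ?j} < card (O1 u) / m + \<theta> * \<Delta> / (2 * m)"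
          "card {f \<in> O2 u. g f = ?j} < card (O2 u) / m + \<theta> * \<Delta> / (2 * m)"
          using uN by auto
        \<comment> \<open>The leading 1 is the edge \<open>{v, u}\<close> itself, the place reserved
          for it in \<open>D_ge\<close>.\<close>
        have "real (node_degree (group G g ?j) u) < 1 + ((card (O1 u) / m + card (O2 u) / m) + \<theta> * \<Delta> / m)"
        proof -
          have "\<theta> * \<Delta> / m = \<theta> * \<Delta> / (2 * m) + \<theta> * \<Delta> / (2 * m)" by (simp add: field_simps)
          moreover have "real (node_degree (group G g ?j) u) \<le>
            1 + (real (card {f \<in> O1 u. g f = ?j}) + real (card {f \<in> O2 u. g f = ?j}))" using deg by linarith
          ultimately show ?thesis using c by linarith
        qed
        also have "card (O1 u) / m + card (O2 u) / m \<le> \<Delta> / m"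
          using own by (simp add: divide_right_mono flip: add_divide_distrib)
        also have "1 + (\<Delta> / m + \<theta> * \<Delta> / m) \<le> D" using D_ge by (simp add: algebra_simps add_divide_distrib)
        finally show False using u(3) fvu by simp
      qed
      then show "f \<in> (\<lambda>u. {v, u}) ` (?bad O1 g \<union> ?bad O2 g)" using fvu by auto
    qed
    then have "card ?O \<le> card (?bad O1 g \<union> ?bad O2 g)" using fin by (intro surj_card_le) auto
    also have "\<dots> \<le> card (?bad O1 g) + card (?bad O2 g)" by (rule card_Un_le)
    finally have "real (card ?O) \<le> real (card (?bad O1 g)) + real (card (?bad O2 g))" by linarith
    moreover have "real (card (?bad O1 g)) < 3 * \<theta> * \<Delta>" "real (card (?bad O2 g)) < 3 * \<theta> * \<Delta>"
      using nb by (simp_all add: not_le)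
    ultimately show False using le by linarith
  qed
  also have "\<dots> \<le> (\<Sum>Own\<in>{O1, O2}. pr label_pmf (\<lambda>g. 3 * \<theta> * \<Delta> \<le> card (?bad Own g)))"
    by (rule pr_UN_le) simp
  also have "\<dots> \<le> (\<Sum>Own\<in>{O1, O2}. exp (- (\<theta> * \<Delta>)))" by (intro sum_mono tails) auto
  also have "\<dots> = card {O1, O2} * exp (- (\<theta> * \<Delta>))" by simp
  also have "\<dots> \<le> 2 * exp (- (\<theta> * \<Delta>))"
    by (intro mult_right_mono) (auto simp: card_insert_if)
  finally show ?thesis .
qed

definition left_bound :: real where
  "left_bound = 20 * \<theta> * m * D + s * D + 6 * \<theta> * \<Delta>"

text \<open>An edge at \<open>v\<close> is left over because the nibble missed it, because its group
  is overloaded at \<open>v\<close>, or because its group is overloaded at the other endpoint. The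
  three summands of \<open>left_bound\<close> are the thresholds for these causes.\<close>

lemma left_degree_tail:
  assumes G: "graph_on n G" "max_degree_le n G \<Delta>"
  shows "pr space_pmf (\<lambda>\<omega>. left_bound \<le> node_degree (left \<omega> G) v) \<le>
    exp (- (2 * \<theta> * m)) + 2 ^ m * exp (- (\<theta> ^ 3 * \<Delta> / 4)) + 2 * exp (- (\<theta> * \<Delta>))"
proof -
  let ?U = "\<lambda>g \<xi>. {f \<in> G. v \<in> f \<and> f \<in> core D G g (g f) \<and> status (g, \<xi>) G f = None}"
  let ?S = "\<lambda>g. {f \<in> G. v \<in> f \<and> D < node_degree (group G g (g f)) v}"
  let ?T = "\<lambda>g. {f \<in> G. v \<in> f \<and> (\<exists>u\<in>f. u \<noteq> v \<and> D < node_degree (group G g (g f)) u)}"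
  let ?a = "\<lambda>g \<xi>. of_bool (20 * \<theta> * m * D \<le> card (?U g \<xi>)) :: real"
  let ?b = "\<lambda>g. of_bool (s * D \<le> card (?S g)) :: real"
  let ?c = "\<lambda>g. of_bool (6 * \<theta> * \<Delta> \<le> card (?T g)) :: real"
  have finG: "finite G" by (rule finite_graph_on[OF G(1)])
  have "pr space_pmf (\<lambda>\<omega>. left_bound \<le> node_degree (left \<omega> G) v) =
    expect label_pmf (\<lambda>g. expect seeds_pmf (\<lambda>\<xi>. of_bool (left_bound \<le> node_degree (left (g, \<xi>) G) v)))"
    unfolding pr_expect space_pmf_def by (rule expect_pair[OF finite_label_pmf finite_seeds_pmf])
  also have "\<dots> \<le> expect label_pmf (\<lambda>g. expect seeds_pmf (\<lambda>\<xi>. ?a g \<xi> + (?b g + ?c g)))"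
  proof (intro expect_mono finite_label_pmf finite_seeds_pmf)
    fix g \<xi>
    have "{f \<in> left (g, \<xi>) G. v \<in> f} \<subseteq> ?U g \<xi> \<union> (?S g \<union> ?T g)"
      by (auto simp: left_def core_def group_def not_le)
    then have "node_degree (left (g, \<xi>) G) v \<le> card (?U g \<xi> \<union> (?S g \<union> ?T g))"
      unfolding node_degree_def using finG by (intro card_mono) auto
    also have "\<dots> \<le> card (?U g \<xi>) + card (?S g \<union> ?T g)" by (rule card_Un_le)
    also have "card (?S g \<union> ?T g) \<le> card (?S g) + card (?T g)" by (rule card_Un_le)
    finally have d: "node_degree (left (g, \<xi>) G) v \<le> card (?U g \<xi>) + (card (?S g) + card (?T g))" by simp
    show "of_bool (left_bound \<le> node_degree (left (g, \<xi>) G) v) \<le> ?a g \<xi> + (?b g + ?c g)"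
    proof (cases "20 * \<theta> * m * D \<le> card (?U g \<xi>) \<or> s * D \<le> card (?S g) \<or> 6 * \<theta> * \<Delta> \<le> card (?T g)")
      case True
      then have "1 \<le> ?a g \<xi> + (?b g + ?c g)"
        by (elim disjE) (simp_all only: of_bool_eq, simp_all add: add_nonneg_nonneg del: status.simps)
      then show ?thesis by (rule order_trans[rotated]) simp
    next
      case False
      then have "card (?U g \<xi>) < 20 * \<theta> * m * D" "real (card (?S g)) < s * D" "card (?T g) < 6 * \<theta> * \<Delta>"
        by (auto simp: not_le simp flip: of_nat_mult)
      then have "node_degree (left (g, \<xi>) G) v < left_bound" using d unfolding left_bound_def by linarith
      then have "\<not> left_bound \<le> node_degree (left (g, \<xi>) G) v" by linarith
      then have "of_bool (left_bound \<le> node_degree (left (g, \<xi>) G) v) = (0::real)" by (simp only: of_bool_eq)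
      then show ?thesis by (simp only:) (intro add_nonneg_nonneg; simp del: status.simps)
    qed
  qed
  also have "\<dots> = expect label_pmf (\<lambda>g. expect seeds_pmf (\<lambda>\<xi>. ?a g \<xi>)) + (expect label_pmf ?b + expect label_pmf ?c)"
    by (simp only: expect_add finite_label_pmf finite_seeds_pmf integral_const measure_pmf.prob_space) simp
  also have "\<dots> \<le> exp (- (2 * \<theta> * m)) + (2 ^ m * exp (- (\<theta> ^ 3 * \<Delta> / 4)) + 2 * exp (- (\<theta> * \<Delta>)))"
  proof (intro add_mono)
    show "expect label_pmf (\<lambda>g. expect seeds_pmf (\<lambda>\<xi>. ?a g \<xi>)) \<le> exp (- (2 * \<theta> * m))"
      unfolding pr_expect[symmetric] by (intro expect_le finite_label_pmf uncolored_tail G)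
    show "expect label_pmf ?b \<le> 2 ^ m * exp (- (\<theta> ^ 3 * \<Delta> / 4))"
      unfolding pr_expect[symmetric] by (rule overload_self_tail[OF G])
    show "expect label_pmf ?c \<le> 2 * exp (- (\<theta> * \<Delta>))"
      unfolding pr_expect[symmetric] by (rule overload_other_tail[OF G])
  qed
  finally show ?thesis by simp
qed

end

subsection \<open>The algorithm\<close>

text \<open>Colours of edges that stay in the leftover are frozen and only newcomers are coloured,
  so a change of the leftover never cascades. The bound on a new colour refers to the leftover at
  the time it is chosen.\<close>

definition greedy_extension :: "graph \<Rightarrow> graph \<Rightarrow> (edge \<Rightarrow> nat) \<Rightarrow> (edge \<Rightarrow> nat) \<Rightarrow> bool" where
  "greedy_extension L L' \<psi> \<psi>' \<longleftrightarrow> proper_edge_coloring L' \<psi>' \<and> (\<forall>e\<in>L \<inter> L'. \<psi>' e = \<psi> e) \<and>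
     (\<forall>e\<in>L' - L. \<psi>' e \<le> card {f \<in> L'. f \<noteq> e \<and> f \<inter> e \<noteq> {}})"

lemma greedy_extension_exists:
  assumes "finite L'" "proper_edge_coloring L \<psi>"
  shows "\<exists>\<psi>'. greedy_extension L L' \<psi> \<psi>'"
proof -
  have "\<exists>\<psi>'. proper_edge_coloring (L \<inter> L' \<union> F) \<psi>' \<and> (\<forall>e\<in>L \<inter> L'. \<psi>' e = \<psi> e) \<and>
     (\<forall>e\<in>F. \<psi>' e \<le> card {f \<in> L'. f \<noteq> e \<and> f \<inter> e \<noteq> {}})" if "finite F" "F \<subseteq> L' - L" for F
    using that
  proof (induction F rule: finite_induct)
    case empty
    have "proper_edge_coloring (L \<inter> L') \<psi>" using assms(2) by (simp add: proper_edge_coloring_def)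
    then show ?case by auto
  next
    case (insert e F)
    then obtain \<psi>' where \<psi>': "proper_edge_coloring (L \<inter> L' \<union> F) \<psi>'" "\<forall>e\<in>L \<inter> L'. \<psi>' e = \<psi> e"
      "\<forall>e\<in>F. \<psi>' e \<le> card {f \<in> L'. f \<noteq> e \<and> f \<inter> e \<noteq> {}}" by auto
    let ?S = "{f \<in> L'. f \<noteq> e \<and> f \<inter> e \<noteq> {}}"
    have "finite ?S" using assms by auto
    then have "card (\<psi>' ` ?S) < card {..card ?S}" using card_image_le[of ?S \<psi>'] by simp
    then have "\<not> {..card ?S} \<subseteq> \<psi>' ` ?S"
      using \<open>finite ?S\<close> card_mono[of "\<psi>' ` ?S" "{..card ?S}"] by auto
    then obtain c where c: "c \<le> card ?S" "c \<notin> \<psi>' ` ?S" by auto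
    let ?\<phi> = "\<psi>'(e := c)"
    have eL: "e \<notin> L" "e \<in> L'" using insert by auto
    have "proper_edge_coloring (L \<inter> L' \<union> insert e F) ?\<phi>"
      unfolding proper_edge_coloring_def
    proof (intro ballI impI)
      fix f f' assume f: "f \<in> L \<inter> L' \<union> insert e F" "f' \<in> L \<inter> L' \<union> insert e F" "f \<noteq> f' \<and> f \<inter> f' \<noteq> {}"
      have sub: "L \<inter> L' \<union> insert e F \<subseteq> L'" using insert by auto
      show "?\<phi> f \<noteq> ?\<phi> f'"
      proof (cases "f = e \<or> f' = e")
        case True
        then obtain f'' where "{f, f'} = {e, f''}" "f'' \<noteq> e" using f by auto
        then have "f'' \<in> ?S" using f sub by (auto simp: doubleton_eq_iff)
        then have "\<psi>' f'' \<noteq> c" using c by auto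
        then show ?thesis using \<open>{f, f'} = {e, f''}\<close> \<open>f'' \<noteq> e\<close> by (auto simp: doubleton_eq_iff)
      next
        case False
        then show ?thesis using \<psi>'(1) f by (auto simp: proper_edge_coloring_def)
      qed
    qed
    moreover have "\<forall>g\<in>L \<inter> L'. ?\<phi> g = \<psi> g" using \<psi>'(2) eL by auto
    moreover have "\<forall>g\<in>insert e F. ?\<phi> g \<le> card {f \<in> L'. f \<noteq> g \<and> f \<inter> g \<noteq> {}}"
      using \<psi>'(3) c insert by auto
    ultimately show ?case by blast
  qed
  from this[of "L' - L"] obtain \<psi>' where "proper_edge_coloring (L \<inter> L' \<union> (L' - L)) \<psi>'"
    "\<forall>e\<in>L \<inter> L'. \<psi>' e = \<psi> e" "\<forall>e\<in>L' - L. \<psi>' e \<le> card {f \<in> L'. f \<noteq> e \<and> f \<inter> e \<noteq> {}}"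
    using assms(1) by auto
  moreover have "L \<inter> L' \<union> (L' - L) = L'" by auto
  ultimately show ?thesis unfolding greedy_extension_def by auto
qed

text \<open>Each endpoint contributes at most \<open>B - 1\<close> edges besides \<open>e\<close>;
  the 2 stands on the left to avoid truncated subtraction.\<close>

lemma card_adjacent_le:
  assumes "graph_on n L" "\<And>v. v < n \<Longrightarrow> node_degree L v \<le> B" "e \<in> L"
  shows "card {f \<in> L. f \<noteq> e \<and> f \<inter> e \<noteq> {}} + 2 \<le> 2 * B"
proof -
  have e: "card e = 2" "finite e" "e \<subseteq> {..<n}"
    using assms(1,3) by (auto simp: graph_on_def intro: finite_subset)
  have finL: "finite L" by (rule finite_graph_on[OF assms(1)])
  have "{f \<in> L. f \<noteq> e \<and> f \<inter> e \<noteq> {}} \<subseteq> (\<Union>v\<in>e. {f \<in> L. v \<in> f} - {e})" by auto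
  then have "card {f \<in> L. f \<noteq> e \<and> f \<inter> e \<noteq> {}} \<le> card (\<Union>v\<in>e. {f \<in> L. v \<in> f} - {e})"
    using finL e by (intro card_mono) auto
  also have "\<dots> \<le> (\<Sum>v\<in>e. card ({f \<in> L. v \<in> f} - {e}))" using e by (intro card_UN_le)
  finally have 1: "card {f \<in> L. f \<noteq> e \<and> f \<inter> e \<noteq> {}} \<le> (\<Sum>v\<in>e. card ({f \<in> L. v \<in> f} - {e}))" .
  have "(\<Sum>v\<in>e. card ({f \<in> L. v \<in> f} - {e})) + 2 = (\<Sum>v\<in>e. card ({f \<in> L. v \<in> f} - {e}) + 1)"
    using e by (simp only: sum.distrib) simp
  also have "\<dots> \<le> (\<Sum>v\<in>e. B)"
  proof (rule sum_mono)
    fix v assume v: "v \<in> e"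
    then have "card ({f \<in> L. v \<in> f} - {e}) + 1 = node_degree L v"
      unfolding node_degree_def using assms(3) finL card_Suc_Diff1[of "{f \<in> L. v \<in> f}" e] by simp
    then show "card ({f \<in> L. v \<in> f} - {e}) + 1 \<le> B" using assms(2) v e by auto
  qed
  also have "\<dots> = 2 * B" using e by simp
  finally show ?thesis using 1 by simp
qed

lemma graph_after_snoc: "graph_after G (us @ [u]) = apply_update u (graph_after G us)"
  by (simp add: graph_after_def)

context group_coloring
begin

text \<open>The list contains the updates so far, the most recent one first.\<close>

fun left_coloring :: "(edge \<Rightarrow> nat) \<times> (nat \<Rightarrow> 'r) \<Rightarrow> graph \<Rightarrow> graph_update list \<Rightarrow> edge \<Rightarrow> nat" where
  "left_coloring \<omega> G0 [] = (SOME \<psi>. greedy_extension {} (left \<omega> G0) (\<lambda>_. 0) \<psi>)"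
| "left_coloring \<omega> G0 (u # us) =
    (SOME \<psi>. greedy_extension (left \<omega> (graph_after G0 (rev us))) (left \<omega> (graph_after G0 (rev (u # us))))
      (left_coloring \<omega> G0 us) \<psi>)"

definition full_coloring :: "(edge \<Rightarrow> nat) \<times> (nat \<Rightarrow> 'r) \<Rightarrow> graph \<Rightarrow> graph_update list \<Rightarrow> edge \<Rightarrow> nat" where
  "full_coloring \<omega> G0 us e = (case status \<omega> (graph_after G0 us) e of
     Some x \<Rightarrow> x | None \<Rightarrow> m * D + left_coloring \<omega> G0 (rev us) e)"

lemma graph_on_left: "graph_on n G \<Longrightarrow> graph_on n (left \<omega> G)"
  by (auto simp: left_def graph_on_def)

context
  fixes G0 us \<Delta>
  assumes dyn: "dynamic_graph n \<Delta> G0 us"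
begin

abbreviation gr :: "nat \<Rightarrow> graph" where "gr i \<equiv> graph_after G0 (take i us)"

lemma gr: "i \<le> length us \<Longrightarrow> graph_on n (gr i)" "i \<le> length us \<Longrightarrow> max_degree_le n (gr i) \<Delta>"
  using dyn by (auto simp: dynamic_graph_def)

lemma left_coloring_step:
  assumes "i < length us" "proper_edge_coloring (left \<omega> (gr i)) (left_coloring \<omega> G0 (rev (take i us)))"
  shows "greedy_extension (left \<omega> (gr i)) (left \<omega> (gr (Suc i)))
    (left_coloring \<omega> G0 (rev (take i us))) (left_coloring \<omega> G0 (rev (take (Suc i) us)))"
proof -
  have "rev (take (Suc i) us) = us ! i # rev (take i us)"
    using assms by (simp add: take_Suc_conv_app_nth)
  moreover have "rev (us ! i # rev (take i us)) = take (Suc i) us"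
    using assms by (simp add: take_Suc_conv_app_nth)
  ultimately have "left_coloring \<omega> G0 (rev (take (Suc i) us)) =
    (SOME \<psi>. greedy_extension (left \<omega> (gr i)) (left \<omega> (gr (Suc i))) (left_coloring \<omega> G0 (rev (take i us))) \<psi>)"
    by (simp only: left_coloring.simps rev_rev_ident)
  moreover have "\<exists>\<psi>. greedy_extension (left \<omega> (gr i)) (left \<omega> (gr (Suc i))) (left_coloring \<omega> G0 (rev (take i us))) \<psi>"
    using assms gr[of "Suc i"] by (intro greedy_extension_exists finite_graph_on[OF graph_on_left]) auto
  ultimately show ?thesis using someI_ex by metis
qed

lemma left_coloring_init:
  "greedy_extension {} (left \<omega> (gr 0)) (\<lambda>_. 0) (left_coloring \<omega> G0 (rev (take 0 us)))"
proof -
  have "\<exists>\<psi>. greedy_extension {} (left \<omega> (gr 0)) (\<lambda>_. 0) \<psi>"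
    using gr[of 0] by (intro greedy_extension_exists finite_graph_on[OF graph_on_left])
      (auto simp: proper_edge_coloring_def)
  then have "greedy_extension {} (left \<omega> (gr 0)) (\<lambda>_. 0) (SOME \<psi>. greedy_extension {} (left \<omega> (gr 0)) (\<lambda>_. 0) \<psi>)"
    by (rule someI_ex)
  then show ?thesis by (simp add: graph_after_def)
qed

lemma proper_left_coloring:
  "i \<le> length us \<Longrightarrow> proper_edge_coloring (left \<omega> (gr i)) (left_coloring \<omega> G0 (rev (take i us)))"
proof (induction i)
  case 0
  then show ?case using left_coloring_init[of \<omega>] unfolding greedy_extension_def by blast
next
  case (Suc i)
  then show ?case using left_coloring_step[of i \<omega>] by (auto simp: greedy_extension_def)
qed

text \<open>An edge keeps the colour it got on entering the leftover, so the bound has to come from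
  that earlier time; hence the degree bound \<open>B\<close> is assumed for all times at
  once.\<close>

lemma left_coloring_le:
  assumes B: "\<And>i v. i \<le> length us \<Longrightarrow> v < n \<Longrightarrow> node_degree (left \<omega> (gr i)) v \<le> B"
    and "i \<le> length us" "e \<in> left \<omega> (gr i)"
  shows "left_coloring \<omega> G0 (rev (take i us)) e + 2 \<le> 2 * B"
proof -
  have adj: "card {f \<in> left \<omega> (gr i). f \<noteq> e \<and> f \<inter> e \<noteq> {}} + 2 \<le> 2 * B"
    if "i \<le> length us" "e \<in> left \<omega> (gr i)" for i e
    by (rule card_adjacent_le[OF graph_on_left[OF gr(1)[OF that(1)]] B[OF that(1)] that(2)])
  show ?thesis using assms(2,3)
  proof (induction i arbitrary: e)
    case 0
    then have "left_coloring \<omega> G0 (rev (take 0 us)) e \<le> card {f \<in> left \<omega> (gr 0). f \<noteq> e \<and> f \<inter> e \<noteq> {}}"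
      using left_coloring_init[of \<omega>] unfolding greedy_extension_def by blast
    moreover have "card {f \<in> left \<omega> (gr 0). f \<noteq> e \<and> f \<inter> e \<noteq> {}} + 2 \<le> 2 * B"
      using 0 by (rule adj)
    ultimately show ?case by linarith
  next
    case (Suc i)
    have ext: "greedy_extension (left \<omega> (gr i)) (left \<omega> (gr (Suc i)))
      (left_coloring \<omega> G0 (rev (take i us))) (left_coloring \<omega> G0 (rev (take (Suc i) us)))"
      using Suc.prems proper_left_coloring by (intro left_coloring_step) auto
    show ?case
    proof (cases "e \<in> left \<omega> (gr i)")
      case True
      then have "left_coloring \<omega> G0 (rev (take (Suc i) us)) e = left_coloring \<omega> G0 (rev (take i us)) e"
        using ext Suc.prems unfolding greedy_extension_def by blast
      then show ?thesis using Suc.IH[of e] Suc.prems True by simp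
    next
      case False
      then have "left_coloring \<omega> G0 (rev (take (Suc i) us)) e \<le> card {f \<in> left \<omega> (gr (Suc i)). f \<noteq> e \<and> f \<inter> e \<noteq> {}}"
        using ext Suc.prems unfolding greedy_extension_def by blast
      moreover have "card {f \<in> left \<omega> (gr (Suc i)). f \<noteq> e \<and> f \<inter> e \<noteq> {}} + 2 \<le> 2 * B"
        using Suc.prems by (rule adj)
      ultimately show ?thesis by linarith
    qed
  qed
qed

text \<open>Group colours lie below \<open>m * D\<close>, greedy colours do not, and each of the two
  palettes is proper. This holds for every outcome of the random choices; an unlucky one costs only
  additional colours.\<close>

lemma full_coloring_proper:
  assumes "i \<le> length us" "\<omega> \<in> set_pmf space_pmf"
  shows "proper_edge_coloring (gr i) (full_coloring \<omega> G0 (take i us))"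
  unfolding proper_edge_coloring_def
proof (intro ballI impI)
  fix e f assume ef: "e \<in> gr i" "f \<in> gr i" "e \<noteq> f \<and> e \<inter> f \<noteq> {}"
  obtain g \<xi> where \<omega>: "\<omega> = (g, \<xi>)" by (cases \<omega>)
  have g: "g \<in> set_pmf label_pmf" using assms(2) by (auto simp: space_pmf_def \<omega>)
  have less: "x < m * D" if "status \<omega> (gr i) h = Some x" for h x
    using status_less[OF gr(1)[OF assms(1)] g] that unfolding \<omega> .
  consider (none) "status \<omega> (gr i) e = None" "status \<omega> (gr i) f = None"
    | (left) x where "status \<omega> (gr i) e = Some x" "status \<omega> (gr i) f = None"
    | (right) x where "status \<omega> (gr i) f = Some x" "status \<omega> (gr i) e = None"
    | (some) x y where "status \<omega> (gr i) e = Some x" "status \<omega> (gr i) f = Some y"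
    by (cases "status \<omega> (gr i) e"; cases "status \<omega> (gr i) f") auto
  then show "full_coloring \<omega> G0 (take i us) e \<noteq> full_coloring \<omega> G0 (take i us) f"
  proof cases
    case none
    then have "left_coloring \<omega> G0 (rev (take i us)) e \<noteq> left_coloring \<omega> G0 (rev (take i us)) f"
      using proper_left_coloring[OF assms(1), of \<omega>] ef unfolding proper_edge_coloring_def left_def by blast
    then show ?thesis using none by (simp add: full_coloring_def)
  next
    case left
    then show ?thesis using less[OF left(1)] by (simp add: full_coloring_def)
  next
    case right
    then show ?thesis using less[OF right(1)] by (simp add: full_coloring_def)
  next
    case some
    have "x \<noteq> y"
      using status_disjoint[OF gr(1)[OF assms(1)], of g \<xi> e x f] some ef unfolding \<omega> by blast
    then show ?thesis using some by (simp add: full_coloring_def)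
  qed
qed

lemma full_coloring_less:
  fixes b :: real
  assumes "\<omega> \<in> set_pmf space_pmf" "i \<le> length us" "m * D + 2 * b \<le> K"
    and B: "\<And>i v. i \<le> length us \<Longrightarrow> v < n \<Longrightarrow> node_degree (left \<omega> (gr i)) v < b"
  shows "full_coloring \<omega> G0 (take i us) ` gr i \<subseteq> {..<K}"
proof
  fix x assume "x \<in> full_coloring \<omega> G0 (take i us) ` gr i"
  then obtain e where e: "e \<in> gr i" "x = full_coloring \<omega> G0 (take i us) e" by auto
  obtain g \<xi> where \<omega>: "\<omega> = (g, \<xi>)" by (cases \<omega>)
  have g: "g \<in> set_pmf label_pmf" using assms(1) by (auto simp: space_pmf_def \<omega>)
  have "e \<noteq> {}" "e \<subseteq> {..<n}" using e(1) gr(1)[OF assms(2)] by (auto simp: graph_on_def)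
  then obtain v where "v < n" by auto
  then have b: "0 < b" by (intro le_less_trans[OF of_nat_0_le_iff B[OF assms(2)]])
  show "x \<in> {..<K}"
  proof (cases "status \<omega> (gr i) e")
    case None
    have "left_coloring \<omega> G0 (rev (take i us)) e + 2 \<le> 2 * nat \<lfloor>b\<rfloor>"
    proof (rule left_coloring_le[OF _ assms(2)])
      show "node_degree (left \<omega> (gr i)) v \<le> nat \<lfloor>b\<rfloor>" if "i \<le> length us" "v < n" for i v
        using B[OF that] by (simp add: le_nat_floor)
      show "e \<in> left \<omega> (gr i)" using e None by (simp add: left_def)
    qed
    then have "real (left_coloring \<omega> G0 (rev (take i us)) e) + 2 \<le> 2 * real (nat \<lfloor>b\<rfloor>)" by linarith
    also have "real (nat \<lfloor>b\<rfloor>) \<le> b" using b by simp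
    finally have "real x < K" using e None assms(3) by (simp add: full_coloring_def)
    then show ?thesis by simp
  next
    case (Some y)
    then have "x = y" using e(2) by (simp add: full_coloring_def)
    then have "x < m * D" using status_less[OF gr(1)[OF assms(2)] g] Some unfolding \<omega> by blast
    then have "real x < m * D + 2 * b" using b by (metis add_strict_mono of_nat_less_iff zero_less_numeral mult_pos_pos add.right_neutral)
    then show ?thesis using assms(3) by simp
  qed
qed

text \<open>An edge present before and after the update whose status is unchanged keeps its colour:
  the status determines it, or the edge stays in the leftover, where colours are frozen. Thus
  recourse is bounded by the status changes plus one for \<open>e\<close>.\<close>

lemma full_coloring_recourse:
  assumes i: "i < length us"
  shows "expect space_pmf (\<lambda>\<omega>. recourse (gr i) (full_coloring \<omega> G0 (take i us)) (gr (Suc i)) (full_coloring \<omega> G0 (take (Suc i) us)))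
    \<le> (2 * D + 1) * (1 / \<theta> ^ 35) + 2"
proof -
  have step: "gr (Suc i) = apply_update (us ! i) (gr i)" "proper_update (us ! i) (gr i)"
    using i dyn by (auto simp: take_Suc_conv_app_nth graph_after_snoc dynamic_graph_def)
  \<comment> \<open>Insertion and deletion are treated alike: the two graphs are \<open>G\<close>
    and \<open>G - {e}\<close> in some order, and the number of status changes is symmetric in
    them.\<close>
  obtain G e where G: "graph_on n G" "e \<in> G" "{gr i, gr (Suc i)} = {G, G - {e}}"
  proof (cases "us ! i")
    case (Insert e)
    then have "gr i = gr (Suc i) - {e}" "e \<in> gr (Suc i)" using step by auto
    then show ?thesis using that[of "gr (Suc i)" e] gr(1)[of "Suc i"] i by auto
  next
    case (Delete e)
    then have "gr (Suc i) = gr i - {e}" "e \<in> gr i" using step by auto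
    then show ?thesis using that[of "gr i" e] gr(1)[of i] i by auto
  qed
  have finG: "finite G" by (rule finite_graph_on[OF G(1)])
  have "expect space_pmf (\<lambda>\<omega>. recourse (gr i) (full_coloring \<omega> G0 (take i us)) (gr (Suc i)) (full_coloring \<omega> G0 (take (Suc i) us)))
    \<le> expect space_pmf (\<lambda>\<omega>. 1 + real (card {f. status \<omega> G f \<noteq> status \<omega> (G - {e}) f}))"
  proof (rule expect_mono[OF finite_space])
    fix \<omega>
    let ?old = "full_coloring \<omega> G0 (take i us)" and ?new = "full_coloring \<omega> G0 (take (Suc i) us)"
    let ?d = "{f. status \<omega> G f \<noteq> status \<omega> (G - {e}) f}"
    have sub: "{f \<in> gr (Suc i). f \<notin> gr i \<or> ?new f \<noteq> ?old f} \<subseteq> {e} \<union> ?d"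
    proof
      fix f assume f: "f \<in> {f \<in> gr (Suc i). f \<notin> gr i \<or> ?new f \<noteq> ?old f}"
      show "f \<in> {e} \<union> ?d"
      proof (rule ccontr)
        assume nf: "f \<notin> {e} \<union> ?d"
        then have fe: "f \<noteq> e" and eq: "status \<omega> G f = status \<omega> (G - {e}) f" by simp_all
        from G(3) have cases: "gr i = G \<and> gr (Suc i) = G - {e} \<or> gr i = G - {e} \<and> gr (Suc i) = G"
          by (simp only: doubleton_eq_iff)
        then have same: "status \<omega> (gr i) f = status \<omega> (gr (Suc i)) f"
          using eq by (elim disjE conjE) (simp_all only:)
        have "f \<in> gr i" using cases f fe by (elim disjE conjE) simp_all
        then have ne: "?new f \<noteq> ?old f" using f by auto
        show False
        proof (cases "status \<omega> (gr i) f")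
          case None
          then have L: "f \<in> left \<omega> (gr i) \<inter> left \<omega> (gr (Suc i))"
            using \<open>f \<in> gr i\<close> f same by (auto simp: left_def)
          have "greedy_extension (left \<omega> (gr i)) (left \<omega> (gr (Suc i)))
            (left_coloring \<omega> G0 (rev (take i us))) (left_coloring \<omega> G0 (rev (take (Suc i) us)))"
            using i proper_left_coloring by (intro left_coloring_step) auto
          then have "left_coloring \<omega> G0 (rev (take (Suc i) us)) f = left_coloring \<omega> G0 (rev (take i us)) f"
            using L unfolding greedy_extension_def by blast
          then show False using ne None same by (simp add: full_coloring_def)
        next
          case (Some x)
          then show False using ne same by (simp add: full_coloring_def)
        qed
      qed
    qed
    have None: "status \<omega> H f = None" if "f \<notin> H" for H f
      using that by (cases \<omega>) simp
    have "?d \<subseteq> G"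
    proof
      fix f assume "f \<in> ?d"
      show "f \<in> G"
      proof (rule ccontr)
        assume "f \<notin> G"
        then have "status \<omega> G f = None" "status \<omega> (G - {e}) f = None" by (auto intro: None)
        then show False using \<open>f \<in> ?d\<close> by simp
      qed
    qed
    then have "finite ?d" by (rule finite_subset[OF _ finG])
    then have "card {f \<in> gr (Suc i). f \<notin> gr i \<or> ?new f \<noteq> ?old f} \<le> card ({e} \<union> ?d)"
      using sub by (intro card_mono) auto
    also have "\<dots> \<le> card {e} + card ?d" by (rule card_Un_le)
    finally show "real (recourse (gr i) ?old (gr (Suc i)) ?new) \<le> 1 + real (card ?d)"
      unfolding recourse_def by simp
  qed
  also have "\<dots> = 1 + expect space_pmf (\<lambda>\<omega>. real (card {f. status \<omega> G f \<noteq> status \<omega> (G - {e}) f}))"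
    by (simp only: expect_add finite_space integral_const measure_pmf.prob_space) simp
  also have "\<dots> \<le> 1 + ((2 * D + 1) * (1 / \<theta> ^ 35) + 1)"
    using expect_status_diff[OF G(1,2)] by (rule add_left_mono)
  finally show ?thesis by simp
qed

end

end

section \<open>Encoding the randomness as a seed\<close>

text \<open>The required seed space consists of real sequences, so a sample of the finitely supported
  distribution \<open>P\<close> is encoded by its index.\<close>

definition encode_algorithm ::
  "'s pmf \<Rightarrow> ('s \<Rightarrow> graph \<Rightarrow> graph_update list \<Rightarrow> edge \<Rightarrow> nat) \<Rightarrow> (nat \<Rightarrow> real) online_algorithm" where
  "encode_algorithm P \<phi> = \<lparr>seed = measure_pmf (map_pmf (\<lambda>\<omega> _. real (to_nat_on (set_pmf P) \<omega>)) P),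
     coloring = (\<lambda>r. \<phi> (from_nat_into (set_pmf P) (nat \<lfloor>r 0\<rfloor>)))\<rparr>"

lemma decode: "\<omega> \<in> set_pmf P \<Longrightarrow> from_nat_into (set_pmf P) (nat \<lfloor>real (to_nat_on (set_pmf P) \<omega>)\<rfloor>) = \<omega>"
  by simp

lemma randomized_encode_algorithm: "randomized_algorithm (encode_algorithm P \<phi>)"
  by (simp add: randomized_algorithm_def encode_algorithm_def measure_pmf.prob_space_axioms)

lemma always_proper_encode_algorithm:
  assumes "\<And>\<omega> i. \<omega> \<in> set_pmf P \<Longrightarrow> i \<le> length us \<Longrightarrow>
    proper_edge_coloring (graph_after G0 (take i us)) (\<phi> \<omega> G0 (take i us))"
  shows "always_proper (encode_algorithm P \<phi>) G0 us"
  unfolding always_proper_def encode_algorithm_def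
  by (simp del: measure_map_pmf, intro allI impI assms from_nat_into set_pmf_not_empty)

lemma prob_maintains_encode_algorithm:
  "prob_maintains (encode_algorithm P \<phi>) k G0 us = pr P (\<lambda>\<omega>. \<forall>i\<le>length us.
     proper_k_edge_coloring k (graph_after G0 (take i us)) (\<phi> \<omega> G0 (take i us)))"
proof -
  have "prob_maintains (encode_algorithm P \<phi>) k G0 us = pr P (\<lambda>\<omega>. \<forall>i\<le>length us.
     proper_k_edge_coloring k (graph_after G0 (take i us))
       (\<phi> (from_nat_into (set_pmf P) (nat \<lfloor>real (to_nat_on (set_pmf P) \<omega>)\<rfloor>)) G0 (take i us)))"
    unfolding prob_maintains_def encode_algorithm_def by (simp add: vimage_def)
  also have "\<dots> = pr P (\<lambda>\<omega>. \<forall>i\<le>length us.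
     proper_k_edge_coloring k (graph_after G0 (take i us)) (\<phi> \<omega> G0 (take i us)))"
    by (intro antisym pr_mono) (simp_all only: decode)
  finally show ?thesis .
qed

lemma expected_recourse_encode_algorithm:
  "expected_recourse (encode_algorithm P \<phi>) G0 us i = expect P (\<lambda>\<omega>. recourse
     (graph_after G0 (take i us)) (\<phi> \<omega> G0 (take i us))
     (graph_after G0 (take (Suc i) us)) (\<phi> \<omega> G0 (take (Suc i) us)))"
  unfolding expected_recourse_def encode_algorithm_def
  by (simp del: of_nat_add) (rule expect_cong, simp)

section \<open>Guarantees over the whole update sequence\<close>

context group_coloring_params
begin

text \<open>A union bound over all times and nodes. Obliviousness enters here: every graph of the
  sequence is fixed before the labels and seeds are drawn, so \<open>left_degree_tail\<close>
  applies to each of them.\<close>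

lemma algorithm_correct:
  assumes dyn: "dynamic_graph n \<Delta> G0 us" and K: "m * D + 2 * left_bound \<le> real K"
  defines "A \<equiv> encode_algorithm space_pmf full_coloring"
  shows "randomized_algorithm A" "always_proper A G0 us"
    "1 - real (length us + 1) * n * (exp (- (2 * \<theta> * m)) + 2 ^ m * exp (- (\<theta> ^ 3 * \<Delta> / 4)) + 2 * exp (- (\<theta> * \<Delta>)))
       \<le> prob_maintains A K G0 us"
    "i < length us \<Longrightarrow> expected_recourse A G0 us i \<le> (2 * D + 1) * (1 / \<theta> ^ 35) + 2"
proof -
  let ?G = "\<lambda>i. graph_after G0 (take i us)"
  show "randomized_algorithm A" unfolding A_def by (rule randomized_encode_algorithm)
  show "always_proper A G0 us"
    unfolding A_def by (intro always_proper_encode_algorithm full_coloring_proper[OF dyn])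
  show "expected_recourse A G0 us i \<le> (2 * D + 1) * (1 / \<theta> ^ 35) + 2" if "i < length us"
    unfolding A_def expected_recourse_encode_algorithm by (rule full_coloring_recourse[OF dyn that])
  let ?\<tau> = "exp (- (2 * \<theta> * m)) + 2 ^ m * exp (- (\<theta> ^ 3 * \<Delta> / 4)) + 2 * exp (- (\<theta> * \<Delta>))"
  let ?I = "{..length us} \<times> {..<n}"
  let ?bad = "\<lambda>(i, v) \<omega>. left_bound \<le> node_degree (left \<omega> (?G i)) v"
  have "pr space_pmf (\<lambda>\<omega>. \<exists>x\<in>?I. ?bad x \<omega>) \<le> (\<Sum>x\<in>?I. pr space_pmf (?bad x))"
    by (rule pr_UN_le) simp
  also have "\<dots> \<le> (\<Sum>x\<in>?I. ?\<tau>)"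
  proof (rule sum_mono)
    fix x assume x: "x \<in> ?I"
    obtain i v where "x = (i, v)" by (cases x)
    then show "pr space_pmf (?bad x) \<le> ?\<tau>"
      using left_degree_tail[of "?G i" v] gr[OF dyn, of i] x by simp
  qed
  also have "\<dots> = real (length us + 1) * n * ?\<tau>" by (simp add: algebra_simps)
  finally have bad: "pr space_pmf (\<lambda>\<omega>. \<exists>x\<in>?I. ?bad x \<omega>) \<le> real (length us + 1) * n * ?\<tau>" .
  have "1 - pr space_pmf (\<lambda>\<omega>. \<exists>x\<in>?I. ?bad x \<omega>) = pr space_pmf (\<lambda>\<omega>. \<not> (\<exists>x\<in>?I. ?bad x \<omega>))"
    by (rule pr_neg[symmetric])
  also have "\<dots> \<le> prob_maintains A K G0 us"
    unfolding A_def prob_maintains_encode_algorithm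
  proof (rule pr_mono, intro allI impI)
    fix \<omega> i assume \<omega>: "\<omega> \<in> set_pmf space_pmf" "\<not> (\<exists>x\<in>?I. ?bad x \<omega>)" and i: "i \<le> length us"
    have "node_degree (left \<omega> (?G i)) v < left_bound" if "i \<le> length us" "v < n" for i v
      using \<omega>(2) that by (auto simp: not_le)
    then have "full_coloring \<omega> G0 (take i us) ` ?G i \<subseteq> {..<K}"
      by (intro full_coloring_less[OF dyn \<omega>(1) i K])
    then show "proper_k_edge_coloring K (?G i) (full_coloring \<omega> G0 (take i us))"
      using full_coloring_proper[OF dyn i \<omega>(1)] by (simp add: proper_k_edge_coloring_def)
  qed
  finally show "1 - real (length us + 1) * n * ?\<tau> \<le> prob_maintains A K G0 us" using bad by linarith
qed

end

section \<open>The number of groups and the final constants\<close>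

text \<open>The ceiling of the solution \<open>m\<close> of
  \<open>(1 + \<theta>) * \<Delta> / m + 1 = D\<close>: rounding up preserves \<open>D_ge\<close>
  and keeps the total palette \<open>m * D\<close> close to \<Delta>.\<close>

definition num_groups :: "real \<Rightarrow> nat \<Rightarrow> nat" where
  "num_groups \<theta> \<Delta> = nat \<lceil>(1 + \<theta>) * \<Delta> / (group_size \<theta> - 1)\<rceil>"

lemma group_size_bounds:
  assumes "0 < \<theta>" "\<theta> \<le> 1"
  shows "1 / \<theta> ^ 12 \<le> group_size \<theta>" "group_size \<theta> \<le> 2 / \<theta> ^ 12"
proof -
  show "1 / \<theta> ^ 12 \<le> group_size \<theta>"
    unfolding group_size_def using assms by (auto simp: of_nat_nat)
  have "1 \<le> 1 / \<theta> ^ 12" using assms by (simp add: power_le_one)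
  moreover have "group_size \<theta> \<le> 1 / \<theta> ^ 12 + 1"
    unfolding group_size_def using assms by (auto simp: of_nat_nat)
  ultimately show "group_size \<theta> \<le> 2 / \<theta> ^ 12" by (simp add: add_divide_distrib[symmetric])
qed

text \<open>The exponent 13 comes from the concentration over groups: \<open>m\<close> is at least
  about \<open>\<theta> ^ 12 * \<Delta> / 2\<close>, and \<open>uncolored_tail\<close> needs
  \<open>\<theta> * m\<close> to be at least \<open>L\<close>. The other tails and all rounding
  errors are milder.\<close>

lemma parameter_choice:
  fixes \<theta> L :: real and \<Delta> :: nat
  assumes \<theta>: "0 < \<theta>" "\<theta> \<le> 1 / 4" and L: "1 \<le> L" and \<Delta>: "2 * L \<le> \<theta> ^ 13 * \<Delta>"
  defines "D \<equiv> group_size \<theta>" and "m \<equiv> num_groups \<theta> \<Delta>" and "s \<equiv> nat \<lceil>\<theta> * num_groups \<theta> \<Delta>\<rceil>"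
  shows "0 < m" "(1 + \<theta>) * \<Delta> / m + 1 \<le> D" "exp (- (\<theta>\<^sup>2 * \<Delta> / (16 * real m))) \<le> \<theta>"
    "s \<le> m" "\<theta> * m \<le> s"
    "real m * D + 2 * (20 * \<theta> * real m * D + real s * D + 6 * \<theta> * \<Delta>) \<le> (1 + 200 * \<theta>) * \<Delta> - 1"
    "exp (- (2 * \<theta> * m)) + 2 ^ m * exp (- (\<theta> ^ 3 * \<Delta> / 4)) + 2 * exp (- (\<theta> * \<Delta>)) \<le> 4 * exp (- L)"
proof -
  have Dlo: "1 / \<theta> ^ 12 \<le> D" and Dhi: "D \<le> 2 / \<theta> ^ 12"
    unfolding D_def using group_size_bounds[of \<theta>] \<theta> by auto
  have pw: "\<theta> ^ j \<le> (1 / 4) ^ j" for j using \<theta> by (intro power_mono) auto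
  have D4: "4 / \<theta> \<le> D"
  proof -
    have "4 / \<theta> \<le> 1 / \<theta> ^ 12"
    proof -
      have "4 * \<theta> ^ 11 \<le> 1" using pw[of 11] by (simp add: power_one_over)
      then have "4 * \<theta> ^ 12 \<le> \<theta>" using \<theta> mult_right_mono[of "4 * \<theta> ^ 11" 1 \<theta>] by (simp add: eval_nat_numeral mult_ac)
      then show ?thesis using \<theta> by (simp add: field_simps)
    qed
    then show ?thesis using Dlo by linarith
  qed
  have \<theta>4: "4 \<le> 1 / \<theta>" using \<theta> by (simp add: field_simps)
  have D16: "16 \<le> real D" using D4 \<theta>4 by simp
  have D1: "0 < real D - 1" using D16 by simp
  \<comment> \<open>Lets the rounding of \<open>m\<close> and of \<open>s\<close>, each of which
    costs up to \<open>D\<close> colours, disappear in multiples of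
    \<open>\<theta> * \<Delta>\<close>.\<close>
  have \<Delta>D: "D \<le> \<theta> * \<Delta>"
  proof -
    have "\<theta> ^ 12 * (2 / \<theta> ^ 12) \<le> \<theta> ^ 12 * (\<theta> * \<Delta>)"
      using \<Delta> L \<theta> by (simp add: mult.assoc[symmetric] power_Suc2[symmetric])
    then have "2 / \<theta> ^ 12 \<le> \<theta> * \<Delta>" using \<theta> by (subst (asm) mult_le_cancel_left_pos) auto
    then show ?thesis using Dhi by simp
  qed
  then have \<Delta>0: "0 < real \<Delta>" using D16 \<theta> by (metis less_le_trans mult_pos_pos not_le of_nat_0_le_iff order_le_less mult_zero_right zero_less_numeral)
  let ?q = "(1 + \<theta>) * \<Delta> / (D - 1)"
  have Dm1: "real (D - 1) = real D - 1" using D16 by (simp add: of_nat_diff)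
  have q0: "0 < ?q" using \<theta> \<Delta>0 D1 by simp
  have m: "?q \<le> m" "m \<le> ?q + 1"
    unfolding m_def num_groups_def D_def[symmetric] Dm1[symmetric] using q0[unfolded Dm1[symmetric]] by (auto simp: of_nat_nat)
  show m0: "0 < m" using q0 m by (metis less_le_trans of_nat_0_less_iff)
  have "(1 + \<theta>) * \<Delta> \<le> m * (real D - 1)" using m(1) D1 by (simp add: field_simps)
  then show Dge: "(1 + \<theta>) * \<Delta> / m + 1 \<le> D" using m0 by (simp add: field_simps)
  have mD: "m * D \<le> (1 + 4 * \<theta>) * \<Delta>"
  proof -
    have "real D / (real D - 1) \<le> 1 + \<theta>"
    proof -
      have "1 \<le> \<theta> * (real D - 1)"
      proof -
        have "4 \<le> \<theta> * D" using D4 \<theta> by (simp add: field_simps)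
        then show ?thesis using \<theta> by (simp add: algebra_simps)
      qed
      then show ?thesis using D1 by (simp add: field_simps)
    qed
    then have "(1 + \<theta>) * \<Delta> * (real D / (real D - 1)) \<le> (1 + \<theta>) * \<Delta> * (1 + \<theta>)"
      using \<theta> by (intro mult_left_mono) auto
    moreover have "m * real D \<le> (?q + 1) * D" using m by (intro mult_right_mono) auto
    ultimately have "m * real D \<le> (1 + \<theta>) * \<Delta> * (1 + \<theta>) + \<theta> * \<Delta>" using \<Delta>D Dm1 by (simp add: algebra_simps)
    also have "\<dots> = (1 + \<theta> * 3 + \<theta> * \<theta>) * \<Delta>" by (simp add: algebra_simps)
    also have "\<dots> \<le> (1 + 4 * \<theta>) * \<Delta>"
      using \<theta> mult_left_mono[of \<theta> 1 \<theta>] by (intro mult_right_mono) auto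
    finally show ?thesis by simp
  qed
  then have mD2: "real (m * D) \<le> 2 * real \<Delta>"
    using \<theta> mult_right_mono[of "1 + 4 * \<theta>" 2 "real \<Delta>"] by simp
  have m\<Delta>: "m \<le> 2 * \<theta> ^ 12 * \<Delta>"
  proof -
    have "m * (1 / \<theta> ^ 12) \<le> m * real D" using Dlo by (intro mult_left_mono) auto
    also have "\<dots> \<le> 2 * \<Delta>" using mD2 by simp
    finally show ?thesis using \<theta> by (simp add: field_simps)
  qed
  show "exp (- (\<theta>\<^sup>2 * \<Delta> / (16 * real m))) \<le> \<theta>"
  proof -
    have "1 / \<theta> \<le> \<theta>\<^sup>2 * \<Delta> / (16 * real m)"
    proof -
      have "16 * m \<le> 32 * \<theta> ^ 12 * \<Delta>" using m\<Delta> by (simp add: mult_ac)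
      also have "\<dots> = (32 * \<theta> ^ 9) * (\<theta> ^ 3 * \<Delta>)" by (simp add: mult_ac flip: power_add)
      also have "\<dots> \<le> 1 * (\<theta> ^ 3 * \<Delta>)"
        using pw[of 9] \<theta> by (intro mult_right_mono) (auto simp: power_one_over)
      finally have "16 * m \<le> \<theta> * (\<theta>\<^sup>2 * \<Delta>)" by (simp add: power2_eq_square power3_eq_cube mult.assoc)
      then show ?thesis using \<theta> m0 by (simp add: field_simps)
    qed
    moreover have "1 / \<theta> \<le> exp (1 / \<theta>)" using exp_ge_add_one_self[of "1 / \<theta>"] by linarith
    ultimately have "1 / \<theta> \<le> exp (\<theta>\<^sup>2 * \<Delta> / (16 * real m))" by (meson exp_le_cancel_iff order_trans)
    then show ?thesis using \<theta> by (simp add: exp_minus field_simps)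
  qed
  have \<theta>m1: "\<theta> * m \<le> 1 * real m" using \<theta> by (intro mult_right_mono) auto
  then show "s \<le> m" unfolding s_def m_def[symmetric] by (simp add: ceiling_le_iff)
  show sge: "\<theta> * m \<le> s" unfolding s_def m_def[symmetric] by (rule real_nat_ceiling_ge)
  have sle: "s \<le> \<theta> * m + 1"
    unfolding s_def m_def[symmetric] using of_int_ceiling_le_add_one[of "\<theta> * m"] \<theta> by simp
  show "real m * D + 2 * (20 * \<theta> * real m * D + real s * D + 6 * \<theta> * \<Delta>) \<le> (1 + 200 * \<theta>) * \<Delta> - 1"
  \<comment> \<open>Beyond \<Delta>, the multiples of \<open>\<theta> * \<Delta>\<close> are 4 from
    \<open>m * D\<close>, 80 from the edges missed by the nibble, 6 from overload at the node
    itself, 12 from overload at other endpoints, and 1 for the subtracted 1; 200 is a generous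
    total.\<close>
  proof -
    have "s * real D \<le> (\<theta> * m + 1) * D" using sle by (intro mult_right_mono) auto
    then have "s * real D \<le> \<theta> * (m * D) + \<theta> * \<Delta>" using \<Delta>D by (simp add: algebra_simps)
    moreover have "\<theta> * (m * D) \<le> \<theta> * (2 * \<Delta>)" using mD2 \<theta> by (intro mult_left_mono) auto
    moreover have "1 \<le> \<theta> * \<Delta>" using \<Delta>D D16 by linarith
    ultimately show ?thesis using mD by (simp add: algebra_simps)
  qed
  have \<theta>m: "L \<le> \<theta> * m"
  proof -
    have "m * (2 / \<theta> ^ 12) \<ge> m * real D" using Dhi by (intro mult_left_mono) auto
    moreover have "real \<Delta> \<le> m * real D"
    proof -
      have "\<Delta> \<le> (1 + \<theta>) * \<Delta>" using \<theta> by (simp add: mult_le_cancel_right1)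
      also have "\<dots> \<le> m * (real D - 1)" by fact
      also have "\<dots> \<le> m * real D" by (simp add: algebra_simps)
      finally show ?thesis .
    qed
    ultimately have "\<Delta> \<le> m * (2 / \<theta> ^ 12)" by linarith
    then have "\<theta> ^ 13 * \<Delta> \<le> \<theta> ^ 13 * (m * (2 / \<theta> ^ 12))" using \<theta> by (intro mult_left_mono) auto
    also have "\<dots> = 2 * (\<theta> * m)" using \<theta> by (simp add: power_Suc2 field_simps eval_nat_numeral)
    finally show ?thesis using \<Delta> by linarith
  qed
  show "exp (- (2 * \<theta> * m)) + 2 ^ m * exp (- (\<theta> ^ 3 * \<Delta> / 4)) + 2 * exp (- (\<theta> * \<Delta>)) \<le> 4 * exp (- L)"
  proof -
    have "exp (- (2 * \<theta> * m)) \<le> exp (- L)" using \<theta>m L by simp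
    \<comment> \<open>The sum over sets of groups is affordable: \<open>m\<close> is at most
      \<open>2 * \<theta> ^ 12 * \<Delta>\<close>, so \<open>2 * m\<close> is already below
      \<open>\<theta> ^ 3 * \<Delta> / 4\<close>.\<close>
    moreover have "2 ^ m * exp (- (\<theta> ^ 3 * \<Delta> / 4)) \<le> exp (- L)"
    proof -
      have "(2::real) ^ m \<le> exp 1 ^ m" using exp_ge_add_one_self[of 1] by (intro power_mono) auto
      also have "\<dots> = exp (real m)" by (simp flip: exp_of_nat_mult)
      finally have "2 ^ m * exp (- (\<theta> ^ 3 * \<Delta> / 4)) \<le> exp (real m) * exp (- (\<theta> ^ 3 * \<Delta> / 4))"
        by (intro mult_right_mono) auto
      also have "\<dots> = exp (m - \<theta> ^ 3 * \<Delta> / 4)" by (simp flip: exp_add)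
      also have "\<dots> \<le> exp (- L)"
      proof -
        have "8 * m \<le> 16 * \<theta> ^ 12 * \<Delta>" using m\<Delta> by (simp add: mult_ac)
        also have "\<dots> = (16 * \<theta> ^ 9) * (\<theta> ^ 3 * \<Delta>)" by (simp add: mult_ac flip: power_add)
        also have "\<dots> \<le> 1 * (\<theta> ^ 3 * \<Delta>)"
          using pw[of 9] \<theta> by (intro mult_right_mono) (auto simp: power_one_over)
        finally have "2 * m \<le> \<theta> ^ 3 * \<Delta> / 4" by simp
        moreover have "L \<le> m" using \<theta>m \<theta>m1 by simp
        ultimately show ?thesis by simp
      qed
      finally show ?thesis .
    qed
    moreover have "exp (- (\<theta> * \<Delta>)) \<le> exp (- L)"
    proof -
      have "\<theta> ^ 13 * \<Delta> \<le> \<theta> ^ 1 * \<Delta>" using \<theta> by (intro mult_right_mono power_decreasing) auto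
      then show ?thesis using \<Delta> L by simp
    qed
    ultimately show ?thesis by linarith
  qed
qed

lemma nat_floor_ge: "x \<le> y - 1 \<Longrightarrow> x \<le> real (nat \<lfloor>y\<rfloor>)"
  by linarith

theorem theorem4p6:
  "\<exists>(\<gamma>::real) (\<gamma>'::real) (c::real) (C::real) (d::nat)
     (A :: nat \<Rightarrow> nat \<Rightarrow> real \<Rightarrow> (nat \<Rightarrow> real) online_algorithm).
     0 < \<gamma> \<and> \<gamma> < 1 \<and> 0 < \<gamma>' \<and> \<gamma>' < 1 \<and> 0 < c \<and>
     (\<forall>(\<Delta> :: nat \<Rightarrow> nat) (k :: nat).
        (\<lambda>n. real (\<Delta> n)) \<in> \<omega>(\<lambda>n. ln (real n)) \<longrightarrow>
        (\<forall>\<^sub>F n in at_top. \<forall>\<epsilon>::real.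
           (ln (real n) / real (\<Delta> n)) powr \<gamma>' \<le> \<epsilon> \<and> \<epsilon> \<le> \<gamma> \<longrightarrow>
           randomized_algorithm (A n (\<Delta> n) \<epsilon>) \<and>
           (\<forall>G0 us. dynamic_graph n (\<Delta> n) G0 us \<and> length us \<le> n ^ k \<longrightarrow>
              always_proper (A n (\<Delta> n) \<epsilon>) G0 us \<and>
              prob_maintains (A n (\<Delta> n) \<epsilon>) (nat \<lfloor>(1 + \<epsilon>) * real (\<Delta> n)\<rfloor>) G0 us
                \<ge> 1 - 1 / real n powr c \<and>
              (\<forall>i < length us.
                 expected_recourse (A n (\<Delta> n) \<epsilon>) G0 us i \<le> C * (1 / \<epsilon>) ^ d))))"
proof -
  obtain \<theta>0 where \<theta>0: "0 < \<theta>0" and ex: "\<And>\<theta>. 0 < \<theta> \<Longrightarrow> \<theta> < \<theta>0 \<Longrightarrow>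
    \<forall>n. \<exists>(p :: (slot set + slot \<times> nat \<Rightarrow> bool) list pmf) col. nibble_coloring \<theta> n (group_size \<theta>) p col"
    using nibble_coloring_exists unfolding eventually_at_right_field by blast
  \<comment> \<open>One choice for all pairs of \<theta> and \<open>n\<close> at once, since the
    algorithm must be a function of \<open>n\<close>, the degree bound and \<epsilon> that is fixed
    before the sequence of degree bounds and the exponent \<open>k\<close> are given.\<close>
  have "\<forall>\<theta>n. \<exists>pc. 0 < fst \<theta>n \<longrightarrow> fst \<theta>n < \<theta>0 \<longrightarrow>
    nibble_coloring (fst \<theta>n) (snd \<theta>n) (group_size (fst \<theta>n))
      (fst pc :: (slot set + slot \<times> nat \<Rightarrow> bool) list pmf) (snd pc)"
    using ex by fastforce
  from choice[OF this] obtain pc where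
    "\<forall>\<theta>n. 0 < fst \<theta>n \<longrightarrow> fst \<theta>n < \<theta>0 \<longrightarrow>
      nibble_coloring (fst \<theta>n) (snd \<theta>n) (group_size (fst \<theta>n))
        (fst (pc \<theta>n) :: (slot set + slot \<times> nat \<Rightarrow> bool) list pmf) (snd (pc \<theta>n))" ..
  then have pc: "nibble_coloring \<theta> n (group_size \<theta>) (fst (pc (\<theta>, n))) (snd (pc (\<theta>, n)))"
    if "0 < \<theta>" "\<theta> < \<theta>0" for \<theta> n
    using that by (metis fst_conv snd_conv)
  define A where "A n \<Delta> \<epsilon> = encode_algorithm
    (group_coloring.space_pmf n (num_groups (\<epsilon> / 200) \<Delta>) (fst (pc (\<epsilon> / 200, n))))
    (group_coloring.full_coloring (group_size (\<epsilon> / 200)) (num_groups (\<epsilon> / 200) \<Delta>) (snd (pc (\<epsilon> / 200, n))))"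
    for n \<Delta> \<epsilon>
  define \<gamma> where "\<gamma> = min (1 / 2) (\<theta>0 / 2)"
  have \<gamma>: "0 < \<gamma>" "\<gamma> < 1" using \<theta>0 by (auto simp: \<gamma>_def)
  have main: "\<forall>\<^sub>F n in at_top. \<forall>\<epsilon>::real.
      (ln (real n) / real (\<Delta> n)) powr (1 / 30) \<le> \<epsilon> \<and> \<epsilon> \<le> \<gamma> \<longrightarrow>
      randomized_algorithm (A n (\<Delta> n) \<epsilon>) \<and>
      (\<forall>G0 us. dynamic_graph n (\<Delta> n) G0 us \<and> length us \<le> n ^ k \<longrightarrow>
         always_proper (A n (\<Delta> n) \<epsilon>) G0 us \<and>
         prob_maintains (A n (\<Delta> n) \<epsilon>) (nat \<lfloor>(1 + \<epsilon>) * real (\<Delta> n)\<rfloor>) G0 us \<ge> 1 - 1 / real n powr 1 \<and>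
         (\<forall>i < length us. expected_recourse (A n (\<Delta> n) \<epsilon>) G0 us i \<le> 7 * 200 ^ 47 * (1 / \<epsilon>) ^ 47))"
    if \<Delta>: "(\<lambda>n. real (\<Delta> n)) \<in> \<omega>(\<lambda>n. ln (real n))" for \<Delta> :: "nat \<Rightarrow> nat" and k :: nat
  proof -
    \<comment> \<open>Chosen so that \<open>W * ln n \<le> \<epsilon> ^ 13 * \<Delta> n\<close> is
      exactly the hypothesis of \<open>parameter_choice\<close> for
      \<open>\<theta> = \<epsilon> / 200\<close>.\<close>
    define W :: real where "W = 2 * (k + 5) * 200 ^ 13"
    have W: "1 \<le> W" unfolding W_def by simp
    have "\<forall>\<^sub>F n in at_top. W\<^sup>2 * norm (ln (real n)) \<le> norm (real (\<Delta> n))"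
      using landau_omega.smallD[OF \<Delta>, of "W\<^sup>2"] W by simp
    moreover have "\<forall>\<^sub>F n::nat in at_top. 3 \<le> n" by (rule eventually_ge_at_top)
    ultimately show ?thesis
    proof eventually_elim
      case (elim n)
      have n3: "3 \<le> real n" using elim by simp
      have "exp 1 \<le> real n" using exp_le n3 by linarith
      then have ln1: "1 \<le> ln (real n)" using n3 by (subst ln_ge_iff) auto
      show ?case
      proof (intro allI impI)
        fix \<epsilon> :: real assume \<epsilon>: "(ln (real n) / real (\<Delta> n)) powr (1 / 30) \<le> \<epsilon> \<and> \<epsilon> \<le> \<gamma>"
        define x where "x = ln (real n) / real (\<Delta> n)"
        have \<Delta>W: "W\<^sup>2 * ln (real n) \<le> \<Delta> n" using elim ln1 by simp
        have "1 * 1 \<le> W\<^sup>2 * ln (real n)" using W ln1 by (intro mult_mono) auto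
        then have \<Delta>0: "0 < real (\<Delta> n)" using \<Delta>W by linarith
        have x0: "0 < x" using \<Delta>0 ln1 by (simp add: x_def)
        then have "0 < x powr (1 / 30)" by simp
        then have \<epsilon>0: "0 < \<epsilon>" using \<epsilon> unfolding x_def by linarith
        have "x = (x powr (1 / 30)) ^ 30" using x0 by (simp add: powr_powr flip: powr_realpow)
        also have "\<dots> \<le> \<epsilon> ^ 30" using \<epsilon> by (intro power_mono) (auto simp: x_def)
        finally have \<Delta>\<epsilon>: "ln (real n) \<le> \<epsilon> ^ 30 * \<Delta> n" using \<Delta>0 by (simp add: x_def field_simps)
        define \<theta> where "\<theta> = \<epsilon> / 200"
        have \<theta>: "0 < \<theta>" "\<theta> \<le> 1 / 4" "\<theta> < \<theta>0" using \<epsilon> \<epsilon>0 by (auto simp: \<theta>_def \<gamma>_def)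
        have \<epsilon>1: "\<epsilon> \<le> 1" using \<epsilon> \<gamma> by simp
        have key: "W * ln (real n) \<le> \<epsilon> ^ 13 * \<Delta> n"
        proof -
          \<comment> \<open>A geometric mean of \<open>\<Delta> n \<ge> W\<^sup>2 * ln n\<close> and
            \<open>\<epsilon> ^ 30 * \<Delta> n \<ge> ln n\<close>, done by cases. This is why
            \<open>W\<close> was squared and why \<open>\<gamma>'\<close> is \<open>1 / 30\<close>:
            half of 30 still exceeds 13, while the superlogarithmic growth supplies the
            constant.\<close>
          have "W * ln (real n) \<le> \<epsilon> ^ 15 * \<Delta> n"
          proof (cases "W * \<epsilon> ^ 15 \<le> 1")
            case True
            have "\<epsilon> ^ 15 * (W * ln (real n)) = W * \<epsilon> ^ 15 * ln (real n)" by simp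
            also have "\<dots> \<le> 1 * ln (real n)" using True ln1 by (intro mult_right_mono) auto
            also have "\<dots> \<le> \<epsilon> ^ 15 * (\<epsilon> ^ 15 * \<Delta> n)" using \<Delta>\<epsilon> by (simp flip: power_add mult.assoc)
            finally show ?thesis using \<epsilon>0 by (subst (asm) mult_le_cancel_left_pos) auto
          next
            case False
            have "W * ln (real n) * 1 \<le> W * ln (real n) * (W * \<epsilon> ^ 15)"
              using False W ln1 by (intro mult_left_mono) auto
            also have "\<dots> = \<epsilon> ^ 15 * (W\<^sup>2 * ln (real n))" by (simp add: power2_eq_square)
            also have "\<dots> \<le> \<epsilon> ^ 15 * \<Delta> n" using \<Delta>W \<epsilon>0 by (intro mult_left_mono) auto
            finally show ?thesis by simp
          qed
          also have "\<dots> \<le> \<epsilon> ^ 13 * \<Delta> n"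
            using \<epsilon>0 \<epsilon>1 by (intro mult_right_mono power_decreasing) auto
          finally show ?thesis .
        qed
        \<comment> \<open>The union bound runs over at most \<open>2 * n ^ k * n\<close> pairs of
          time and node; with \<open>exp (- L) = 1 / n ^ (k + 5)\<close> the total failure is at
          most \<open>8 / n ^ 4\<close>, below \<open>1 / n\<close> for \<open>n\<close> at least
          3.\<close>
        define L where "L = (k + 5) * ln (real n)"
        have L1: "1 \<le> L" unfolding L_def using mult_mono[of 1 "real (k + 5)" 1 "ln (real n)"] ln1 by simp
        have "2 * L \<le> \<theta> ^ 13 * \<Delta> n"
        proof -
          have "200 ^ 13 * (2 * L) \<le> 200 ^ 13 * (\<theta> ^ 13 * \<Delta> n)"
            using key by (simp add: L_def W_def \<theta>_def power_divide algebra_simps)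
          then show ?thesis by (subst (asm) mult_le_cancel_left_pos) auto
        qed
        note par = parameter_choice[OF \<theta>(1,2) L1 this]
        let ?s = "nat \<lceil>\<theta> * num_groups \<theta> (\<Delta> n)\<rceil>"
        interpret group_coloring_params \<theta> n "group_size \<theta>" "num_groups \<theta> (\<Delta> n)"
          "fst (pc (\<theta>, n))" "snd (pc (\<theta>, n))" "\<Delta> n" ?s
          by unfold_locales (use par \<theta> pc[OF \<theta>(1,3)] in auto)
        have A_eq: "A n (\<Delta> n) \<epsilon> = encode_algorithm space_pmf full_coloring"
          by (simp add: A_def \<theta>_def)
        let ?K = "nat \<lfloor>(1 + \<epsilon>) * real (\<Delta> n)\<rfloor>"
        have K: "num_groups \<theta> (\<Delta> n) * group_size \<theta> + 2 * left_bound \<le> real ?K"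
        proof (rule nat_floor_ge)
          have "\<epsilon> = 200 * \<theta>" by (simp add: \<theta>_def)
          then show "num_groups \<theta> (\<Delta> n) * group_size \<theta> + 2 * left_bound \<le> (1 + \<epsilon>) * real (\<Delta> n) - 1"
            using par(6) unfolding left_bound_def by simp
        qed
        show "randomized_algorithm (A n (\<Delta> n) \<epsilon>) \<and>
          (\<forall>G0 us. dynamic_graph n (\<Delta> n) G0 us \<and> length us \<le> n ^ k \<longrightarrow>
             always_proper (A n (\<Delta> n) \<epsilon>) G0 us \<and>
             prob_maintains (A n (\<Delta> n) \<epsilon>) ?K G0 us \<ge> 1 - 1 / real n powr 1 \<and>
             (\<forall>i < length us. expected_recourse (A n (\<Delta> n) \<epsilon>) G0 us i \<le> 7 * 200 ^ 47 * (1 / \<epsilon>) ^ 47))"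
        proof (intro conjI allI impI)
          show "randomized_algorithm (A n (\<Delta> n) \<epsilon>)" unfolding A_eq by (rule randomized_encode_algorithm)
          fix G0 us assume dyn: "dynamic_graph n (\<Delta> n) G0 us \<and> length us \<le> n ^ k"
          note cor = algorithm_correct[OF conjunct1[OF dyn] K, folded A_eq]
          show "always_proper (A n (\<Delta> n) \<epsilon>) G0 us" by (rule cor(2))
          have "real (length us + 1) * n * (4 * exp (- L)) \<le> 1 / n"
          proof -
            have "exp (- L) = 1 / real n ^ (k + 5)"
              using n3 by (simp add: L_def exp_minus exp_of_nat_mult[of "k + 5" "ln (real n)", simplified] inverse_eq_divide)
            moreover have "real (length us + 1) \<le> 2 * real n ^ k"
            proof -
              have "real (length us) \<le> real (n ^ k)" using dyn by (subst of_nat_le_iff) simp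
              then have "real (length us) \<le> real n ^ k" by (simp only: of_nat_power)
              moreover have "1 \<le> real n ^ k" using n3 by (intro one_le_power) auto
              ultimately show ?thesis unfolding of_nat_add of_nat_1 by linarith
            qed
            ultimately have "real (length us + 1) * n * (4 * exp (- L)) \<le> (2 * real n ^ k) * n * (4 * (1 / real n ^ (k + 5)))"
              by (simp only:) (intro mult_right_mono, auto)
            also have "\<dots> = 8 / (n ^ 3) * (1 / n)" using n3 by (simp add: field_simps eval_nat_numeral power_add)
            also have "\<dots> \<le> 1 * (1 / n)"
            proof (intro mult_right_mono)
              have "(3::real) ^ 3 \<le> real n ^ 3" using n3 by (intro power_mono) auto
              then show "8 / real (n ^ 3) \<le> 1" using n3 by (simp add: divide_le_eq)
            qed simp
            finally show ?thesis by simp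
          qed
          moreover have "real (length us + 1) * n * (exp (- (2 * \<theta> * num_groups \<theta> (\<Delta> n))) +
              2 ^ num_groups \<theta> (\<Delta> n) * exp (- (\<theta> ^ 3 * \<Delta> n / 4)) + 2 * exp (- (\<theta> * \<Delta> n))) \<le>
            real (length us + 1) * n * (4 * exp (- L))"
            using par(7) by (intro mult_left_mono) auto
          ultimately have "1 - 1 / real n \<le> prob_maintains (A n (\<Delta> n) \<epsilon>) ?K G0 us"
            using cor(3) by linarith
          then show "prob_maintains (A n (\<Delta> n) \<epsilon>) ?K G0 us \<ge> 1 - 1 / real n powr 1"
            using n3 by simp
          fix i assume "i < length us"
          then have "expected_recourse (A n (\<Delta> n) \<epsilon>) G0 us i \<le> (2 * group_size \<theta> + 1) * (1 / \<theta> ^ 35) + 2"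
            by (rule cor(4))
          \<comment> \<open>The exponent is 12 from the group size plus 35 from the sensitivity of
            the nibble.\<close>
          also have "\<dots> \<le> 7 * (1 / \<theta> ^ 47)"
          proof -
            have "group_size \<theta> \<le> 2 / \<theta> ^ 12" using group_size_bounds[of \<theta>] \<theta> by auto
            moreover have "1 \<le> 1 / \<theta> ^ j" for j using \<theta> by (simp add: power_le_one)
            note one = this[of 12] this[of 47]
            ultimately have "2 * group_size \<theta> + 1 \<le> 5 / \<theta> ^ 12" by (simp add: field_simps)
            then have "(2 * group_size \<theta> + 1) * (1 / \<theta> ^ 35) \<le> 5 / \<theta> ^ 12 * (1 / \<theta> ^ 35)"
              using \<theta> by (intro mult_right_mono) auto
            also have "\<dots> = 5 * (1 / \<theta> ^ 47)" by (simp flip: power_add)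
            finally show ?thesis using one by linarith
          qed
          also have "\<dots> = 7 * 200 ^ 47 * (1 / \<epsilon>) ^ 47" by (simp add: \<theta>_def power_divide)
          finally show "expected_recourse (A n (\<Delta> n) \<epsilon>) G0 us i \<le> 7 * 200 ^ 47 * (1 / \<epsilon>) ^ 47" .
        qed
      qed
    qed
  qed
  show ?thesis
    by (rule exI[of _ \<gamma>], rule exI[of _ "1 / 30"], rule exI[of _ 1], rule exI[of _ "7 * 200 ^ 47"],
        rule exI[of _ 47], rule exI[of _ A], intro conjI allI impI main)
      (use \<gamma> in simp_all)
qed

end
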